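(* Let $\Sigma$ be a compact Riemann surface, possibly with boundary $\partial\Sigma$, and let $D\subset\Sigma$ be a finite subset which does not meet $\partial\Sigma$. Let $\omega\in\mathcal A^2(\Sigma,\star D)$. Then there exist $\alpha\in\mathcal A^2(\Sigma,\log D)$ and $\beta\in\mathcal A^{0,1}(\Sigma,\star D)$ such that $\omega=\alpha+\partial\beta$. The integral $\int_\Sigma\alpha$ is absolutely convergent, and the sum $$\int_\Sigma\alpha+\int_{\partial\Sigma}\beta$$ does not depend on the choice of $\alpha,\beta$.
   Context: $\mathcal A^{p,q}(\Sigma,\star D)$ is the space of complex-valued $(p,q)$-forms which are smooth on $\Sigma\setminus D$ and which near each $p\in D$ have the form $\alpha_0/z^N$, where $z$ is a local holomorphic coordinate with $z(p)=0$, $N\ge0$ is an integer and $\alpha_0$ is a smooth form near $p$. $\mathcal A^2(\Sigma,\star D)=\mathcal A^{1,1}(\Sigma,\star D)$. $\mathcal A^2(\Sigma,\log D)=\mathcal A^{1,1}(\Sigma,\log D)$ is the subspace of forms which near each $p\in D$ have the form $\frac{dz}z\wedge\beta_0$ with $\beta_0$ a smooth $(0,1)$-form. $\partial$ is the holomorphic de Rham differential (the $(1,0)$-part of $d$). $\partial\Sigma$ carries the induced boundary orientation. *)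

theory Defs
  imports "HOL-Analysis.Analysis"
begin

section \<open>Smooth functions on subsets of Euclidean space\<close>

text \<open>\<open>Ck_on k f S\<close> is meant for open \<open>S\<close>.\<close>

primrec Ck_on ::
    "nat \<Rightarrow> ('a::euclidean_space \<Rightarrow> 'b::real_normed_vector) \<Rightarrow> 'a set \<Rightarrow> bool" where
  "Ck_on 0 f S \<longleftrightarrow> continuous_on S f"
| "Ck_on (Suc k) f S \<longleftrightarrow>
     (\<forall>x\<in>S. f differentiable (at x)) \<and>
     (\<forall>v. Ck_on k (\<lambda>x. frechet_derivative f (at x) v) S)"

text \<open>
  On a set that need not be open (here: a relatively open part of the closed upper half plane),
  smooth means locally the restriction of a smooth function on an open set.
\<close>

definition smooth_on :: "('a::euclidean_space \<Rightarrow> 'b::real_normed_vector) \<Rightarrow> 'a set \<Rightarrow> bool" where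
  "smooth_on f S \<longleftrightarrow>
     (\<forall>x\<in>S. \<exists>V g. open V \<and> x \<in> V \<and> (\<forall>k. Ck_on k g V) \<and> (\<forall>y\<in>S \<inter> V. f y = g y))"


section \<open>Riemann surfaces with boundary\<close>

text \<open>A chart is its domain together with the coordinate; the coordinate is irrelevant
  outside the domain.\<close>

type_synonym 'a chart = "'a set \<times> ('a \<Rightarrow> complex)"

abbreviation chart_dom :: "'a chart \<Rightarrow> 'a set" where "chart_dom c \<equiv> fst c"
abbreviation coord :: "'a chart \<Rightarrow> 'a \<Rightarrow> complex" where "coord c \<equiv> snd c"
abbreviation chart_img :: "'a chart \<Rightarrow> complex set" where "chart_img c \<equiv> coord c ` chart_dom c"
abbreviation chart_inv :: "'a chart \<Rightarrow> complex \<Rightarrow> 'a" where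
  "chart_inv c \<equiv> inv_into (chart_dom c) (coord c)"

definition is_chart :: "'a topology \<Rightarrow> 'a chart \<Rightarrow> bool" where
  "is_chart X c \<longleftrightarrow>
     openin X (chart_dom c) \<and>
     (open (chart_img c) \<or> openin (top_of_set {z. 0 \<le> Im z}) (chart_img c)) \<and>
     homeomorphic_map (subtopology X (chart_dom c)) (top_of_set (chart_img c)) (coord c)"

text \<open>The transition map from \<open>c\<close> to \<open>c'\<close> is holomorphic; at boundary points this means that it
  extends holomorphically to a neighbourhood in the complex plane.\<close>

definition holo_transition :: "'a chart \<Rightarrow> 'a chart \<Rightarrow> bool" where
  "holo_transition c c' \<longleftrightarrow>
     (\<forall>x \<in> chart_dom c \<inter> chart_dom c'.
        \<exists>W F. open W \<and> coord c x \<in> W \<and> F holomorphic_on W \<and>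
          (\<forall>y \<in> chart_dom c \<inter> chart_dom c'. coord c y \<in> W \<longrightarrow> F (coord c y) = coord c' y))"

definition compatible :: "'a chart \<Rightarrow> 'a chart \<Rightarrow> bool" where
  "compatible c c' \<longleftrightarrow> holo_transition c c' \<and> holo_transition c' c"

text \<open>
  A Riemann surface, possibly with boundary and not necessarily connected. The atlas is maximal,
  so that its members are all the local holomorphic coordinates. Second countability is not
  required; it is automatic in the compact case.
\<close>

definition riemann_surface :: "'a topology \<Rightarrow> 'a chart set \<Rightarrow> bool" where
  "riemann_surface X A \<longleftrightarrow>
     Hausdorff_space X \<and>
     (\<forall>c\<in>A. is_chart X c) \<and>
     (\<Union>c\<in>A. chart_dom c) = topspace X \<and>
     (\<forall>c\<in>A. \<forall>c'\<in>A. compatible c c') \<and>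
     (\<forall>c. is_chart X c \<and> (\<forall>c'\<in>A. compatible c c') \<longrightarrow> c \<in> A)"

definition surface_boundary :: "'a chart set \<Rightarrow> 'a set" where
  "surface_boundary A = {x. \<exists>c\<in>A. x \<in> chart_dom c \<and> coord c x \<notin> interior (chart_img c)}"

text \<open>The complex derivative \<open>dz'/dz\<close> at a point \<open>x\<close>, where \<open>z\<close>, \<open>z'\<close> are the coordinates
  \<open>c\<close>, \<open>c'\<close>; it is one-sided at boundary points.\<close>

definition transition_deriv :: "'a chart \<Rightarrow> 'a chart \<Rightarrow> 'a \<Rightarrow> complex" where
  "transition_deriv c c' x =
     (THE d. ((coord c' \<circ> chart_inv c) has_field_derivative d)
        (at (coord c x) within coord c ` (chart_dom c \<inter> chart_dom c')))"


section \<open>Differential forms\<close>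

text \<open>
  A \<open>(p,q)\<close>-form, \<open>p, q \<in> {0,1}\<close>, is given by its coefficients: in the chart \<open>c\<close> with coordinate
  \<open>z\<close> the form \<open>\<omega>\<close> is \<open>\<omega> c\<close> times \<open>1\<close>, \<open>dz\<close>, \<open>dz\<^sup>-\<close> or \<open>dz \<and> dz\<^sup>-\<close>, where \<open>dz\<^sup>-\<close> is the conjugate
  of \<open>dz\<close>. The coefficient \<open>\<omega> c\<close> is a function of the point of the surface. Its values outside
  the domain of \<open>c\<close>, or at points where the form is not defined, are irrelevant.
\<close>

type_synonym 'a form = "'a chart \<Rightarrow> 'a \<Rightarrow> complex"

text \<open>Smooth forms of type \<open>(p,q)\<close> on the complement of \<open>D\<close>: the coefficients transform with
  \<open>(dz'/dz)\<^sup>p\<close> times the conjugate of \<open>(dz'/dz)\<^sup>q\<close>.\<close>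

definition smooth_forms :: "'a chart set \<Rightarrow> nat \<Rightarrow> nat \<Rightarrow> 'a set \<Rightarrow> 'a form set" where
  "smooth_forms A p q D = {\<omega>.
     (\<forall>c\<in>A. smooth_on (\<lambda>z. \<omega> c (chart_inv c z)) (coord c ` (chart_dom c - D))) \<and>
     (\<forall>c\<in>A. \<forall>c'\<in>A. \<forall>x \<in> chart_dom c \<inter> chart_dom c' - D.
        \<omega> c x = \<omega> c' x * transition_deriv c c' x ^ p * cnj (transition_deriv c c' x) ^ q)}"

text \<open>The forms in \<open>pole_forms A p q D\<close> are \<open>\<alpha>\<^sub>0 / z\<^sup>N\<close> near each point of \<open>D\<close>, where
  \<open>g\<close> is the coefficient of the smooth form \<open>\<alpha>\<^sub>0\<close>.\<close>

definition pole_forms :: "'a chart set \<Rightarrow> nat \<Rightarrow> nat \<Rightarrow> 'a set \<Rightarrow> 'a form set" where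
  "pole_forms A p q D = {\<omega> \<in> smooth_forms A p q D.
     \<forall>a\<in>D. \<exists>c\<in>A. a \<in> chart_dom c \<and> coord c a = 0 \<and> chart_dom c \<inter> D = {a} \<and>
       (\<exists>(N::nat) g. smooth_on g (chart_img c) \<and>
          (\<forall>x \<in> chart_dom c - {a}. \<omega> c x = g (coord c x) / coord c x ^ N))}"

text \<open>The \<open>(1,1)\<close>-forms with logarithmic poles are \<open>dz/z \<and> \<beta>\<^sub>0\<close> near each point of \<open>D\<close>, where
  \<open>\<beta>\<^sub>0 = g dz\<^sup>-\<close> is smooth.\<close>

definition log_forms :: "'a chart set \<Rightarrow> 'a set \<Rightarrow> 'a form set" where
  "log_forms A D = {\<alpha> \<in> pole_forms A 1 1 D.
     \<forall>a\<in>D. \<exists>c\<in>A. a \<in> chart_dom c \<and> coord c a = 0 \<and> chart_dom c \<inter> D = {a} \<and>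
       (\<exists>g. smooth_on g (chart_img c) \<and>
          (\<forall>x \<in> chart_dom c - {a}. \<alpha> c x = (1 / coord c x) * g (coord c x)))}"

text \<open>The Wirtinger derivative \<open>(\<partial>\<^sub>x - \<i> \<partial>\<^sub>y) / 2\<close>.\<close>

definition wirtinger :: "(complex \<Rightarrow> complex) \<Rightarrow> complex \<Rightarrow> complex set \<Rightarrow> complex" where
  "wirtinger f z S =
     (frechet_derivative f (at z within S) 1 - \<i> * frechet_derivative f (at z within S) \<i>) / 2"

text \<open>The operator \<open>\<partial>\<close> from \<open>(0,1)\<close>-forms on the complement of \<open>D\<close> to \<open>(1,1)\<close>-forms:
  \<open>\<partial> (b dz\<^sup>-) = (\<partial>b/\<partial>z) dz \<and> dz\<^sup>-\<close>.\<close>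

definition del :: "'a set \<Rightarrow> 'a form \<Rightarrow> 'a form" where
  "del D \<beta> = (\<lambda>c x. wirtinger (\<lambda>z. \<beta> c (chart_inv c z)) (coord c x) (coord c ` (chart_dom c - D)))"

text \<open>\<open>\<omega> = \<alpha> + \<partial>\<beta>\<close> with \<open>\<alpha>\<close> logarithmic; equality of forms is equality on the complement of \<open>D\<close>.\<close>

definition log_decomposition ::
    "'a chart set \<Rightarrow> 'a set \<Rightarrow> 'a form \<Rightarrow> 'a form \<Rightarrow> 'a form \<Rightarrow> bool" where
  "log_decomposition A D \<omega> \<alpha> \<beta> \<longleftrightarrow>
     \<alpha> \<in> log_forms A D \<and> \<beta> \<in> pole_forms A 0 1 D \<and>
     (\<forall>c\<in>A. \<forall>x \<in> chart_dom c - D. \<omega> c x = \<alpha> c x + del D \<beta> c x)"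


section \<open>Integration\<close>

text \<open>A finite smooth partition of unity \<open>\<rho> 0, \<dots>, \<rho> (n - 1)\<close> such that \<open>\<rho> i\<close> is supported in
  the domain of the chart \<open>c i\<close>.\<close>

definition partition_of_unity ::
    "'a topology \<Rightarrow> 'a chart set \<Rightarrow> nat \<Rightarrow> (nat \<Rightarrow> 'a chart) \<Rightarrow> (nat \<Rightarrow> 'a \<Rightarrow> real) \<Rightarrow> bool" where
  "partition_of_unity X A n c \<rho> \<longleftrightarrow>
     (\<forall>i<n. c i \<in> A \<and>
        (\<forall>k\<in>A. smooth_on (\<lambda>z. \<rho> i (chart_inv k z)) (chart_img k)) \<and>
        (\<forall>x\<in>topspace X. 0 \<le> \<rho> i x) \<and>
        X closure_of {x \<in> topspace X. \<rho> i x \<noteq> 0} \<subseteq> chart_dom (c i)) \<and>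
     (\<forall>x\<in>topspace X. (\<Sum>i<n. \<rho> i x) = 1)"

text \<open>
  The integral over the surface of a \<open>(1,1)\<close>-form that is defined up to finitely many points,
  as an absolutely convergent integral. The factor comes from \<open>dz \<and> dz\<^sup>- = -2\<i> dx \<and> dy\<close>.
\<close>

definition surface_integrand :: "'a chart \<Rightarrow> ('a \<Rightarrow> real) \<Rightarrow> 'a form \<Rightarrow> complex \<Rightarrow> complex" where
  "surface_integrand c r \<alpha> z =
     complex_of_real (r (chart_inv c z)) * \<alpha> c (chart_inv c z) * (- 2 * \<i>)"

definition has_surface_integral ::
    "'a topology \<Rightarrow> 'a chart set \<Rightarrow> 'a form \<Rightarrow> complex \<Rightarrow> bool" where
  "has_surface_integral X A \<alpha> I \<longleftrightarrow>
     (\<exists>n c \<rho>. partition_of_unity X A n c \<rho> \<and>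
        (\<forall>i<n. surface_integrand (c i) (\<rho> i) \<alpha> absolutely_integrable_on chart_img (c i)) \<and>
        I = (\<Sum>i<n. integral (chart_img (c i)) (surface_integrand (c i) (\<rho> i) \<alpha>)))"

text \<open>
  The integral of a \<open>(0,1)\<close>-form over the boundary. In a chart with values in the closed upper
  half plane the boundary is part of the real line, its induced orientation (outward normal
  first) is that of increasing real part, and \<open>dz\<^sup>-\<close> restricts to \<open>dt\<close>.
\<close>

definition boundary_img :: "'a chart set \<Rightarrow> 'a chart \<Rightarrow> real set" where
  "boundary_img A c = {t. complex_of_real t \<in> coord c ` (chart_dom c \<inter> surface_boundary A)}"

definition boundary_integrand :: "'a chart \<Rightarrow> ('a \<Rightarrow> real) \<Rightarrow> 'a form \<Rightarrow> real \<Rightarrow> complex" where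
  "boundary_integrand c r \<beta> t =
     complex_of_real (r (chart_inv c (complex_of_real t))) * \<beta> c (chart_inv c (complex_of_real t))"

definition has_boundary_integral ::
    "'a topology \<Rightarrow> 'a chart set \<Rightarrow> 'a form \<Rightarrow> complex \<Rightarrow> bool" where
  "has_boundary_integral X A \<beta> J \<longleftrightarrow>
     (\<exists>n c \<rho>. partition_of_unity X A n c \<rho> \<and>
        (\<forall>i<n. boundary_integrand (c i) (\<rho> i) \<beta> absolutely_integrable_on boundary_img A (c i)) \<and>
        J = (\<Sum>i<n. integral (boundary_img A (c i)) (boundary_integrand (c i) (\<rho> i) \<beta>)))"

end

theory Submission
  imports Defs "HOL-Complex_Analysis.Complex_Analysis"
begin

text \<open>
  Why the theorem holds. Near a point \<open>a \<in> D\<close> write \<open>\<omega> = g / z\<^sup>N\<close>. For \<open>N \<ge> 1\<close> the Leibniz rule gives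
  \<open>\<partial>(- g / (N z\<^sup>N)) = g / z\<^sup>N\<^sup>+\<^sup>1 - (\<partial>g / N) / z\<^sup>N\<close>, so a pole of order \<open>N + 1\<close> is exact up to a pole of order
  \<open>N\<close>; by induction every pole is exact up to \<open>h / z\<close> with \<open>h\<close> smooth (\<open>pole_reduction\<close>). Multiplying
  the local primitives by bump functions and adding them up yields a global \<open>\<beta>\<close> for which
  \<open>\<alpha> = \<omega> - \<partial>\<beta>\<close> is logarithmic (\<open>log_decomposition_exists\<close>). The integral of \<open>\<alpha>\<close> converges because
  \<open>1 / \<bar>z\<bar>\<close> is integrable in the plane (\<open>log_singular_integrable\<close>).

  For two decompositions put \<open>\<gamma> = \<beta>' - \<beta>\<close>. Then \<open>\<partial>\<gamma> = \<alpha> - \<alpha>'\<close> is logarithmic, and independence is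
  Stokes' theorem \<open>\<integral> \<partial>\<gamma> = \<integral> \<gamma>\<close> for the singular form \<open>\<gamma>\<close>, in which no residue occurs at \<open>D\<close>
  (\<open>stokes\<close>). The reason is \<open>pole_stokes\<close>: if \<open>\<gamma> = g / z\<^sup>N\<close> is cut off in a disc of radius
  \<open>e\<close>, the error is the integral of \<open>\<gamma>\<close> against the \<open>z\<close>-derivative of a radial function, which is
  \<open>cnj z\<close> times a radial function. The Taylor terms \<open>z\<^sup>j cnj z\<^sup>k\<close> of \<open>g\<close> with \<open>j + k < N\<close> contribute
  integrands of the rotational weight \<open>j - k - 1 - N < 0\<close>, whose integrals vanish; the remainder
  is bounded by a multiple of \<open>e\<close>. As \<open>\<partial>\<gamma>\<close> is absolutely integrable, \<open>e \<rightarrow> 0\<close> gives the claim.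
  Away from \<open>D\<close>, Stokes' theorem in a chart is the fundamental theorem of calculus in a half plane
  (\<open>halfplane_stokes\<close>).

  The passage to the surface uses a partition of unity \<open>\<rho>\<^sub>i\<close> that is constant near \<open>D\<close>
  (\<open>adapted_partition\<close>), so that \<open>\<partial>(\<rho>\<^sub>i \<gamma>)\<close> is again logarithmic. The forms
  \<open>\<rho>\<^sub>i \<partial>\<gamma> - \<partial>(\<rho>\<^sub>i \<gamma>)\<close> add up to zero, and their integrals do as well, because the integral of a form
  does not depend on the chart in which it is computed. That independence is proved once, in the
  locale \<open>chart_integral\<close>, and instantiated with the surface integral (change of variables with
  Jacobian \<open>\<bar>dz'/dz\<bar>\<^sup>2\<close>) and with the boundary integral (where \<open>dz'/dz\<close> is real and positive). It
  also shows that the integrals do not depend on the partition of unity.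
\<close>

section \<open>Calculus of smooth functions\<close>

lemma Ck_on_subset: "Ck_on k f S \<Longrightarrow> T \<subseteq> S \<Longrightarrow> Ck_on k f T"
proof (induction k arbitrary: f)
  case 0
  then show ?case by (auto intro: continuous_on_subset)
next
  case (Suc k)
  then show ?case by auto
qed

text \<open>The Frechet derivative in \<open>Ck_on\<close> is taken in the whole space; on an open set it is determined by the
  values on that set.\<close>

lemma Ck_on_cong:
  assumes "open S" "\<And>x. x \<in> S \<Longrightarrow> f x = g x" "Ck_on k f S"
  shows "Ck_on k g S"
  using assms(2,3)
proof (induction k arbitrary: f g)
  case 0
  then show ?case using continuous_on_cong[of S S f g] by simp
next
  case (Suc k)
  have D: "(g has_derivative frechet_derivative f (at x)) (at x)" if "x \<in> S" for x
  proof (rule has_derivative_transform_within_open[OF _ \<open>open S\<close> that Suc.prems(1)])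
    show "(f has_derivative frechet_derivative f (at x)) (at x)"
      using Suc.prems(2) that by (auto simp: frechet_derivative_works)
  qed
  have "frechet_derivative f (at x) = frechet_derivative g (at x)" if "x \<in> S" for x
    using frechet_derivative_at[OF D[OF that]] .
  then have "Ck_on k (\<lambda>x. frechet_derivative g (at x) v) S" for v
    using Suc.IH[of "\<lambda>x. frechet_derivative f (at x) v" "\<lambda>x. frechet_derivative g (at x) v"]
      Suc.prems(2) by simp
  then show ?case using D by (auto simp: differentiable_def)
qed

text \<open>Reduces the next differentiability class to a known derivative, so that the calculus below is an
  induction over the usual differentiation rules.\<close>

lemma Ck_on_SucI:
  assumes "open S" "\<And>x. x \<in> S \<Longrightarrow> (f has_derivative f' x) (at x)"
    and "\<And>v. Ck_on k (\<lambda>x. f' x v) S"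
  shows "Ck_on (Suc k) f S"
proof -
  have "Ck_on k (\<lambda>x. frechet_derivative f (at x) v) S" for v
    using Ck_on_cong[OF assms(1) _ assms(3)[of v]] frechet_derivative_at[OF assms(2)] by simp
  then show ?thesis using assms(2) by (auto simp: differentiable_def)
qed

lemma Ck_on_SucD: "Ck_on (Suc k) f S \<Longrightarrow> Ck_on k f S"
proof (induction k arbitrary: f)
  case 0
  then show ?case
    by (auto intro!: continuous_at_imp_continuous_on differentiable_imp_continuous_within)
next
  case (Suc k)
  then show ?case by (metis Ck_on.simps(2))
qed

lemma Ck_on_local:
  assumes "\<And>x. x \<in> S \<Longrightarrow> \<exists>V. open V \<and> x \<in> V \<and> Ck_on k f V"
  shows "Ck_on k f S"
  using assms
proof (induction k arbitrary: f)
  case 0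
  have "continuous (at x) f" if "x \<in> S" for x
    using 0[OF that] by (auto simp: continuous_on_eq_continuous_at)
  then show ?case by (simp add: continuous_at_imp_continuous_on)
next
  case (Suc k)
  show ?case unfolding Ck_on.simps
  proof (intro conjI ballI allI)
    show "f differentiable (at x)" if "x \<in> S" for x using Suc.prems[OF that] by auto
    show "Ck_on k (\<lambda>x. frechet_derivative f (at x) v) S" for v
      by (rule Suc.IH) (use Suc.prems in force)
  qed
qed

lemma Ck_on_has_derivative:
  "Ck_on (Suc k) f S \<Longrightarrow> x \<in> S \<Longrightarrow> (f has_derivative frechet_derivative f (at x)) (at x)"
  by (auto simp: frechet_derivative_works)

lemma Ck_on_const: "open S \<Longrightarrow> Ck_on k (\<lambda>x. c) S"
proof (induction k arbitrary: c)
  case (Suc k)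
  then show ?case by (intro Ck_on_SucI[where f'="\<lambda>x v. 0"]) auto
qed auto

lemma Ck_on_bounded_linear:
  assumes "bounded_linear L" "open S" "Ck_on k f S" shows "Ck_on k (\<lambda>x. L (f x)) S"
  using assms(3)
proof (induction k arbitrary: f)
  case 0
  then show ?case using assms(1) by (simp add: bounded_linear.continuous_on)
next
  case (Suc k)
  show ?case
  proof (rule Ck_on_SucI[OF assms(2)])
    show "((\<lambda>x. L (f x)) has_derivative (\<lambda>v. L (frechet_derivative f (at x) v))) (at x)"
      if "x \<in> S" for x
      by (rule bounded_linear.has_derivative[OF assms(1) Ck_on_has_derivative[OF Suc.prems that]])
    show "Ck_on k (\<lambda>x. L (frechet_derivative f (at x) v)) S" for v
      by (rule Suc.IH) (use Suc.prems in auto)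
  qed
qed

lemma Ck_on_add:
  assumes "open S" "Ck_on k f S" "Ck_on k g S" shows "Ck_on k (\<lambda>x. f x + g x) S"
  using assms(2,3)
proof (induction k arbitrary: f g)
  case 0
  then show ?case by (simp add: continuous_on_add)
next
  case (Suc k)
  show ?case
  proof (rule Ck_on_SucI[OF assms(1)])
    show "((\<lambda>x. f x + g x) has_derivative
       (\<lambda>v. frechet_derivative f (at x) v + frechet_derivative g (at x) v)) (at x)" if "x \<in> S" for x
      by (intro has_derivative_add Ck_on_has_derivative[OF Suc.prems(1) that]
          Ck_on_has_derivative[OF Suc.prems(2) that])
    show "Ck_on k (\<lambda>x. frechet_derivative f (at x) v + frechet_derivative g (at x) v) S" for v
      by (rule Suc.IH) (use Suc.prems in auto)
  qed
qed

lemma Ck_on_bilinear: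
  assumes "bounded_bilinear B" "open S" "Ck_on k f S" "Ck_on k g S"
  shows "Ck_on k (\<lambda>x. B (f x) (g x)) S"
  using assms(3,4)
proof (induction k arbitrary: f g)
  case 0
  then show ?case using assms(1) by (simp add: bounded_bilinear.continuous_on)
next
  case (Suc k)
  have 1: "Ck_on k f S" "Ck_on k g S" using Suc.prems Ck_on_SucD by blast+
  show ?case
  proof (rule Ck_on_SucI[OF assms(2)])
    show "((\<lambda>x. B (f x) (g x)) has_derivative
       (\<lambda>v. B (f x) (frechet_derivative g (at x) v) + B (frechet_derivative f (at x) v) (g x))) (at x)"
      if "x \<in> S" for x
      by (rule bounded_bilinear.FDERIV[OF assms(1) Ck_on_has_derivative[OF Suc.prems(1) that]
          Ck_on_has_derivative[OF Suc.prems(2) that]])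
    show "Ck_on k (\<lambda>x. B (f x) (frechet_derivative g (at x) v) +
        B (frechet_derivative f (at x) v) (g x)) S" for v
      by (rule Ck_on_add[OF assms(2)]; rule Suc.IH) (use Suc.prems 1 in auto)
  qed
qed

lemma Ck_on_inverse:
  fixes f :: "'a::euclidean_space \<Rightarrow> 'b::real_normed_div_algebra"
  assumes "open S" "Ck_on k f S" "\<And>x. x \<in> S \<Longrightarrow> f x \<noteq> 0"
  shows "Ck_on k (\<lambda>x. inverse (f x)) S"
  using assms(2)
proof (induction k)
  case 0
  then show ?case using assms(3) by (simp add: continuous_on_inverse)
next
  case (Suc k)
  have i: "Ck_on k (\<lambda>x. inverse (f x)) S" using Suc Ck_on_SucD by blast
  show ?case
  proof (rule Ck_on_SucI[OF assms(1)])
    show "((\<lambda>x. inverse (f x)) has_derivative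
       (\<lambda>v. - (inverse (f x) * frechet_derivative f (at x) v * inverse (f x)))) (at x)"
      if "x \<in> S" for x
      by (rule Deriv.has_derivative_inverse[OF assms(3)[OF that] Ck_on_has_derivative[OF Suc.prems that]])
    show "Ck_on k (\<lambda>x. - (inverse (f x) * frechet_derivative f (at x) v * inverse (f x))) S" for v
      by (intro Ck_on_bounded_linear[OF bounded_linear_minus[OF bounded_linear_ident]]
           Ck_on_bilinear[OF bounded_bilinear_mult] assms(1) i) (use Suc.prems in auto)
  qed
qed

text \<open>Differentiating \<open>g \<circ> f\<close> in direction \<open>v\<close> produces the derivative of \<open>g\<close> in a direction
  that varies with the point; expanding that direction in a basis keeps the induction going.\<close>

lemma Ck_on_compose:
  fixes f :: "'a::euclidean_space \<Rightarrow> 'b::euclidean_space" and g :: "'b \<Rightarrow> 'c::real_normed_vector"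
  assumes "open S" "Ck_on k f S" "Ck_on k g T" "f ` S \<subseteq> T"
  shows "Ck_on k (\<lambda>x. g (f x)) S"
  using assms(2,3)
proof (induction k arbitrary: g)
  case 0
  then show ?case using assms(4) by (auto intro: continuous_on_compose2)
next
  case (Suc k)
  have fk: "Ck_on k f S" using Suc.prems Ck_on_SucD by blast
  let ?f' = "\<lambda>x. frechet_derivative f (at x)" and ?g' = "\<lambda>y. frechet_derivative g (at y)"
  show ?case
  proof (rule Ck_on_SucI[OF assms(1)])
    fix x assume x: "x \<in> S"
    then have gx: "(g has_derivative ?g' (f x)) (at (f x))"
      using Ck_on_has_derivative[OF Suc.prems(2)] assms(4) by auto
    have "((\<lambda>x. g (f x)) has_derivative (\<lambda>v. ?g' (f x) (?f' x v))) (at x)"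
      using has_derivative_compose[OF Ck_on_has_derivative[OF Suc.prems(1) x] gx] .
    moreover have "?g' (f x) (?f' x v) = (\<Sum>b\<in>Basis. (?f' x v \<bullet> b) *\<^sub>R ?g' (f x) b)" for v
    proof -
      have l: "linear (?g' (f x))" using gx has_derivative_linear by blast
      have "?g' (f x) (?f' x v) = ?g' (f x) (\<Sum>b\<in>Basis. (?f' x v \<bullet> b) *\<^sub>R b)"
        by (simp add: euclidean_representation)
      then show ?thesis by (simp add: linear_sum[OF l] linear_scale[OF l])
    qed
    ultimately show "((\<lambda>x. g (f x)) has_derivative
        (\<lambda>v. \<Sum>b\<in>Basis. (?f' x v \<bullet> b) *\<^sub>R ?g' (f x) b)) (at x)" by simp
  next
    fix v
    have "Ck_on k (\<lambda>x. (?f' x v \<bullet> b) *\<^sub>R ?g' (f x) b) S" for b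
    proof (intro Ck_on_bilinear[OF bounded_bilinear_scaleR] assms(1))
      show "Ck_on k (\<lambda>x. ?f' x v \<bullet> b) S"
        by (rule Ck_on_bounded_linear[OF bounded_linear_inner_left assms(1)]) (use Suc.prems in auto)
      show "Ck_on k (\<lambda>x. ?g' (f x) b) S"
        by (rule Suc.IH[OF fk]) (use Suc.prems in auto)
    qed
    moreover have "Ck_on k (\<lambda>x. \<Sum>b\<in>I. F b x) S"
      if "finite I" "\<And>b. Ck_on k (F b) S" for I :: "'b set" and F :: "'b \<Rightarrow> 'a \<Rightarrow> 'c"
      using that(1) by induction (auto simp: Ck_on_const[OF assms(1)] intro: Ck_on_add[OF assms(1)] that)
    ultimately show "Ck_on k (\<lambda>x. \<Sum>b\<in>Basis. (?f' x v \<bullet> b) *\<^sub>R ?g' (f x) b) S" by simp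
  qed
qed

lemma Ck_on_holomorphic: "open S \<Longrightarrow> f holomorphic_on S \<Longrightarrow> Ck_on k f S"
proof (induction k arbitrary: f)
  case 0
  then show ?case by (simp add: holomorphic_on_imp_continuous_on)
next
  case (Suc k)
  show ?case
  proof (rule Ck_on_SucI[OF Suc.prems(1)])
    show "(f has_derivative (\<lambda>v. deriv f x * v)) (at x)" if "x \<in> S" for x
      using holomorphic_derivI[OF Suc.prems(2,1) that] by (simp add: has_field_derivative_def)
    show "Ck_on k (\<lambda>x. deriv f x * v) S" for v
      by (intro Ck_on_bounded_linear[OF bounded_linear_mult_left] Suc.IH holomorphic_deriv Suc.prems)
  qed
qed

abbreviation C_inf :: "('a::euclidean_space \<Rightarrow> 'b::real_normed_vector) \<Rightarrow> 'a set \<Rightarrow> bool"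
  where "C_inf f S \<equiv> \<forall>k. Ck_on k f S"

lemma C_inf_derivative:
  "C_inf f S \<Longrightarrow> x \<in> S \<Longrightarrow> (f has_derivative frechet_derivative f (at x)) (at x)"
  using Ck_on_has_derivative by blast

lemma C_inf_continuous: "C_inf f S \<Longrightarrow> continuous_on S f"
  using Ck_on.simps(1) by blast

lemma C_inf_frechet: "C_inf f S \<Longrightarrow> C_inf (\<lambda>x. frechet_derivative f (at x) v) S"
  by (metis Ck_on.simps(2))

lemma smooth_onE:
  assumes "smooth_on f S" "x \<in> S"
  obtains V g where "open V" "x \<in> V" "C_inf g V" "\<And>y. y \<in> S \<Longrightarrow> y \<in> V \<Longrightarrow> f y = g y"
  using assms unfolding smooth_on_def by (metis IntI)

lemma smooth_onI:
  assumes "\<And>x. x \<in> S \<Longrightarrow> \<exists>V g. open V \<and> x \<in> V \<and> C_inf g V \<and> (\<forall>y. y \<in> S \<longrightarrow> y \<in> V \<longrightarrow> f y = g y)"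
  shows "smooth_on f S"
  unfolding smooth_on_def
proof
  fix x assume "x \<in> S"
  then show "\<exists>V g. open V \<and> x \<in> V \<and> C_inf g V \<and> (\<forall>y\<in>S \<inter> V. f y = g y)"
    using assms[of x] by (metis IntE)
qed

text \<open>On an open set the local extensions in the definition of \<open>smooth_on\<close> are the function itself. This
  links \<open>smooth_on\<close> to the calculus of \<open>Ck_on\<close>.\<close>

lemma smooth_on_open_iff:
  assumes o: "open S" shows "smooth_on f S \<longleftrightarrow> C_inf f S"
proof
  assume s: "smooth_on f S"
  show "C_inf f S"
  proof (intro allI Ck_on_local)
    fix k x assume x: "x \<in> S"
    obtain V g where V: "open V" "x \<in> V" "C_inf g V" "\<And>y. y \<in> S \<Longrightarrow> y \<in> V \<Longrightarrow> f y = g y"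
      by (rule smooth_onE[OF s x]) (rule that)
    have "Ck_on k f (S \<inter> V)"
    proof (rule Ck_on_cong)
      show "open (S \<inter> V)" using o V(1) by blast
      show "g y = f y" if "y \<in> S \<inter> V" for y using V(4)[of y] that by simp
      show "Ck_on k g (S \<inter> V)" by (rule Ck_on_subset[OF V(3)[rule_format]]) simp
    qed
    then show "\<exists>V. open V \<and> x \<in> V \<and> Ck_on k f V"
      using o V(1,2) x by (intro exI[of _ "S \<inter> V"]) auto
  qed
next
  assume s: "C_inf f S"
  show "smooth_on f S" unfolding smooth_on_def
  proof
    fix x assume "x \<in> S"
    then show "\<exists>V g. open V \<and> x \<in> V \<and> C_inf g V \<and> (\<forall>y\<in>S \<inter> V. f y = g y)"
      using o s by (intro exI[of _ S] exI[of _ f]) simp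
  qed
qed

lemma smooth_on_subset:
  assumes "smooth_on f S" "T \<subseteq> S" shows "smooth_on f T"
proof (rule smooth_onI)
  fix x assume "x \<in> T"
  then have x: "x \<in> S" using assms by blast
  obtain V g where "open V" "x \<in> V" "C_inf g V" "\<And>y. y \<in> S \<Longrightarrow> y \<in> V \<Longrightarrow> f y = g y"
    by (rule smooth_onE[OF assms(1) x]) (rule that)
  then show "\<exists>V g. open V \<and> x \<in> V \<and> C_inf g V \<and> (\<forall>y. y \<in> T \<longrightarrow> y \<in> V \<longrightarrow> f y = g y)"
    using assms(2) by (intro exI[of _ V] exI[of _ g]) auto
qed

lemma smooth_on_cong:
  assumes "\<And>x. x \<in> S \<Longrightarrow> f x = g x" shows "smooth_on f S \<longleftrightarrow> smooth_on g S"
  unfolding smooth_on_def using assms by (intro ball_cong ex_cong1) auto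

lemma smooth_on_local:
  assumes "\<And>x. x \<in> S \<Longrightarrow> \<exists>U. open U \<and> x \<in> U \<and> smooth_on f (S \<inter> U)"
  shows "smooth_on f S"
proof (rule smooth_onI)
  fix x assume x: "x \<in> S"
  then obtain U where U: "open U" "x \<in> U" "smooth_on f (S \<inter> U)" using assms by blast
  then obtain V g where "open V" "x \<in> V" "C_inf g V" "\<And>y. y \<in> S \<inter> U \<Longrightarrow> y \<in> V \<Longrightarrow> f y = g y"
    using smooth_onE[OF U(3), of x] x by blast
  then show "\<exists>V g. open V \<and> x \<in> V \<and> C_inf g V \<and> (\<forall>y. y \<in> S \<longrightarrow> y \<in> V \<longrightarrow> f y = g y)"
    using U by (intro exI[of _ "V \<inter> U"] exI[of _ g]) (auto intro: Ck_on_subset)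
qed

lemma smooth_on_imp_continuous_on: "smooth_on f S \<Longrightarrow> continuous_on S f"
proof (rule continuous_on_eq_continuous_within[THEN iffD2], rule ballI)
  fix x assume s: "smooth_on f S" and x: "x \<in> S"
  obtain V g where V: "open V" "x \<in> V" "C_inf g V" "\<And>y. y \<in> S \<Longrightarrow> y \<in> V \<Longrightarrow> f y = g y"
    by (rule smooth_onE[OF s x]) (rule that)
  have "isCont g x"
    using iffD1[OF continuous_on_eq_continuous_at[OF V(1)] C_inf_continuous[OF V(3)]] V(2) by (rule bspec)
  then have "continuous (at x within S) g"
    by (rule continuous_at_imp_continuous_at_within)
  then have "(g \<longlongrightarrow> g x) (at x within S)" unfolding continuous_within .
  moreover have "\<forall>\<^sub>F y in at x within S. g y = f y"
    unfolding eventually_at_topological by (rule exI[of _ V]) (use V in auto)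
  ultimately have "(f \<longlongrightarrow> g x) (at x within S)" by (rule Lim_transform_eventually)
  then show "continuous (at x within S) f"
    unfolding continuous_within using V(4)[OF x V(2)] by simp
qed

lemma smooth_on_const [simp]: "smooth_on (\<lambda>x. c) S"
  unfolding smooth_on_def using Ck_on_const[OF open_UNIV] by blast

lemma smooth_on_bounded_linear:
  assumes "bounded_linear L" "smooth_on f S" shows "smooth_on (\<lambda>x. L (f x)) S"
proof (rule smooth_onI)
  fix x assume "x \<in> S"
  then obtain V g where "open V" "x \<in> V" "C_inf g V" "\<And>y. y \<in> S \<Longrightarrow> y \<in> V \<Longrightarrow> f y = g y"
    using smooth_onE[OF assms(2)] by metis
  then show "\<exists>V g. open V \<and> x \<in> V \<and> C_inf g V \<and> (\<forall>y. y \<in> S \<longrightarrow> y \<in> V \<longrightarrow> L (f y) = g y)"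
    by (intro exI[of _ V] exI[of _ "\<lambda>x. L (g x)"]) (auto intro: Ck_on_bounded_linear assms)
qed

lemma smooth_on_bilinear:
  assumes B: "bounded_bilinear B" and f: "smooth_on f S" and g: "smooth_on g S"
  shows "smooth_on (\<lambda>x. B (f x) (g x)) S"
proof (rule smooth_onI)
  fix x assume x: "x \<in> S"
  obtain V f' where V: "open V" "x \<in> V" "C_inf f' V" "\<And>y. y \<in> S \<Longrightarrow> y \<in> V \<Longrightarrow> f y = f' y"
    by (rule smooth_onE[OF f x]) (rule that)
  obtain W g' where W: "open W" "x \<in> W" "C_inf g' W" "\<And>y. y \<in> S \<Longrightarrow> y \<in> W \<Longrightarrow> g y = g' y"
    by (rule smooth_onE[OF g x]) (rule that)
  have "C_inf (\<lambda>x. B (f' x) (g' x)) (V \<inter> W)"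
    using V W by (auto intro!: Ck_on_bilinear[OF B] intro: Ck_on_subset)
  then show "\<exists>V g'. open V \<and> x \<in> V \<and> C_inf g' V \<and> (\<forall>y. y \<in> S \<longrightarrow> y \<in> V \<longrightarrow> B (f y) (g y) = g' y)"
    using V W by (intro exI[of _ "V \<inter> W"] exI[of _ "\<lambda>x. B (f' x) (g' x)"]) auto
qed

lemma smooth_on_add:
  assumes f: "smooth_on f S" and g: "smooth_on g S"
  shows "smooth_on (\<lambda>x. f x + g x) S"
proof (rule smooth_onI)
  fix x assume x: "x \<in> S"
  obtain V f' where V: "open V" "x \<in> V" "C_inf f' V" "\<And>y. y \<in> S \<Longrightarrow> y \<in> V \<Longrightarrow> f y = f' y"
    by (rule smooth_onE[OF f x]) (rule that)
  obtain W g' where W: "open W" "x \<in> W" "C_inf g' W" "\<And>y. y \<in> S \<Longrightarrow> y \<in> W \<Longrightarrow> g y = g' y"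
    by (rule smooth_onE[OF g x]) (rule that)
  have "C_inf (\<lambda>x. f' x + g' x) (V \<inter> W)"
    using V W by (auto intro!: Ck_on_add intro: Ck_on_subset)
  then show "\<exists>V g'. open V \<and> x \<in> V \<and> C_inf g' V \<and> (\<forall>y. y \<in> S \<longrightarrow> y \<in> V \<longrightarrow> f y + g y = g' y)"
    using V W by (intro exI[of _ "V \<inter> W"] exI[of _ "\<lambda>x. f' x + g' x"]) auto
qed

lemmas smooth_on_mult = smooth_on_bilinear[OF bounded_bilinear_mult]
lemmas smooth_on_minus = smooth_on_bounded_linear[OF bounded_linear_minus[OF bounded_linear_ident]]
lemmas smooth_on_cnj = smooth_on_bounded_linear[OF bounded_linear_cnj]
lemmas smooth_on_of_real = smooth_on_bounded_linear[OF bounded_linear_of_real]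

lemma smooth_on_diff: "smooth_on f S \<Longrightarrow> smooth_on g S \<Longrightarrow> smooth_on (\<lambda>x. f x - g x) S"
  using smooth_on_add[OF _ smooth_on_minus, of f S g] by simp

lemma smooth_on_sum:
  "(\<And>i. i \<in> I \<Longrightarrow> smooth_on (f i) S) \<Longrightarrow> smooth_on (\<lambda>x. \<Sum>i\<in>I. f i x) S"
  by (induction I rule: infinite_finite_induct) (auto intro: smooth_on_add)

lemma smooth_on_compose:
  fixes f :: "'a::euclidean_space \<Rightarrow> 'b::euclidean_space"
  assumes f: "smooth_on f S" and g: "smooth_on g T" and "f ` S \<subseteq> T"
  shows "smooth_on (\<lambda>x. g (f x)) S"
proof (rule smooth_onI)
  fix x assume x: "x \<in> S"
  obtain V f' where V: "open V" "x \<in> V" "C_inf f' V" "\<And>y. y \<in> S \<Longrightarrow> y \<in> V \<Longrightarrow> f y = f' y"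
    by (rule smooth_onE[OF f x]) (rule that)
  obtain W g' where W: "open W" "f x \<in> W" "C_inf g' W" "\<And>y. y \<in> T \<Longrightarrow> y \<in> W \<Longrightarrow> g y = g' y"
    using smooth_onE[OF g] x assms(3) by (metis image_subset_iff)
  define U where "U = V \<inter> f' -` W"
  have U: "open U" "x \<in> U" "U \<subseteq> V" "f' ` U \<subseteq> W"
    using continuous_open_preimage[OF C_inf_continuous[OF V(3)] V(1) W(1)] V(2,4) W(2) x
    by (auto simp: U_def)
  have "C_inf (\<lambda>x. g' (f' x)) U"
    using U V(3) W(3) by (auto intro!: Ck_on_compose[of U _ f' g' W] intro: Ck_on_subset)
  moreover have "g (f y) = g' (f' y)" if "y \<in> S" "y \<in> U" for y
  proof -
    have "f y = f' y" "f y \<in> T" "f' y \<in> W" using V(4) that U assms(3) by auto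
    then show ?thesis using W(4)[of "f y"] by simp
  qed
  ultimately show "\<exists>V h. open V \<and> x \<in> V \<and> C_inf h V \<and> (\<forall>y. y \<in> S \<longrightarrow> y \<in> V \<longrightarrow> g (f y) = h y)"
    using U by blast
qed

lemma smooth_on_holomorphic: "open W \<Longrightarrow> F holomorphic_on W \<Longrightarrow> smooth_on F W"
  by (simp add: smooth_on_open_iff Ck_on_holomorphic)

lemma smooth_on_linear: "bounded_linear L \<Longrightarrow> smooth_on L (S :: 'a::euclidean_space set)"
proof -
  assume L: "bounded_linear L"
  have "Ck_on k L UNIV" for k
  proof (cases k)
    case 0
    then show ?thesis using L by (simp add: linear_continuous_on)
  next
    case (Suc n)
    show ?thesis unfolding Suc
      by (rule Ck_on_SucI[where f'="\<lambda>x. L"]) (auto simp: Ck_on_const bounded_linear_imp_has_derivative L)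
  qed
  then show ?thesis using smooth_on_open_iff[of UNIV L] smooth_on_subset by blast
qed

lemmas smooth_on_ident = smooth_on_linear[OF bounded_linear_ident]

lemma smooth_on_inverse:
  fixes f :: "'a::euclidean_space \<Rightarrow> 'b::real_normed_div_algebra"
  assumes f: "smooth_on f S" and nz: "\<And>x. x \<in> S \<Longrightarrow> f x \<noteq> 0"
  shows "smooth_on (\<lambda>x. inverse (f x)) S"
proof (rule smooth_onI)
  fix x assume x: "x \<in> S"
  obtain V f' where V: "open V" "x \<in> V" "C_inf f' V" "\<And>y. y \<in> S \<Longrightarrow> y \<in> V \<Longrightarrow> f y = f' y"
    by (rule smooth_onE[OF f x]) (rule that)
  define U where "U = V \<inter> f' -` (-{0})"
  have U: "open U" "x \<in> U" "U \<subseteq> V"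
    using continuous_open_preimage[OF C_inf_continuous[OF V(3)] V(1), of "-{0}"] V(2)
      V(4)[OF x V(2)] nz[OF x]
    by (auto simp: U_def open_Compl)
  have "C_inf (\<lambda>x. inverse (f' x)) U"
    using U V(3) by (auto intro!: Ck_on_inverse intro: Ck_on_subset simp: U_def)
  then show "\<exists>V h. open V \<and> x \<in> V \<and> C_inf h V \<and> (\<forall>y. y \<in> S \<longrightarrow> y \<in> V \<longrightarrow> inverse (f y) = h y)"
    using U V by (intro exI[of _ U] exI[of _ "\<lambda>x. inverse (f' x)"]) auto
qed

lemma smooth_on_divide:
  fixes f :: "'a::euclidean_space \<Rightarrow> 'b::real_normed_field"
  shows "smooth_on f S \<Longrightarrow> smooth_on g S \<Longrightarrow> (\<And>x. x \<in> S \<Longrightarrow> g x \<noteq> 0) \<Longrightarrow> smooth_on (\<lambda>x. f x / g x) S"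
  unfolding divide_inverse by (intro smooth_on_mult smooth_on_inverse)

lemma smooth_on_power:
  fixes f :: "'a::euclidean_space \<Rightarrow> 'b::real_normed_field"
  shows "smooth_on f S \<Longrightarrow> smooth_on (\<lambda>x. f x ^ n) S"
  by (induction n) (auto intro: smooth_on_mult)

section \<open>The Wirtinger derivative\<close>

text \<open>At a boundary point of a half plane the derivative within the half plane is still unique,
  because the half plane accumulates at the point along every coordinate direction. \<open>thick\<close> is
  this property at all points.\<close>

definition thick :: "complex set \<Rightarrow> bool" where
  "thick S \<longleftrightarrow> (\<forall>z\<in>S. \<forall>i\<in>Basis. \<forall>e>0. \<exists>d. 0 < \<bar>d\<bar> \<and> \<bar>d\<bar> < e \<and> z + d *\<^sub>R i \<in> S)"

lemma thick_halfplane: "thick {z. a \<le> Im z}"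
  unfolding thick_def
proof (intro ballI allI impI)
  fix z i :: complex and e :: real assume "z \<in> {z. a \<le> Im z}" "i \<in> Basis" "0 < e"
  then show "\<exists>d. 0 < \<bar>d\<bar> \<and> \<bar>d\<bar> < e \<and> z + d *\<^sub>R i \<in> {z. a \<le> Im z}"
    by (intro exI[of _ "e/2"]) (auto simp: Basis_complex_def)
qed

lemma thick_openin:
  assumes "openin (top_of_set T) S" "thick T" shows "thick S"
  unfolding thick_def
proof (intro ballI allI impI)
  fix z i :: complex and e :: real assume z: "z \<in> S" and i: "i \<in> Basis" and e: "0 < e"
  obtain U where U: "open U" "S = T \<inter> U" using assms(1) by (auto simp: openin_open)
  then obtain r where r: "r > 0" "ball z r \<subseteq> U" using z open_contains_ball by blast
  obtain d where d: "0 < \<bar>d\<bar>" "\<bar>d\<bar> < min r e" "z + d *\<^sub>R i \<in> T"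
    using assms(2) z U(2) i e r(1) unfolding thick_def by (metis IntD1 min_less_iff_conj)
  have "dist z (z + d *\<^sub>R i) < r" using d(2) i by (auto simp: dist_norm)
  then show "\<exists>d. 0 < \<bar>d\<bar> \<and> \<bar>d\<bar> < e \<and> z + d *\<^sub>R i \<in> S"
    using d r U by (intro exI[of _ d]) auto
qed

lemma thick_UNIV [simp]: "thick UNIV"
  using thick_openin[OF _ thick_halfplane[of 0]] unfolding thick_def
  by (metis UNIV_I abs_of_pos dense)

lemma thick_open: "open S \<Longrightarrow> thick S"
  using thick_openin[OF _ thick_UNIV] by simp

text \<open>The possible images of charts.\<close>

definition hopen :: "complex set \<Rightarrow> bool" where
  "hopen S \<longleftrightarrow> open S \<or> openin (top_of_set {z. 0 \<le> Im z}) S"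

lemma hopen_thick: "hopen S \<Longrightarrow> thick S"
  unfolding hopen_def using thick_open thick_openin[OF _ thick_halfplane] by blast

lemma hopen_openin: "hopen S \<Longrightarrow> openin (top_of_set S) T \<Longrightarrow> hopen T"
  unfolding hopen_def using openin_open_trans openin_trans by blast

lemma hopen_borel: "hopen S \<Longrightarrow> S \<in> sets borel"
proof -
  have "{z::complex. 0 \<le> Im z} \<in> sets borel"
    by (intro borel_closed closed_Collect_le continuous_intros)
  moreover assume "hopen S"
  ultimately show ?thesis unfolding hopen_def by (auto simp: openin_open)
qed

text \<open>Uniqueness of the derivative on thick sets turns any derivative found by the differentiation rules
  into the value of \<open>wirtinger\<close>.\<close>

lemma wirtinger_eq:
  assumes "thick S" "z \<in> S" "(f has_derivative f') (at z within S)"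
  shows "wirtinger f z S = (f' 1 - \<i> * f' \<i>) / 2"
proof -
  have "(f has_derivative frechet_derivative f (at z within S)) (at z within S)"
    using assms(3) frechet_derivative_works differentiable_def by blast
  then have "frechet_derivative f (at z within S) = f'"
    using frechet_derivative_unique_within[OF _ assms(3)] assms(1,2) unfolding thick_def by metis
  then show ?thesis by (simp add: wirtinger_def)
qed

lemma smooth_on_has_derivative:
  assumes "smooth_on f S" "z \<in> S"
  shows "(f has_derivative frechet_derivative f (at z within S)) (at z within S)"
proof -
  obtain V g where V: "open V" "z \<in> V" "C_inf g V" "\<And>y. y \<in> S \<Longrightarrow> y \<in> V \<Longrightarrow> f y = g y"
    by (rule smooth_onE[OF assms]) (rule that)
  have "(g has_derivative frechet_derivative g (at z)) (at z within S)"
    by (rule has_derivative_at_withinI[OF C_inf_derivative[OF V(3,2)]])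
  then have "(f has_derivative frechet_derivative g (at z)) (at z within S)"
  proof (rule has_derivative_transform_eventually)
    show "\<forall>\<^sub>F y in at z within S. g y = f y"
      unfolding eventually_at_topological by (rule exI[of _ V]) (use V in auto)
  qed (use V assms in auto)
  then show ?thesis using frechet_derivative_works differentiable_def by blast
qed

text \<open>The Wirtinger derivative only sees the germ of the function, also when the ambient set
  changes.\<close>

lemma wirtinger_transfer:
  assumes "thick S" "thick T" "z \<in> T" "open V" "z \<in> V" "T \<inter> V \<subseteq> S"
    and "\<And>y. y \<in> T \<Longrightarrow> y \<in> V \<Longrightarrow> f y = g y" and "smooth_on g S"
  shows "wirtinger f z T = wirtinger g z S"
proof -
  have zS: "z \<in> S" using assms by auto
  let ?D = "frechet_derivative g (at z within S)"
  have D: "(g has_derivative ?D) (at z within S)" by (rule smooth_on_has_derivative[OF assms(8) zS])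
  have "(g has_derivative ?D) (at z within T \<inter> V)"
    by (rule has_derivative_subset[OF D assms(6)])
  moreover have "at z within T \<inter> V = at z within T"
    by (rule at_within_nhd[of z V]) (use assms(4,5) in auto)
  ultimately have "(g has_derivative ?D) (at z within T)" by simp
  then have "(f has_derivative ?D) (at z within T)"
  proof (rule has_derivative_transform_eventually)
    show "\<forall>\<^sub>F y in at z within T. g y = f y"
      unfolding eventually_at_topological by (rule exI[of _ V]) (use assms in auto)
  qed (use assms in auto)
  from wirtinger_eq[OF assms(2,3) this] show ?thesis
    by (simp only: wirtinger_eq[OF assms(1) zS D])
qed

text \<open>Near a point the Wirtinger derivative within \<open>S\<close> is that of a smooth extension to an open set, which
  is smooth.\<close>

lemma smooth_on_wirtinger:
  assumes "thick S" "smooth_on f S" shows "smooth_on (\<lambda>z. wirtinger f z S) S"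
proof (rule smooth_onI)
  fix z assume z: "z \<in> S"
  obtain V g where V: "open V" "z \<in> V" "C_inf g V" "\<And>y. y \<in> S \<Longrightarrow> y \<in> V \<Longrightarrow> f y = g y"
    by (rule smooth_onE[OF assms(2) z]) (rule that)
  let ?d = "\<lambda>w. (frechet_derivative g (at w) 1 - \<i> * frechet_derivative g (at w) \<i>) / 2"
  have gV: "smooth_on g V" using iffD2[OF smooth_on_open_iff[OF V(1)] V(3)] .
  have "wirtinger f w S = ?d w" if "w \<in> S" "w \<in> V" for w
  proof -
    have "wirtinger f w S = wirtinger g w V"
      by (rule wirtinger_transfer[where V=V]) (use V that assms(1) gV thick_open in auto)
    also have "\<dots> = ?d w"
      by (rule wirtinger_eq[OF thick_open[OF V(1)] that(2)
            has_derivative_at_withinI[OF C_inf_derivative[OF V(3) that(2)]]])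
    finally show ?thesis .
  qed
  moreover have "smooth_on ?d V"
    by (intro smooth_on_divide smooth_on_diff smooth_on_mult smooth_on_const)
      (simp_all add: smooth_on_open_iff[OF V(1)] C_inf_frechet[OF V(3), rule_format])
  then have "C_inf ?d V" unfolding smooth_on_open_iff[OF V(1)] .
  ultimately show "\<exists>V g. open V \<and> z \<in> V \<and> C_inf g V \<and>
      (\<forall>y. y \<in> S \<longrightarrow> y \<in> V \<longrightarrow> wirtinger f y S = g y)"
    using V(1,2) by (intro exI[of _ V] exI[of _ ?d]) simp
qed

lemma wirtinger_add:
  assumes "thick S" "z \<in> S" "smooth_on f S" "smooth_on g S"
  shows "wirtinger (\<lambda>z. f z + g z) z S = wirtinger f z S + wirtinger g z S"
  using wirtinger_eq[OF assms(1,2) has_derivative_add[OF smooth_on_has_derivative[OF assms(3,2)]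
        smooth_on_has_derivative[OF assms(4,2)]]]
  by (simp add: wirtinger_def algebra_simps diff_divide_distrib add_divide_distrib)

lemma wirtinger_diff:
  assumes "thick S" "z \<in> S" "smooth_on f S" "smooth_on g S"
  shows "wirtinger (\<lambda>z. f z - g z) z S = wirtinger f z S - wirtinger g z S"
  using wirtinger_eq[OF assms(1,2) has_derivative_diff[OF smooth_on_has_derivative[OF assms(3,2)]
        smooth_on_has_derivative[OF assms(4,2)]]]
  by (simp add: wirtinger_def algebra_simps diff_divide_distrib add_divide_distrib)

lemma wirtinger_const: "thick S \<Longrightarrow> z \<in> S \<Longrightarrow> wirtinger (\<lambda>z. c) z S = 0"
  using wirtinger_eq[OF _ _ has_derivative_const] by simp

lemma wirtinger_sum:
  assumes "thick S" "z \<in> S" "\<And>i. i \<in> I \<Longrightarrow> smooth_on (f i) S"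
  shows "wirtinger (\<lambda>z. \<Sum>i\<in>I. f i z) z S = (\<Sum>i\<in>I. wirtinger (f i) z S)"
  using assms(3)
  by (induction I rule: infinite_finite_induct)
     (auto simp: wirtinger_const assms(1,2) wirtinger_add[OF assms(1,2) _ smooth_on_sum])

lemma wirtinger_mult:
  assumes "thick S" "z \<in> S" "smooth_on f S" "smooth_on g S"
  shows "wirtinger (\<lambda>z. f z * g z) z S = f z * wirtinger g z S + wirtinger f z S * g z"
  using wirtinger_eq[OF assms(1,2) has_derivative_mult[OF smooth_on_has_derivative[OF assms(3,2)]
        smooth_on_has_derivative[OF assms(4,2)]]]
  by (simp add: wirtinger_def algebra_simps diff_divide_distrib add_divide_distrib)

lemma wirtinger_holomorphic:
  assumes "thick S" "z \<in> S" "(f has_field_derivative d) (at z within S)"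
  shows "wirtinger f z S = d"
  using wirtinger_eq[OF assms(1,2) assms(3)[unfolded has_field_derivative_def]]
  by (simp add: algebra_simps)

text \<open>The splitting of the differential into \<open>\<partial>/\<partial>z\<close> and \<open>\<partial>/\<partial>z\<^sup>-\<close>.\<close>

lemma real_linear_complex:
  assumes "linear (L :: complex \<Rightarrow> complex)"
  shows "L v = (L 1 - \<i> * L \<i>) / 2 * v + (L 1 + \<i> * L \<i>) / 2 * cnj v"
proof -
  have "v = Re v *\<^sub>R 1 + Im v *\<^sub>R \<i>" by (simp add: complex_eq_iff)
  then have "L v = L (Re v *\<^sub>R 1 + Im v *\<^sub>R \<i>)" by simp
  also have "\<dots> = Re v *\<^sub>R L 1 + Im v *\<^sub>R L \<i>"
    by (simp add: linear_add[OF assms] linear_scale[OF assms])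
  also have "\<dots> = (L 1 - \<i> * L \<i>) / 2 * v + (L 1 + \<i> * L \<i>) / 2 * cnj v"
    by (simp add: complex_eq_iff field_simps)
  finally show ?thesis .
qed

text \<open>The operator \<open>\<partial>\<close> on \<open>(0,1)\<close>-forms commutes with holomorphic changes of coordinates. The
  conjugate of \<open>F'\<close> is antiholomorphic, so that it behaves like a constant.\<close>

lemma wirtinger_pullback:
  assumes "thick S" "thick T" "z \<in> S" "smooth_on b T"
    and "open W" "z \<in> W" "F holomorphic_on W"
    and "\<And>w. w \<in> S \<Longrightarrow> w \<in> W \<Longrightarrow> F w \<in> T \<and> f w = b (F w) * cnj (deriv F w)"
  shows "wirtinger f z S = wirtinger b (F z) T * deriv F z * cnj (deriv F z)"
proof -
  have FT: "F z \<in> T" using assms by blast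
  let ?B = "frechet_derivative b (at (F z) within T)"
  let ?d = "deriv F z" and ?e = "deriv (deriv F) z"
  have B: "(b has_derivative ?B) (at (F z) within T)" by (rule smooth_on_has_derivative[OF assms(4) FT])
  have dF: "(F has_derivative (\<lambda>v. ?d * v)) (at z within S \<inter> W)"
    using holomorphic_derivI[OF assms(7,5,6)]
    by (simp add: has_field_derivative_def has_derivative_at_withinI)
  have "(deriv F has_derivative (\<lambda>v. ?e * v)) (at z within S \<inter> W)"
    using holomorphic_derivI[OF holomorphic_deriv[OF assms(7,5)] assms(5,6)]
    by (simp add: has_field_derivative_def has_derivative_at_withinI)
  from bounded_linear.has_derivative[OF bounded_linear_cnj this]
  have dc: "((\<lambda>w. cnj (deriv F w)) has_derivative (\<lambda>v. cnj (?e * v))) (at z within S \<inter> W)" .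
  have "((\<lambda>w. b (F w)) has_derivative (\<lambda>v. ?B (?d * v))) (at z within S \<inter> W)"
    by (rule has_derivative_in_compose2[OF _ _ _ dF, of T b "\<lambda>x. frechet_derivative b (at x within T)"])
      (use assms smooth_on_has_derivative in auto)
  from has_derivative_mult[OF this dc]
  have "((\<lambda>w. b (F w) * cnj (deriv F w)) has_derivative
     (\<lambda>v. b (F z) * cnj (?e * v) + ?B (?d * v) * cnj ?d)) (at z within S \<inter> W)" .
  then have "(f has_derivative
     (\<lambda>v. b (F z) * cnj (?e * v) + ?B (?d * v) * cnj ?d)) (at z within S \<inter> W)"
    by (rule has_derivative_transform[rotated 2]) (use assms in auto)
  then have "(f has_derivative
     (\<lambda>v. b (F z) * cnj (?e * v) + ?B (?d * v) * cnj ?d)) (at z within S)"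
    using at_within_nhd[of z W "S \<inter> W" S] assms by auto
  from wirtinger_eq[OF assms(1,3) this]
  have w: "wirtinger f z S = (?B ?d - \<i> * ?B (?d * \<i>)) / 2 * cnj ?d"
    by (simp add: algebra_simps diff_divide_distrib add_divide_distrib)
  define p q where "p = (?B 1 - \<i> * ?B \<i>) / 2" and "q = (?B 1 + \<i> * ?B \<i>) / 2"
  have "?B v = p * v + q * cnj v" for v
    unfolding p_def q_def by (rule real_linear_complex[OF has_derivative_linear[OF B]])
  then have "(?B ?d - \<i> * ?B (?d * \<i>)) / 2 = p * ?d"
    by (simp add: algebra_simps)
  with w show ?thesis by (simp add: wirtinger_def p_def)
qed

section \<open>A smooth cutoff function\<close>

text \<open>All derivatives of \<open>exp (-1/t)\<close>, extended by zero, have the form \<open>p (1/t) exp (-1/t)\<close> with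
  a polynomial \<open>p\<close>.\<close>

definition flat_poly :: "real poly \<Rightarrow> real \<Rightarrow> real" where
  "flat_poly p t = (if t > 0 then poly p (1 / t) * exp (- 1 / t) else 0)"

text \<open>Exponential decay beats the polynomial; this is what makes the derivative at the origin exist and vanish.\<close>

lemma flat_poly_tendsto_0: "((\<lambda>t. flat_poly p t / t) \<longlongrightarrow> 0) (at_right 0)"
proof -
  have "((\<lambda>u::real. poly q u / exp u) \<longlongrightarrow> 0) at_top" for q
  proof -
    have "((\<lambda>u::real. \<Sum>i\<le>degree q. coeff q i * (u ^ i / exp u)) \<longlongrightarrow> (\<Sum>i\<le>degree q. coeff q i * 0)) at_top"
      by (intro tendsto_sum tendsto_mult tendsto_const tendsto_power_div_exp_0)
    then show ?thesis by (simp add: poly_altdef sum_divide_distrib)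
  qed
  from this[of "p * [:0, 1:]"]
  have "((\<lambda>t. poly (p * [:0, 1:]) (inverse t) / exp (inverse t)) \<longlongrightarrow> 0) (at_right (0::real))"
    by (rule filterlim_compose) (rule filterlim_inverse_at_top_right)
  then show ?thesis
    by (rule Lim_transform_eventually)
      (auto simp: eventually_at_filter flat_poly_def field_simps exp_minus)
qed

lemma flat_poly_has_derivative:
  "(flat_poly p has_real_derivative flat_poly ((p - pderiv p) * [:0, 0, 1:]) t) (at t)"
proof -
  consider "t > 0" | "t < 0" | "t = 0" by linarith
  then show ?thesis
  proof cases
    case 1
    have "((\<lambda>t. poly p (1 / t) * exp (- 1 / t)) has_real_derivative
        flat_poly ((p - pderiv p) * [:0, 0, 1:]) t) (at t)"
      using 1 by (auto intro!: derivative_eq_intros poly_DERIV[THEN DERIV_chain2]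
          simp: flat_poly_def field_simps power2_eq_square)
    then show ?thesis
      by (rule has_field_derivative_transform_within_open[of _ _ _ "{0<..}"])
        (use 1 in \<open>auto simp: flat_poly_def\<close>)
  next
    case 2
    have "((\<lambda>t. 0) has_real_derivative flat_poly ((p - pderiv p) * [:0, 0, 1:]) t) (at t)"
      using 2 by (auto simp: flat_poly_def)
    then show ?thesis
      by (rule has_field_derivative_transform_within_open[of _ _ _ "{..<0}"])
        (use 2 in \<open>auto simp: flat_poly_def\<close>)
  next
    case 3
    have "((\<lambda>t. flat_poly p t / t) \<longlongrightarrow> 0) (at_left 0)"
      by (rule Lim_transform_eventually[OF tendsto_const])
        (auto simp: eventually_at_filter flat_poly_def)
    then have "((\<lambda>t. flat_poly p t / t) \<longlongrightarrow> 0) (at 0)"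
      using flat_poly_tendsto_0 filterlim_split_at by blast
    then show ?thesis using 3 by (simp add: has_field_derivative_iff flat_poly_def)
  qed
qed

text \<open>The derivative of a function in this family is again in the family, so that one induction over the
  order shows that all of them are smooth.\<close>

lemma smooth_on_flat_poly: "smooth_on (flat_poly p) S"
proof -
  have "Ck_on k (flat_poly p) UNIV" for k
  proof (induction k arbitrary: p)
    case 0
    then show ?case
      using flat_poly_has_derivative by (auto intro: DERIV_isCont continuous_at_imp_continuous_on)
  next
    case (Suc k)
    let ?q = "(p - pderiv p) * [:0, 0, 1:]"
    show ?case
    proof (rule Ck_on_SucI[OF open_UNIV])
      show "(flat_poly p has_derivative (\<lambda>v. flat_poly ?q x * v)) (at x)" for x
        using flat_poly_has_derivative[of p x] by (simp add: has_field_derivative_def)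
      show "Ck_on k (\<lambda>x. flat_poly ?q x * v) UNIV" for v
        by (rule Ck_on_bounded_linear[OF bounded_linear_mult_left open_UNIV Suc])
    qed
  qed
  then have "smooth_on (flat_poly p) UNIV" unfolding smooth_on_open_iff[OF open_UNIV] by (rule allI)
  then show ?thesis by (rule smooth_on_subset) simp
qed

text \<open>The quotient makes the function equal to one, not merely positive, for \<open>s \<le> 1/2\<close>: there the second
  summand of the denominator vanishes. The function will be applied to squared norms, which are smooth.\<close>

definition cutoff :: "real \<Rightarrow> real" where
  "cutoff s = flat_poly 1 (1 - s) / (flat_poly 1 (1 - s) + flat_poly 1 (s - 1/2))"

lemma flat_poly_1_nonneg: "0 \<le> flat_poly 1 t"
  and flat_poly_1_pos: "0 < t \<Longrightarrow> 0 < flat_poly 1 t"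
  and flat_poly_1_zero: "t \<le> 0 \<Longrightarrow> flat_poly 1 t = 0"
  by (auto simp: flat_poly_def)

lemma cutoff_denominator: "0 < flat_poly 1 (1 - s) + flat_poly 1 (s - 1/2)"
proof (cases "s < 1")
  case True
  then show ?thesis by (intro add_pos_nonneg flat_poly_1_nonneg flat_poly_1_pos) auto
next
  case False
  then show ?thesis by (intro add_nonneg_pos flat_poly_1_nonneg flat_poly_1_pos) auto
qed

lemma cutoff_eq_1: "s \<le> 1/2 \<Longrightarrow> cutoff s = 1"
  using cutoff_denominator[of s] by (simp add: cutoff_def flat_poly_1_zero)

lemma cutoff_eq_0: "1 \<le> s \<Longrightarrow> cutoff s = 0"
  by (simp add: cutoff_def flat_poly_1_zero)

lemma cutoff_nonneg: "0 \<le> cutoff s"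
  and cutoff_le_1: "cutoff s \<le> 1"
  unfolding cutoff_def using cutoff_denominator[of s] flat_poly_1_nonneg
  by (auto simp: divide_le_eq)

lemma smooth_on_cutoff: "smooth_on cutoff S"
proof -
  have l: "smooth_on (\<lambda>s. c - s) S" "smooth_on (\<lambda>s. s - c) S" for c :: real
    by (intro smooth_on_diff smooth_on_const smooth_on_ident)+
  have "smooth_on (\<lambda>s. flat_poly 1 (1 - s)) S"
    by (rule smooth_on_compose[OF l(1) smooth_on_flat_poly[of _ UNIV]]) simp
  moreover have "smooth_on (\<lambda>s. flat_poly 1 (s - 1/2)) S"
    by (rule smooth_on_compose[OF l(2) smooth_on_flat_poly[of _ UNIV]]) simp
  ultimately have "smooth_on (\<lambda>s. flat_poly 1 (1 - s) / (flat_poly 1 (1 - s) + flat_poly 1 (s - 1/2))) S"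
    by (intro smooth_on_divide smooth_on_add) (use cutoff_denominator in \<open>auto simp: less_imp_neq[symmetric]\<close>)
  then show ?thesis by (simp add: cutoff_def[abs_def])
qed

lemma smooth_on_norm_square:
  fixes f :: "complex \<Rightarrow> complex"
  assumes "smooth_on f S" shows "smooth_on (\<lambda>z. (norm (f z))\<^sup>2) S"
proof -
  have "smooth_on (\<lambda>z. Re (f z * cnj (f z))) S"
    by (intro smooth_on_bounded_linear[OF bounded_linear_Re] smooth_on_mult smooth_on_cnj assms)
  then show ?thesis by (simp add: cmod_power2[symmetric] power2_eq_square[symmetric])
qed

section \<open>Integration over the complex plane\<close>

text \<open>Several results on multiple integrals live on \<open>real ^ 2\<close> or on \<open>real \<times> real\<close>; they are
  transported to the complex plane along linear bijections that preserve Lebesgue measure.\<close>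

lemma measure_preserving_lebesgue:
  fixes J :: "'a::euclidean_space \<Rightarrow> 'b::euclidean_space"
  assumes "J \<in> borel_measurable borel" "distr lborel borel J = lborel"
  shows "J \<in> measurable lebesgue lebesgue" "distr lebesgue lebesgue J = lebesgue"
proof -
  have J1: "J \<in> measurable lborel lborel" using assms(1) by simp
  have "distr lborel lborel J = distr lborel borel J" by (rule distr_cong) auto
  then have D1: "distr lebesgue lborel J = lborel" using distr_completion[OF J1] assms(2) by simp
  have J2: "J \<in> measurable lebesgue lborel" by (rule measurable_completion[OF J1])
  show "J \<in> measurable lebesgue lebesgue"
    by (rule completion.measurable_completion2[OF J2]) (simp add: D1)
  have "completion (distr lebesgue lborel J) = distr lebesgue lebesgue J"
    by (rule completion.completion_distr_eq[OF J2]) (simp add: D1)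
  then show "distr lebesgue lebesgue J = lebesgue" using D1 by simp
qed

text \<open>The inverse map carries measurability of \<open>f \<circ> J\<close> back to \<open>f\<close>.\<close>

lemma measure_preserving_absolutely_integrable:
  fixes J :: "'a::euclidean_space \<Rightarrow> 'b::euclidean_space" and f :: "'b \<Rightarrow> 'c::euclidean_space"
  assumes J: "J \<in> borel_measurable borel" and K: "K \<in> borel_measurable borel"
    and KJ: "\<And>x. K (J x) = x" and JK: "\<And>y. J (K y) = y"
    and D: "distr lborel borel J = lborel"
  shows "f absolutely_integrable_on S \<longleftrightarrow> (\<lambda>x. f (J x)) absolutely_integrable_on (J -` S)" (is ?A)
    and "f absolutely_integrable_on S \<Longrightarrow> integral S f = integral (J -` S) (\<lambda>x. f (J x))"
proof -
  have DK: "distr lborel borel K = lborel"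
  proof -
    have "distr lborel borel K = distr (distr lborel borel J) borel K" by (simp add: D)
    also have "\<dots> = distr lborel borel (K \<circ> J)" using J K by (subst distr_distr) auto
    also have "K \<circ> J = (\<lambda>x. x)" using KJ by auto
    finally show ?thesis by (simp add: distr_id2)
  qed
  note J' = measure_preserving_lebesgue[OF J D] and K' = measure_preserving_lebesgue[OF K DK]
  let ?F = "\<lambda>y. indicator S y *\<^sub>R f y" and ?G = "\<lambda>x. indicator (J -` S) x *\<^sub>R f (J x)"
  have GF: "?G = (\<lambda>x. ?F (J x))" by (auto simp: indicator_def)
  have FG: "?F = (\<lambda>y. ?G (K y))" using JK by (auto simp: indicator_def)
  have m: "?F \<in> borel_measurable lebesgue \<longleftrightarrow> ?G \<in> borel_measurable lebesgue"
  proof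
    assume "?F \<in> borel_measurable lebesgue"
    from measurable_compose[OF J'(1) this] show "?G \<in> borel_measurable lebesgue"
      unfolding GF .
  next
    assume "?G \<in> borel_measurable lebesgue"
    from measurable_compose[OF K'(1) this] show "?F \<in> borel_measurable lebesgue"
      unfolding FG .
  qed
  have e: "integrable lebesgue ?F \<longleftrightarrow> integrable lebesgue ?G"
  proof (cases "?F \<in> borel_measurable lebesgue")
    case True
    from integrable_distr_eq[OF J'(1) this] show ?thesis by (simp add: J'(2) GF)
  next
    case False
    then show ?thesis using m by (meson borel_measurable_integrable)
  qed
  then show A: ?A unfolding set_integrable_def .
  assume f: "f absolutely_integrable_on S"
  then have "?F \<in> borel_measurable lebesgue"
    unfolding set_integrable_def by (rule borel_measurable_integrable)
  from integral_distr[OF J'(1) this]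
  have "integral\<^sup>L lebesgue ?F = integral\<^sup>L lebesgue ?G" by (simp add: J'(2) GF)
  then show "integral S f = integral (J -` S) (\<lambda>x. f (J x))"
    using set_lebesgue_integral_eq_integral(2)[OF f]
      set_lebesgue_integral_eq_integral(2)[OF iffD1[OF A f]]
    unfolding set_lebesgue_integral_def by simp
qed

definition complex_of_vec :: "real ^ 2 \<Rightarrow> complex" where "complex_of_vec v = Complex (v $ 1) (v $ 2)"
definition vec_of_complex :: "complex \<Rightarrow> real ^ 2" where "vec_of_complex z = vector [Re z, Im z]"
definition complex_of_pair :: "real \<times> real \<Rightarrow> complex" where "complex_of_pair p = Complex (fst p) (snd p)"

lemma vec_of_complex_inverse [simp]:
  "complex_of_vec (vec_of_complex z) = z" "vec_of_complex (complex_of_vec v) = v"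
  by (auto simp: complex_of_vec_def vec_of_complex_def vector_2 vec_eq_iff forall_2)

lemma bounded_linear_complex_of_vec: "bounded_linear complex_of_vec"
  by (rule linear_conv_bounded_linear[THEN iffD1])
    (auto simp: linear_iff complex_of_vec_def complex_eq_iff)

lemma bounded_linear_vec_of_complex: "bounded_linear vec_of_complex"
  by (rule linear_conv_bounded_linear[THEN iffD1])
    (auto simp: linear_iff vec_of_complex_def vec_eq_iff forall_2 vector_2)

lemma distr_complex_of_vec: "distr lborel borel complex_of_vec = lborel"
proof (rule lborel_eqI[symmetric])
  have m: "complex_of_vec \<in> borel_measurable borel"
    by (intro borel_measurable_continuous_onI linear_continuous_on bounded_linear_complex_of_vec)
  fix l u :: complex assume le: "\<And>b. b \<in> Basis \<Longrightarrow> l \<bullet> b \<le> u \<bullet> b"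
  have b: "complex_of_vec -` box l u = box (vec_of_complex l) (vec_of_complex u)"
    by (auto simp: mem_box Basis_complex_def Basis_vec_def complex_of_vec_def vec_of_complex_def
        vector_2 forall_2 inner_axis)
  have B: "(Basis :: (real^2) set) = {axis 1 1, axis 2 1}"
    by (auto simp: Basis_vec_def UNIV_2)
  have "emeasure (distr lborel borel complex_of_vec) (box l u)
      = emeasure lborel (box (vec_of_complex l) (vec_of_complex u))"
    using m by (simp add: emeasure_distr b)
  also have "\<dots> = (\<Prod>b\<in>Basis. (vec_of_complex u - vec_of_complex l) \<bullet> b)"
    using le[of 1] le[of \<i>] by (intro emeasure_lborel_box)
      (auto simp: Basis_complex_def B vec_of_complex_def vector_2 inner_axis)
  also have "\<dots> = (\<Prod>b\<in>Basis. (u - l) \<bullet> b)"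
    by (auto simp: Basis_complex_def B vec_of_complex_def vector_2 inner_axis axis_eq_axis)
  finally show "emeasure (distr lborel borel complex_of_vec) (box l u)
      = (\<Prod>b\<in>Basis. (u - l) \<bullet> b)" .
qed simp

lemma distr_complex_of_pair: "distr lborel borel complex_of_pair = lborel"
proof (rule lborel_eqI[symmetric])
  have m: "complex_of_pair \<in> borel_measurable borel"
    by (intro borel_measurable_continuous_onI)
      (auto simp: complex_of_pair_def[abs_def] Complex_eq intro!: continuous_intros)
  fix l u :: complex assume le: "\<And>b. b \<in> Basis \<Longrightarrow> l \<bullet> b \<le> u \<bullet> b"
  have b: "complex_of_pair -` box l u = box (Re l, Im l) (Re u, Im u)"
    by (auto simp: mem_box Basis_complex_def Basis_prod_def complex_of_pair_def)
  have "emeasure (distr lborel borel complex_of_pair) (box l u)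
      = emeasure lborel (box (Re l, Im l) (Re u, Im u))"
    using m by (simp add: emeasure_distr b)
  also have "\<dots> = (\<Prod>b\<in>Basis. ((Re u, Im u) - (Re l, Im l)) \<bullet> b)"
    using le[of 1] le[of \<i>] by (intro emeasure_lborel_box)
      (auto simp: Basis_complex_def Basis_prod_def)
  also have "\<dots> = (\<Prod>b\<in>Basis. (u - l) \<bullet> b)"
    by (auto simp: Basis_complex_def Basis_prod_def mult.commute)
  finally show "emeasure (distr lborel borel complex_of_pair) (box l u)
      = (\<Prod>b\<in>Basis. (u - l) \<bullet> b)" .
qed simp

lemma complex_vec_integrable:
  fixes f :: "complex \<Rightarrow> 'c::euclidean_space"
  shows "f absolutely_integrable_on S \<longleftrightarrow>
      (\<lambda>x. f (complex_of_vec x)) absolutely_integrable_on (complex_of_vec -` S)"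
    and "f absolutely_integrable_on S \<Longrightarrow>
      integral S f = integral (complex_of_vec -` S) (\<lambda>x. f (complex_of_vec x))"
  by (rule measure_preserving_absolutely_integrable[OF _ _ _ _ distr_complex_of_vec, of vec_of_complex];
      simp add: borel_measurable_continuous_onI linear_continuous_on
        bounded_linear_complex_of_vec bounded_linear_vec_of_complex)+

lemma complex_pair_integrable:
  fixes f :: "complex \<Rightarrow> 'c::euclidean_space"
  shows "f absolutely_integrable_on S \<longleftrightarrow>
      (\<lambda>x. f (complex_of_pair x)) absolutely_integrable_on (complex_of_pair -` S)"
    and "f absolutely_integrable_on S \<Longrightarrow>
      integral S f = integral (complex_of_pair -` S) (\<lambda>x. f (complex_of_pair x))"
proof -
  have "complex_of_pair \<in> borel_measurable borel" "(\<lambda>z. (Re z, Im z)) \<in> borel_measurable borel"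
    by (intro borel_measurable_continuous_onI;
        auto simp: complex_of_pair_def[abs_def] Complex_eq intro!: continuous_intros)+
  note * = measure_preserving_absolutely_integrable[OF this _ _ distr_complex_of_pair]
  show "f absolutely_integrable_on S \<longleftrightarrow>
      (\<lambda>x. f (complex_of_pair x)) absolutely_integrable_on (complex_of_pair -` S)"
    by (rule *(1)) (auto simp: complex_of_pair_def)
  show "f absolutely_integrable_on S \<Longrightarrow>
      integral S f = integral (complex_of_pair -` S) (\<lambda>x. f (complex_of_pair x))"
    by (rule *(2)) (auto simp: complex_of_pair_def)
qed

text \<open>The real Jacobian determinant of a holomorphic map with derivative \<open>g'\<close> is the square of
  the modulus of \<open>g'\<close>.\<close>

lemma change_of_variables_complex:
  fixes f g :: "complex \<Rightarrow> complex"
  assumes S: "S \<in> sets lebesgue"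
    and g: "\<And>z. z \<in> S \<Longrightarrow> (g has_field_derivative g' z) (at z within S)"
    and inj: "inj_on g S"
  shows "(\<lambda>z. of_real ((cmod (g' z))\<^sup>2) * f (g z)) absolutely_integrable_on S \<and>
      integral S (\<lambda>z. of_real ((cmod (g' z))\<^sup>2) * f (g z)) = b \<longleftrightarrow>
    f absolutely_integrable_on (g ` S) \<and> integral (g ` S) f = b"
proof -
  let ?J = complex_of_vec and ?K = vec_of_complex
  let ?S = "?J -` S" and ?g = "\<lambda>v. ?K (g (?J v))" and ?f = "\<lambda>v. ?K (f (?J v))"
  let ?g' = "\<lambda>v h. ?K (g' (?J v) * ?J h)"
  have Sm: "?S \<in> sets lebesgue"
  proof -
    have "?J \<in> borel_measurable borel"
      by (intro borel_measurable_continuous_onI linear_continuous_on bounded_linear_complex_of_vec)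
    then have "?J \<in> measurable lebesgue lebesgue"
      using measure_preserving_lebesgue(1) distr_complex_of_vec by blast
    from measurable_sets[OF this S] show ?thesis by simp
  qed
  have gS: "?g ` ?S = ?J -` (g ` S)"
  proof (intro set_eqI iffI)
    fix x assume "x \<in> ?J -` (g ` S)"
    then obtain z where z: "z \<in> S" "?J x = g z" by auto
    then have "x = ?g (?K z)" using vec_of_complex_inverse(2)[of x] by simp
    then show "x \<in> ?g ` ?S" using z(1) by (intro image_eqI[of _ _ "?K z"]) auto
  qed auto
  have der: "(?g has_derivative ?g' v) (at v within ?S)" if "v \<in> ?S" for v
  proof -
    have "?J v \<in> S" using that by simp
    from g[OF this, unfolded has_field_derivative_def]
    have *: "(g has_derivative (\<lambda>h. g' (?J v) * h)) (at (?J v) within S)" .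
    have "((\<lambda>v. g (?J v)) has_derivative (\<lambda>h. g' (?J v) * ?J h)) (at v within ?S)"
      by (rule has_derivative_in_compose[OF bounded_linear_imp_has_derivative[OF bounded_linear_complex_of_vec]
           has_derivative_subset[OF *]]) auto
    from bounded_linear.has_derivative[OF bounded_linear_vec_of_complex this] show ?thesis .
  qed
  have det: "\<bar>det (matrix (?g' v))\<bar> = (cmod (g' (?J v)))\<^sup>2" for v
    unfolding cmod_power2
    by (simp add: det_2 matrix_def vec_of_complex_def vector_2 complex_of_vec_def axis_def
        power2_eq_square)
  have injg: "inj_on ?g ?S"
  proof (rule inj_onI)
    fix u v assume uv: "u \<in> ?S" "v \<in> ?S" "?g u = ?g v"
    have "g (?J u) = g (?J v)"
      using arg_cong[OF uv(3), of ?J] by (simp only: vec_of_complex_inverse)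
    then have "?J u = ?J v" by (rule inj_onD[OF inj]) (use uv in auto)
    from arg_cong[OF this, of ?K] show "u = v" by (simp only: vec_of_complex_inverse)
  qed
  have lin: "h absolutely_integrable_on T \<longleftrightarrow> (\<lambda>v. ?K (h v)) absolutely_integrable_on T"
    for h :: "real^2 \<Rightarrow> complex" and T
    using absolutely_integrable_linear[OF _ bounded_linear_vec_of_complex, where f=h and s=T]
      absolutely_integrable_linear[OF _ bounded_linear_complex_of_vec, where f="\<lambda>v. ?K (h v)" and s=T]
    unfolding o_def vec_of_complex_inverse by blast
  have lin2: "integral T (\<lambda>v. ?K (h v)) = ?K (integral T h)" if "h absolutely_integrable_on T"
    for h :: "real^2 \<Rightarrow> complex" and T
    using integral_linear[OF set_lebesgue_integral_eq_integral(1)[OF that] bounded_linear_vec_of_complex]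
    by (simp add: o_def)
  have Kinj: "?K x = ?K y \<longleftrightarrow> x = y" for x y by (metis vec_of_complex_inverse(1))
  let ?h = "\<lambda>z. of_real ((cmod (g' z))\<^sup>2) * f (g z)"
  have h: "(\<lambda>v. \<bar>det (matrix (?g' v))\<bar> *\<^sub>R ?f (?g v)) = (\<lambda>v. ?K (?h (?J v)))"
    unfolding det vec_of_complex_inverse scaleR_conv_of_real[symmetric]
      linear_scale[OF bounded_linear.linear[OF bounded_linear_vec_of_complex]] ..
  have tr: "F absolutely_integrable_on T \<and> integral T F = b \<longleftrightarrow>
     (\<lambda>v. ?K (F (?J v))) absolutely_integrable_on (?J -` T) \<and>
     integral (?J -` T) (\<lambda>v. ?K (F (?J v))) = ?K b" for F :: "complex \<Rightarrow> complex" and T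
  proof (cases "F absolutely_integrable_on T")
    case True
    then have 1: "(\<lambda>v. F (?J v)) absolutely_integrable_on (?J -` T)"
      by (rule iffD1[OF complex_vec_integrable(1)])
    show ?thesis
      using True 1 iffD1[OF lin 1] by (simp only: complex_vec_integrable(2)[OF True] lin2[OF 1] Kinj)
  next
    case False
    then have "\<not> (\<lambda>v. F (?J v)) absolutely_integrable_on (?J -` T)"
      by (subst (asm) complex_vec_integrable(1))
    with False show ?thesis by (subst (asm) lin) blast
  qed
  have "?h absolutely_integrable_on S \<and> integral S ?h = b \<longleftrightarrow>
     (\<lambda>v. \<bar>det (matrix (?g' v))\<bar> *\<^sub>R ?f (?g v)) absolutely_integrable_on ?S \<and>
     integral ?S (\<lambda>v. \<bar>det (matrix (?g' v))\<bar> *\<^sub>R ?f (?g v)) = ?K b"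
    unfolding h by (rule tr)
  also have "\<dots> \<longleftrightarrow> ?f absolutely_integrable_on (?g ` ?S) \<and> integral (?g ` ?S) ?f = ?K b"
    by (rule has_absolute_integral_change_of_variables[OF Sm der injg])
  also have "\<dots> \<longleftrightarrow> f absolutely_integrable_on (g ` S) \<and> integral (g ` S) f = b"
    unfolding gS by (rule tr[symmetric])
  finally show ?thesis .
qed

lemma absolutely_integrable_compact_support:
  fixes f :: "'a::euclidean_space \<Rightarrow> 'b::euclidean_space"
  assumes "compact K" "K \<subseteq> S" "continuous_on K f" "\<And>x. x \<in> S - K \<Longrightarrow> f x = 0"
  shows "f absolutely_integrable_on S" and "integral S f = integral K f"
proof -
  obtain B where B: "\<And>x. x \<in> K \<Longrightarrow> norm (f x) \<le> B"
    using compact_imp_bounded[OF compact_continuous_image[OF assms(3,1)]]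
    unfolding bounded_iff by blast
  have "f absolutely_integrable_on K"
  proof (rule measurable_bounded_by_integrable_imp_absolutely_integrable)
    show "K \<in> sets lebesgue" using assms(1) by (simp add: compact_imp_closed borel_closed sets_completionI_sets)
    then show "f \<in> borel_measurable (lebesgue_on K)"
      by (rule continuous_imp_measurable_on_sets_lebesgue[OF assms(3)])
    show "(\<lambda>x. B) integrable_on K" using lmeasurable_compact[OF assms(1)]
      by (simp add: integrable_on_const)
    show "norm (f x) \<le> B" if "x \<in> K" for x using B that by blast
  qed
  moreover have "{x \<in> S - K. f x \<noteq> 0} = {}" "{x \<in> K - S. f x \<noteq> 0} = {}" using assms by auto
  then have "negligible {x \<in> S - K. f x \<noteq> 0}" "negligible {x \<in> K - S. f x \<noteq> 0}"
    by (simp_all only: negligible_empty)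
  ultimately show "f absolutely_integrable_on S"
    using absolutely_integrable_spike_set_eq by blast
  show "integral S f = integral K f"
    by (rule integral_spike_set) (use assms in \<open>auto intro: negligible_subset[OF negligible_empty]\<close>)
qed

text \<open>Stokes' theorem for a compactly supported \<open>(0,1)\<close>-form on a closed half plane: integrate the
  two partial derivatives by Fubini's theorem, each in its own direction first.\<close>

lemma halfplane_stokes:
  fixes f :: "complex \<Rightarrow> complex" and a R :: real
  defines "H \<equiv> {z. a \<le> Im z}"
  assumes f: "smooth_on f H" and R: "\<And>z. z \<in> H \<Longrightarrow> R < norm z \<Longrightarrow> f z = 0"
  shows "integral H (\<lambda>z. wirtinger f z H * (- 2 * \<i>)) = integral UNIV (\<lambda>t. f (Complex t a))"
proof -
  have tH: "thick H" unfolding H_def by (rule thick_halfplane)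
  define r where "r = max 0 R + 1"
  define b where "b = max a 0 + r"
  have r: "R < r" "0 < r" by (auto simp: r_def)
  let ?D = "\<lambda>z. frechet_derivative f (at z within H)"
  have D: "(f has_derivative ?D z) (at z within H)" if "z \<in> H" for z
    by (rule smooth_on_has_derivative[OF f that])
  have contD: "continuous_on H (\<lambda>z. ?D z v)" for v
  proof (rule smooth_on_imp_continuous_on, rule smooth_onI)
    fix z assume z: "z \<in> H"
    obtain V g where V: "open V" "z \<in> V" "C_inf g V" "\<And>y. y \<in> H \<Longrightarrow> y \<in> V \<Longrightarrow> f y = g y"
      by (rule smooth_onE[OF f z]) (rule that)
    have "?D y v = frechet_derivative g (at y) v" if y: "y \<in> H" "y \<in> V" for y
    proof -
      have "(f has_derivative frechet_derivative g (at y)) (at y within H)"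
      proof (rule has_derivative_transform_eventually)
        show "(g has_derivative frechet_derivative g (at y)) (at y within H)"
          by (rule has_derivative_at_withinI[OF C_inf_derivative[OF V(3) y(2)]])
        show "\<forall>\<^sub>F x in at y within H. g x = f x"
          unfolding eventually_at_topological by (rule exI[of _ V]) (use V y in auto)
      qed (use V y in auto)
      then show ?thesis
        using frechet_derivative_unique_within[OF D[OF y(1)]] tH y(1) unfolding thick_def by metis
    qed
    then show "\<exists>V g. open V \<and> z \<in> V \<and> C_inf g V \<and> (\<forall>y. y \<in> H \<longrightarrow> y \<in> V \<longrightarrow> ?D y v = g y)"
      using V C_inf_frechet[OF V(3), of v] by blast
  qed
  have D0: "?D z v = 0" if "z \<in> H" "r < norm z" for z v
  proof -
    have "(f has_derivative (\<lambda>v. 0)) (at z within H)"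
    proof (rule has_derivative_transform_eventually[OF has_derivative_const[of 0]])
      show "\<forall>\<^sub>F x in at z within H. 0 = f x"
        unfolding eventually_at_topological
        by (rule exI[of _ "{x. r < norm x}"]) (use that R r in \<open>auto intro!: open_Collect_less continuous_intros\<close>)
    qed (use that R r in auto)
    then show ?thesis
      using frechet_derivative_unique_within[OF D[OF that(1)]] tH that(1) unfolding thick_def by metis
  qed
  let ?B = "cbox (Complex (-r) a) (Complex r b)"
  have BH: "?B \<subseteq> H" by (auto simp: H_def in_cbox_complex_iff)
  have out: "r < norm z" if "z \<in> H - ?B" for z
  proof (rule ccontr)
    assume "\<not> r < norm z"
    then have "\<bar>Re z\<bar> \<le> r" "\<bar>Im z\<bar> \<le> r" using abs_Re_le_cmod[of z] abs_Im_le_cmod[of z] by linarith+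
    with that show False by (auto simp: H_def in_cbox_complex_iff b_def)
  qed
  have split: "integral H (\<lambda>z. ?D z v) = integral (cbox (-r, a) (r, b)) (\<lambda>p. ?D (complex_of_pair p) v)" for v
  proof -
    have "integral H (\<lambda>z. ?D z v) = integral ?B (\<lambda>z. ?D z v)"
      by (rule absolutely_integrable_compact_support(2)[OF compact_cbox BH
            continuous_on_subset[OF contD[of v] BH]]) (use D0 out in blast)
    also have "\<dots> = integral (complex_of_pair -` ?B) (\<lambda>p. ?D (complex_of_pair p) v)"
      by (rule complex_pair_integrable(2))
        (rule absolutely_integrable_continuous[OF continuous_on_subset[OF contD[of v] BH]])
    also have "complex_of_pair -` ?B = cbox (-r, a) (r, b)"
      by (auto simp: complex_of_pair_def in_cbox_complex_iff)
    finally show ?thesis .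
  qed
  have contP: "continuous_on (cbox (-r, a) (r, b)) (\<lambda>p. ?D (complex_of_pair p) v)" for v
  proof (rule continuous_on_compose2[OF contD[of v]])
    show "continuous_on (cbox (- r, a) (r, b)) complex_of_pair"
      by (auto simp: complex_of_pair_def[abs_def] Complex_eq intro!: continuous_intros)
  qed (auto simp: complex_of_pair_def H_def)
  have zero: "f (Complex x y) = 0" if "y \<ge> a" "\<bar>x\<bar> \<ge> r \<or> y \<ge> b" for x y
  proof -
    have "r \<le> norm (Complex x y)"
      using that abs_Re_le_cmod[of "Complex x y"] abs_Im_le_cmod[of "Complex x y"] by (auto simp: b_def)
    with R[of "Complex x y"] that r show ?thesis by (auto simp: H_def)
  qed
  have ab: "a \<le> b" by (simp add: b_def r_def)
  \<comment> \<open>Only the lower edge of the box carries a boundary value.\<close>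
  have Y: "integral {a..b} (\<lambda>y. ?D (Complex x y) \<i>) = - f (Complex x a)" for x
  proof -
    have "((\<lambda>y. ?D (Complex x y) \<i>) has_integral f (Complex x b) - f (Complex x a)) {a..b}"
    proof (rule fundamental_theorem_of_calculus[OF ab])
      fix y assume y: "y \<in> {a..b}"
      have l: "((\<lambda>y. Complex x y) has_derivative (\<lambda>h. h *\<^sub>R \<i>)) (at y within {a..b})"
        unfolding Complex_eq scaleR_conv_of_real by (auto intro!: derivative_eq_intros)
      have "((\<lambda>y. f (Complex x y)) has_derivative (\<lambda>h. ?D (Complex x y) (h *\<^sub>R \<i>))) (at y within {a..b})"
        by (rule has_derivative_in_compose2[OF _ _ y l, of H f "\<lambda>z. ?D z"])
          (use D in \<open>auto simp: H_def\<close>)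
      moreover have "?D (Complex x y) (h *\<^sub>R \<i>) = h *\<^sub>R ?D (Complex x y) \<i>" for h
        using has_derivative_linear[OF D, of "Complex x y"] y by (auto simp: H_def linear_scale)
      ultimately show "((\<lambda>y. f (Complex x y)) has_vector_derivative ?D (Complex x y) \<i>) (at y within {a..b})"
        by (simp add: has_vector_derivative_def)
    qed
    then show ?thesis using zero[of b x] ab by (simp add: integral_unique)
  qed
  have X: "integral {-r..r} (\<lambda>x. ?D (Complex x y) 1) = 0" if "a \<le> y" for y
  proof -
    have "((\<lambda>x. ?D (Complex x y) 1) has_integral f (Complex r y) - f (Complex (-r) y)) {-r..r}"
    proof (rule fundamental_theorem_of_calculus)
      show "-r \<le> r" using r by simp
      fix x assume x: "x \<in> {-r..r}"
      have l: "((\<lambda>x. Complex x y) has_derivative (\<lambda>h. h *\<^sub>R 1)) (at x within {-r..r})"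
        unfolding Complex_eq scaleR_conv_of_real by (auto intro!: derivative_eq_intros)
      have "((\<lambda>x. f (Complex x y)) has_derivative (\<lambda>h. ?D (Complex x y) (h *\<^sub>R 1))) (at x within {-r..r})"
        by (rule has_derivative_in_compose2[OF _ _ x l, of H f "\<lambda>z. ?D z"])
          (use D that in \<open>auto simp: H_def\<close>)
      moreover have "?D (Complex x y) (h *\<^sub>R 1) = h *\<^sub>R ?D (Complex x y) 1" for h
        using has_derivative_linear[OF D, of "Complex x y"] that
        by (auto simp: H_def linear_scale simp del: scaleR_conv_of_real)
      ultimately show "((\<lambda>x. f (Complex x y)) has_vector_derivative ?D (Complex x y) 1) (at x within {-r..r})"
        by (simp add: has_vector_derivative_def)
    qed
    then show ?thesis using zero[of y r] zero[of y "-r"] that r by (simp add: integral_unique)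
  qed
  \<comment> \<open>The horizontal derivative integrates to zero, the vertical one to the boundary integral.\<close>
  have I: "integral H (\<lambda>z. ?D z \<i>) = - integral UNIV (\<lambda>t. f (Complex t a))"
  proof -
    have "integral H (\<lambda>z. ?D z \<i>) =
        integral {-r..r} (\<lambda>x. integral {a..b} (\<lambda>y. ?D (complex_of_pair (x, y)) \<i>))"
      unfolding split using integral_prod_continuous[OF contP[of \<i>]] by simp
    also have "\<dots> = integral {-r..r} (\<lambda>x. - f (Complex x a))" by (simp add: Y complex_of_pair_def)
    also have "\<dots> = - integral {-r..r} (\<lambda>x. f (Complex x a))" by simp
    also have "integral {-r..r} (\<lambda>x. f (Complex x a)) = integral UNIV (\<lambda>x. f (Complex x a))"
      by (rule integral_spike_set) (use zero in \<open>force intro: negligible_subset[OF negligible_empty]\<close>)+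
    finally show ?thesis .
  qed
  have one: "integral H (\<lambda>z. ?D z 1) = 0"
  proof -
    have "integral H (\<lambda>z. ?D z 1) =
        integral (cbox (- r) r) (\<lambda>x. integral (cbox a b) (\<lambda>y. ?D (complex_of_pair (x, y)) 1))"
      unfolding split using integral_prod_continuous[OF contP[of 1]] by simp
    also have "\<dots> = integral (cbox a b) (\<lambda>y. integral (cbox (- r) r) (\<lambda>x. ?D (complex_of_pair (x, y)) 1))"
      by (rule integral_swap_continuous) (use contP[of 1] in \<open>simp add: case_prod_unfold\<close>)
    also have "\<dots> = integral (cbox a b) (\<lambda>y. 0)"
      by (rule integral_cong) (simp add: X complex_of_pair_def)
    finally show ?thesis by simp
  qed
  have int: "(\<lambda>z. ?D z v) integrable_on H" for v
  proof -
    have "(\<lambda>z. ?D z v) absolutely_integrable_on H"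
      by (rule absolutely_integrable_compact_support(1)[OF compact_cbox BH
            continuous_on_subset[OF contD[of v] BH]]) (use D0 out in blast)
    then show ?thesis by (rule set_lebesgue_integral_eq_integral(1))
  qed
  have pq: "(p - \<i> * q) / 2 * (- 2 * \<i>) = - \<i> * p - q" for p q :: complex
    by (simp add: complex_eq_iff)
  have "((\<lambda>z. - \<i> * ?D z 1 - ?D z \<i>) has_integral
      - \<i> * integral H (\<lambda>z. ?D z 1) - integral H (\<lambda>z. ?D z \<i>)) H"
    by (intro has_integral_diff has_integral_mult_right integrable_integral int)
  then have "((\<lambda>z. wirtinger f z H * (- 2 * \<i>)) has_integral
      - \<i> * integral H (\<lambda>z. ?D z 1) - integral H (\<lambda>z. ?D z \<i>)) H"
    unfolding wirtinger_def pq .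
  from integral_unique[OF this] show ?thesis unfolding I one by simp
qed

text \<open>Points of \<open>T\<close> outside \<open>S\<close> are outside the closed set \<open>K\<close> and so have a neighbourhood on which the extension
  vanishes.\<close>

lemma smooth_on_extend_zero:
  assumes "openin (top_of_set T) S" "compact K" "smooth_on f S" "\<And>z. z \<in> S - K \<Longrightarrow> f z = 0" "K \<inter> T \<subseteq> S"
  shows "smooth_on (\<lambda>z. if z \<in> S then f z else 0) T"
proof (rule smooth_on_local)
  fix x assume x: "x \<in> T"
  obtain U where U: "open U" "S = T \<inter> U" using assms(1) by (auto simp: openin_open)
  show "\<exists>U. open U \<and> x \<in> U \<and> smooth_on (\<lambda>z. if z \<in> S then f z else 0) (T \<inter> U)"
  proof (cases "x \<in> S")
    case True
    have "smooth_on (\<lambda>z. if z \<in> S then f z else 0) (T \<inter> U)"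
      using smooth_on_cong[of "T \<inter> U" "\<lambda>z. if z \<in> S then f z else 0" f] assms(3) U(2) by simp
    then show ?thesis using U True by blast
  next
    case False
    have "smooth_on (\<lambda>z. if z \<in> S then f z else 0) (T \<inter> - K)"
      using smooth_on_cong[of "T \<inter> - K" "\<lambda>z. if z \<in> S then f z else 0" "\<lambda>z. 0"] assms(4) by simp
    moreover have "open (- K)" using assms(2) compact_imp_closed by blast
    moreover have "x \<in> - K" using False assms(5) x by blast
    ultimately show ?thesis by blast
  qed
qed

lemma wirtinger_eq_0_outside:
  assumes "thick S" "closed K" "z \<in> S - K" "\<And>z. z \<in> S - K \<Longrightarrow> f z = 0"
  shows "wirtinger f z S = 0"
proof -
  have "wirtinger f z S = wirtinger (\<lambda>z. 0) z S"
    by (rule wirtinger_transfer[where V="- K"]) (use assms in auto)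
  then show ?thesis using wirtinger_const[OF assms(1)] assms(3) by simp
qed

text \<open>A compactly supported function can be moved from \<open>S\<close> to another domain \<open>T\<close> that agrees with \<open>S\<close>
  near the support.\<close>

lemma wirtinger_integral_extend:
  assumes "thick S" "thick T" "compact K" "K \<subseteq> S" "\<And>z. z \<in> S - K \<Longrightarrow> f z = 0"
    and "smooth_on (\<lambda>z. if z \<in> S then f z else 0) T" (is "smooth_on ?F T")
    and V: "\<And>z. z \<in> K \<Longrightarrow> \<exists>V. open V \<and> z \<in> V \<and> S \<inter> V \<subseteq> T"
  shows "integral S (\<lambda>z. wirtinger f z S * c) = integral T (\<lambda>z. wirtinger ?F z T * c)"
proof -
  have cK: "closed K" using assms(3) by (rule compact_imp_closed)
  have eq: "wirtinger f z S = wirtinger ?F z T" if z: "z \<in> K" for z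
  proof -
    obtain V where "open V" "z \<in> V" "S \<inter> V \<subseteq> T" using V[OF z] by blast
    then show ?thesis
      by (intro wirtinger_transfer[where V=V]) (use assms z in auto)
  qed
  have KT: "K \<subseteq> T" using V assms(4) by blast
  have "integral S (\<lambda>z. wirtinger f z S * c) = integral K (\<lambda>z. wirtinger f z S * c)"
    by (rule integral_spike_set)
      (use wirtinger_eq_0_outside[OF assms(1) cK _ assms(5)] assms(4) in \<open>auto intro: negligible_subset[OF negligible_empty]\<close>)
  also have "\<dots> = integral K (\<lambda>z. wirtinger ?F z T * c)"
    by (rule integral_cong) (simp add: eq)
  also have "\<dots> = integral T (\<lambda>z. wirtinger ?F z T * c)"
    by (rule integral_spike_set)
      (use wirtinger_eq_0_outside[OF assms(2) cK, of _ ?F] assms(5) KT in \<open>auto intro: negligible_subset[OF negligible_empty]\<close>)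
  finally show ?thesis .
qed

text \<open>A horizontal line below the support bounds a half plane on whose boundary the function vanishes.\<close>

lemma compact_support_stokes_open:
  assumes "open S" "compact K" "K \<subseteq> S" "smooth_on f S" "\<And>z. z \<in> S - K \<Longrightarrow> f z = 0"
  shows "integral S (\<lambda>z. wirtinger f z S * (- 2 * \<i>)) = 0"
proof -
  let ?F = "\<lambda>z. if z \<in> S then f z else 0"
  obtain R where R: "\<And>z. z \<in> K \<Longrightarrow> norm z \<le> R"
    using compact_imp_bounded[OF assms(2)] unfolding bounded_iff by blast
  define a where "a = - max 0 R - 1"
  let ?H = "{z. a \<le> Im z}"
  have low: "a < Im z" if "z \<in> K" for z
    using R[OF that] abs_Im_le_cmod[of z] by (auto simp: a_def)
  have "smooth_on ?F UNIV"
    by (rule smooth_on_extend_zero[of UNIV S K]) (use assms in auto)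
  then have F: "smooth_on ?F ?H" by (rule smooth_on_subset) simp
  have "integral S (\<lambda>z. wirtinger f z S * (- 2 * \<i>)) = integral ?H (\<lambda>z. wirtinger ?F z ?H * (- 2 * \<i>))"
  proof (rule wirtinger_integral_extend[OF thick_open[OF assms(1)] thick_halfplane assms(2,3) _ F])
    show "\<exists>V. open V \<and> z \<in> V \<and> S \<inter> V \<subseteq> ?H" if "z \<in> K" for z
      using low[OF that] by (intro exI[of _ "{z. a < Im z}"])
        (auto intro!: open_Collect_less continuous_intros)
  qed (rule assms(5))
  also have "\<dots> = integral UNIV (\<lambda>t. ?F (Complex t a))"
    by (rule halfplane_stokes[where R=R, OF F]) (use R assms(5) in fastforce)
  also have "\<dots> = integral UNIV (\<lambda>t::real. 0)"
  proof (rule integral_cong)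
    show "?F (Complex t a) = 0" for t
      using low[of "Complex t a"] assms(5)[of "Complex t a"] by auto
  qed
  finally show ?thesis by simp
qed

lemma compact_support_stokes_halfplane:
  assumes S: "openin (top_of_set {z. 0 \<le> Im z}) S"
    and "compact K" "K \<subseteq> S" "smooth_on f S" "\<And>z. z \<in> S - K \<Longrightarrow> f z = 0"
  shows "integral S (\<lambda>z. wirtinger f z S * (- 2 * \<i>)) =
    integral {t. of_real t \<in> S} (\<lambda>t. f (complex_of_real t))"
proof -
  let ?F = "\<lambda>z. if z \<in> S then f z else 0"
  obtain R where R: "\<And>z. z \<in> K \<Longrightarrow> norm z \<le> R"
    using compact_imp_bounded[OF assms(2)] unfolding bounded_iff by blast
  let ?H = "{z. 0 \<le> Im z}"
  have F: "smooth_on ?F ?H" by (rule smooth_on_extend_zero[OF S assms(2,4,5) le_infI1[OF assms(3)]])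
  have "integral S (\<lambda>z. wirtinger f z S * (- 2 * \<i>)) = integral ?H (\<lambda>z. wirtinger ?F z ?H * (- 2 * \<i>))"
  proof (rule wirtinger_integral_extend[OF thick_openin[OF S thick_halfplane] thick_halfplane assms(2,3) _ F])
    show "\<exists>V. open V \<and> z \<in> V \<and> S \<inter> V \<subseteq> ?H" if "z \<in> K" for z
      using openin_imp_subset[OF S] by (intro exI[of _ UNIV]) auto
  qed (rule assms(5))
  also have "\<dots> = integral UNIV (\<lambda>t. ?F (Complex t 0))"
    by (rule halfplane_stokes[where R=R, OF F]) (use R assms(5) in fastforce)
  also have "\<dots> = integral UNIV (\<lambda>t. if t \<in> {t. of_real t \<in> S} then f (of_real t) else 0)"
    by (intro integral_cong) (simp add: complex_of_real_def)
  also have "\<dots> = integral {t. of_real t \<in> S} (\<lambda>t. f (complex_of_real t))"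
    by (rule integral_restrict_UNIV)
  finally show ?thesis .
qed

section \<open>Poles of (0,1)-forms in the plane\<close>

lemma integrable_inverse_sqrt:
  "integrable lborel (\<lambda>x::real. indicator {-r..r} x * \<bar>x\<bar> powr - (1/2))"
proof (cases "r \<ge> 0")
  case True
  let ?g = "\<lambda>x::real. \<bar>x\<bar> powr - (1/2)"
  have 1: "?g integrable_on {0..r}"
  proof -
    have "(\<lambda>x. x powr - (1/2)) integrable_on {0..r}"
      by (rule integrable_on_powr_from_0) (use True in auto)
    then show ?thesis by (rule integrable_eq) auto
  qed
  have "(\<lambda>x. ?g (- x)) integrable_on {-r..-0}"
    by (rule iffD2[OF Henstock_Kurzweil_Integration.integrable_reflect_real[where f="?g"] 1])
  then have 2: "?g integrable_on {-r..0}" by simp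
  have "?g integrable_on {-r..r}"
    by (rule Henstock_Kurzweil_Integration.integrable_combine[OF _ _ 2 1]) (use True in auto)
  then have "?g absolutely_integrable_on {-r..r}"
    by (intro nonnegative_absolutely_integrable_1) auto
  then have "integrable lebesgue (\<lambda>x. indicator {-r..r} x * ?g x)"
    by (simp add: set_integrable_def)
  then show ?thesis by (subst (asm) integrable_completion) auto
next
  case False
  then have "indicator {-r..r} = (\<lambda>x::real. 0::real)" by (auto simp: indicator_def)
  then show ?thesis by simp
qed

text \<open>By \<open>x\<^sup>2 + y\<^sup>2 \<ge> 2 \<bar>x y\<bar>\<close> the function \<open>1 / \<bar>z\<bar>\<close> is dominated by a product of two
  integrable functions of one variable.\<close>

lemma absolutely_integrable_inverse_norm:
  "(\<lambda>z. 1 / cmod z) absolutely_integrable_on (cbox (Complex (-r) (-r)) (Complex r r))" (is "_ absolutely_integrable_on ?B")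
proof -
  let ?g = "\<lambda>x::real. indicator {-r..r} x * \<bar>x\<bar> powr - (1/2)"
  let ?h = "\<lambda>p::real \<times> real. ?g (fst p) * ?g (snd p)"
  have "integrable (lborel \<Otimes>\<^sub>M lborel) ?h"
  proof (rule lborel_pair.Fubini_integrable)
    show "integrable lborel (\<lambda>x. \<integral>y. norm (?h (x, y)) \<partial>lborel)"
    proof -
      have "norm (?h (x, y)) = ?g x * ?g y" for x y by (simp add: abs_mult)
      then have "(\<lambda>x. \<integral>y. norm (?h (x, y)) \<partial>lborel) = (\<lambda>x. ?g x * (\<integral>y. ?g y \<partial>lborel))"
        by (simp only: integral_mult_right_zero)
      then show ?thesis using integrable_mult_left[OF integrable_inverse_sqrt[of r]] by (simp only:)
    qed
    show "AE x in lborel. integrable lborel (\<lambda>y. ?h (x, y))"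
      unfolding fst_conv snd_conv by (intro AE_I2 integrable_mult_right integrable_inverse_sqrt)
  qed auto
  then have "integrable lebesgue ?h"
    unfolding lborel_prod by (subst integrable_completion) auto
  then have h: "?h absolutely_integrable_on (complex_of_pair -` UNIV)"
    by (simp add: set_integrable_def)
  let ?H = "\<lambda>z. ?g (Re z) * ?g (Im z)"
  have "(\<lambda>p. ?H (complex_of_pair p)) absolutely_integrable_on (complex_of_pair -` UNIV)"
    using h by (simp add: complex_of_pair_def)
  then have H: "?H absolutely_integrable_on UNIV"
    by (rule iffD2[OF complex_pair_integrable(1)])
  let ?N = "{z. Re z = 0} \<union> {z. Im z = 0}"
  have N: "negligible ?N"
  proof (rule negligible_Un)
    show "negligible {z. Re z = 0}"
      using negligible_standard_hyperplane[of "1::complex" 0] by (simp add: Basis_complex_def)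
    show "negligible {z. Im z = 0}"
      using negligible_standard_hyperplane[of "\<i>::complex" 0] by (simp add: Basis_complex_def)
  qed
  let ?H' = "\<lambda>z. if z \<in> ?N then 1 / cmod z else ?H z"
  have "?H' absolutely_integrable_on UNIV"
    by (rule absolutely_integrable_spike[OF H N]) auto
  then have "?H' absolutely_integrable_on ?B"
    by (rule set_integrable_subset) auto
  then have H': "?H' integrable_on ?B" by (rule set_lebesgue_integral_eq_integral(1))
  show ?thesis
  proof (rule measurable_bounded_by_integrable_imp_absolutely_integrable[OF _ _ H'])
    show "(\<lambda>z. 1 / cmod z) \<in> borel_measurable (lebesgue_on ?B)"
      by (intro measurable_restrict_space1 measurable_completion) simp
    show "norm (1 / cmod z) \<le> ?H' z" if "z \<in> ?B" for z
    proof (cases "z \<in> ?N")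
      case False
      then have nz: "Re z \<noteq> 0" "Im z \<noteq> 0" by auto
      have b: "Re z \<in> {-r..r}" "Im z \<in> {-r..r}" using that by (auto simp: in_cbox_complex_iff)
      have le: "sqrt (\<bar>Re z\<bar> * \<bar>Im z\<bar>) \<le> cmod z"
      proof -
        have "0 \<le> (\<bar>Re z\<bar> - \<bar>Im z\<bar>)\<^sup>2" by simp
        then have "2 * (\<bar>Re z\<bar> * \<bar>Im z\<bar>) \<le> (Re z)\<^sup>2 + (Im z)\<^sup>2"
          by (simp add: power2_diff)
        moreover have "0 \<le> \<bar>Re z\<bar> * \<bar>Im z\<bar>" by simp
        ultimately show ?thesis unfolding cmod_def by (intro real_sqrt_le_mono) linarith
      qed
      have pos: "0 < sqrt (\<bar>Re z\<bar> * \<bar>Im z\<bar>)" using nz by simp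
      have "0 < cmod z" using le pos by (rule less_le_trans[rotated])
      with pos have "0 < cmod z * sqrt (\<bar>Re z\<bar> * \<bar>Im z\<bar>)" by (rule mult_pos_pos[rotated])
      then have "1 / cmod z \<le> 1 / sqrt (\<bar>Re z\<bar> * \<bar>Im z\<bar>)"
        by (rule divide_left_mono[OF le zero_le_one])
      moreover have "\<bar>x\<bar> powr - (1/2) = 1 / sqrt \<bar>x\<bar>" for x :: real
        by (simp add: powr_minus_divide powr_half_sqrt)
      then have "?H z = 1 / sqrt (\<bar>Re z\<bar> * \<bar>Im z\<bar>)"
        using b by (simp add: real_sqrt_mult)
      ultimately have "1 / cmod z \<le> ?H z" by (simp only:)
      then show ?thesis using False by (simp only: if_False real_norm_def abs_divide abs_norm_cancel abs_one)
    qed auto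
  qed simp
qed

text \<open>On the compact support the function is dominated by a multiple of \<open>1 / \<bar>z\<bar>\<close>: near the origin by
  assumption, elsewhere because it is bounded there and \<open>\<bar>z\<bar>\<close> is bounded.\<close>

lemma log_singular_integrable:
  fixes f :: "complex \<Rightarrow> complex"
  assumes K: "compact K" "K - {0} \<subseteq> S" and f: "continuous_on (K - {0}) f"
    and 0: "\<And>z. z \<in> S - K \<Longrightarrow> z \<noteq> 0 \<Longrightarrow> f z = 0"
    and r: "0 < r" "\<And>z. z \<in> K \<Longrightarrow> z \<noteq> 0 \<Longrightarrow> norm z < r \<Longrightarrow> norm (f z) \<le> C / norm z"
  shows "f absolutely_integrable_on S"
proof -
  obtain R where R: "\<And>z. z \<in> K \<Longrightarrow> norm z \<le> R"
    using compact_imp_bounded[OF K(1)] unfolding bounded_iff by blast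
  have "compact (K - ball 0 r)" using K(1) by (intro compact_diff) auto
  moreover have "continuous_on (K - ball 0 r) f"
    by (rule continuous_on_subset[OF f]) (use r in auto)
  ultimately have "compact (f ` (K - ball 0 r))" by (intro compact_continuous_image)
  from compact_imp_bounded[OF this]
  obtain B where B: "\<And>z. z \<in> K - ball 0 r \<Longrightarrow> norm (f z) \<le> B"
    unfolding bounded_iff by blast
  let ?M = "\<bar>C\<bar> + \<bar>B\<bar> * \<bar>R\<bar>"
  have bound: "norm (f z) \<le> ?M * (1 / cmod z)" if z: "z \<in> K - {0}" for z
  proof (cases "norm z < r")
    case True
    then have "norm (f z) \<le> C / norm z" using r(2) z by auto
    also have "C \<le> ?M"
      using abs_ge_self[of C] mult_nonneg_nonneg[OF abs_ge_zero abs_ge_zero, of B R] by linarith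
    then have "C / norm z \<le> ?M / norm z" by (rule divide_right_mono) simp
    finally show ?thesis by simp
  next
    case False
    then have "norm (f z) \<le> \<bar>B\<bar>" using B[of z] z by auto
    moreover have "norm z \<le> \<bar>R\<bar>" using R[of z] z by auto
    ultimately have "norm (f z) * norm z \<le> \<bar>B\<bar> * \<bar>R\<bar>" by (intro mult_mono) auto
    then have "norm (f z) * norm z \<le> ?M" by linarith
    moreover have "0 < norm z" using z by simp
    ultimately have "norm (f z) \<le> ?M / norm z" by (simp only: pos_le_divide_eq)
    then show ?thesis by simp
  qed
  let ?B = "cbox (Complex (-R) (-R)) (Complex R R)"
  have KB: "K - {0} \<subseteq> ?B"
  proof
    fix z assume "z \<in> K - {0}"
    then have "norm z \<le> R" using R by auto
    then show "z \<in> ?B" using abs_Re_le_cmod[of z] abs_Im_le_cmod[of z]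
      by (auto simp: in_cbox_complex_iff)
  qed
  have Km: "K - {0} \<in> sets lebesgue"
    using compact_imp_closed[OF K(1)] by (intro sets.Diff) (auto intro: borel_closed sets_completionI_sets)
  have "(\<lambda>z. 1 / cmod z) absolutely_integrable_on (K - {0})"
    by (rule set_integrable_subset[OF absolutely_integrable_inverse_norm Km KB])
  then have "(\<lambda>z. ?M * (1 / cmod z)) integrable_on (K - {0})"
    by (intro integrable_on_mult_right set_lebesgue_integral_eq_integral(1))
  then have "f absolutely_integrable_on (K - {0})"
    by (rule measurable_bounded_by_integrable_imp_absolutely_integrable
      [OF continuous_imp_measurable_on_sets_lebesgue[OF f Km] Km _ bound])
  moreover have "negligible {z \<in> S - (K - {0}). f z \<noteq> 0}"
    by (rule negligible_subset[of "{0}"]) (use 0 in auto)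
  moreover have "negligible {z \<in> K - {0} - S. f z \<noteq> 0}"
    by (rule negligible_subset[of "{}"]) (use K in auto)
  ultimately show ?thesis using absolutely_integrable_spike_set_eq by blast
qed

text \<open>Rotations preserve the integral, while this one multiplies the integrand by \<open>w \<noteq> 1\<close>.\<close>

lemma integral_rotation_eq_0:
  fixes k :: "complex \<Rightarrow> complex"
  assumes k: "k absolutely_integrable_on UNIV" and u: "norm u = 1"
    and rot: "\<And>z. k (u * z) = w * k z" and w: "w \<noteq> 1"
  shows "integral UNIV k = 0"
proof -
  have u0: "u \<noteq> 0" using u by auto
  have inj: "inj_on ((*) u) UNIV" using u0 by (auto simp: inj_on_def)
  have surj: "range ((*) u) = UNIV"
  proof (intro equalityI subsetI)
    fix z show "z \<in> range ((*) u)" using u0 by (intro image_eqI[of _ _ "z / u"]) auto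
  qed auto
  have "integral UNIV (\<lambda>z. of_real ((cmod u)\<^sup>2) * k (u * z)) = integral UNIV k"
    using change_of_variables_complex[of UNIV "(*) u" "\<lambda>_. u" k "integral UNIV k"] k inj surj
    by (auto intro!: derivative_eq_intros)
  then have "integral UNIV (\<lambda>z. w * k z) = integral UNIV k" by (simp add: u rot)
  then have "(w - 1) * integral UNIV k = 0" by (simp add: algebra_simps)
  then show ?thesis using w by simp
qed

text \<open>A polynomial in \<open>z\<close> and its conjugate, given by the list of its terms
  \<open>a z\<^sup>j cnj z\<^sup>k\<close>.\<close>

definition zpoly :: "(complex \<times> nat \<times> nat) list \<Rightarrow> complex \<Rightarrow> complex" where
  "zpoly xs z = (\<Sum>(a, j, k)\<leftarrow>xs. a * z ^ j * cnj z ^ k)"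

lemma zpoly_Nil [simp]: "zpoly [] z = 0"
  and zpoly_Cons [simp]: "zpoly ((a, j, k) # xs) z = a * z ^ j * cnj z ^ k + zpoly xs z"
  and zpoly_append [simp]: "zpoly (xs @ ys) z = zpoly xs z + zpoly ys z"
  by (simp_all add: zpoly_def)

text \<open>The antiderivative of \<open>z * zpoly xs\<close> along rays from the origin, vanishing at the origin: on the ray
  through \<open>z\<close> a term of bidegree \<open>(j, k)\<close> is a multiple of \<open>t\<^sup>j\<^sup>+\<^sup>k\<close>.\<close>

definition zpoly_integral :: "(complex \<times> nat \<times> nat) list \<Rightarrow> (complex \<times> nat \<times> nat) list" where
  "zpoly_integral xs = map (\<lambda>(a, j, k). (a / of_nat (Suc (j + k)), Suc j, k)) xs"

definition zpoly_cnj_integral :: "(complex \<times> nat \<times> nat) list \<Rightarrow> (complex \<times> nat \<times> nat) list" where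
  "zpoly_cnj_integral xs = map (\<lambda>(a, j, k). (a / of_nat (Suc (j + k)), j, Suc k)) xs"

lemma monomial_ray_derivative:
  "((\<lambda>t. a / of_nat (Suc n) * of_real t ^ Suc n) has_vector_derivative a * of_real t ^ n)
    (at t within S)" for a :: complex
proof -
  have "((\<lambda>w. a / of_nat (Suc n) * w ^ Suc n) has_field_derivative a * of_real t ^ n)
      (at (of_real t))"
    using DERIV_cmult[OF DERIV_power[OF DERIV_ident, of "Suc n" "of_real t"], of "a / of_nat (Suc n)"]
    by (simp del: of_nat_Suc power_Suc)
  then have "((\<lambda>t. a / of_nat (Suc n) * of_real t ^ Suc n) has_vector_derivative a * of_real t ^ n) (at t)"
    by (rule has_vector_derivative_real_field)
  then show ?thesis by (rule has_vector_derivative_at_within)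
qed

lemma zpoly_integral_derivative:
  "((\<lambda>t. zpoly (zpoly_integral xs) (of_real t * z)) has_vector_derivative
     z * zpoly xs (of_real t * z)) (at t within S)"
proof (induction xs)
  case (Cons x xs)
  obtain a j k where x: "x = (a, j, k)" by (cases x) auto
  let ?m = "a * z ^ Suc j * cnj z ^ k"
  have "(\<lambda>t. zpoly (zpoly_integral (x # xs)) (of_real t * z)) =
      (\<lambda>t. ?m / of_nat (Suc (j + k)) * of_real t ^ Suc (j + k) + zpoly (zpoly_integral xs) (of_real t * z))"
    by (rule ext) (simp add: x zpoly_integral_def power_mult_distrib power_add mult_ac del: of_nat_Suc)
  moreover have "z * zpoly (x # xs) (of_real t * z) =
      ?m * of_real t ^ (j + k) + z * zpoly xs (of_real t * z)"
    by (simp add: x power_mult_distrib power_add algebra_simps)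
  ultimately show ?case
    using has_vector_derivative_add[OF monomial_ray_derivative[of ?m "j + k" t S] Cons] by (simp only:)
qed (simp add: zpoly_integral_def)

lemma zpoly_cnj_integral_derivative:
  "((\<lambda>t. zpoly (zpoly_cnj_integral xs) (of_real t * z)) has_vector_derivative
     cnj z * zpoly xs (of_real t * z)) (at t within S)"
proof (induction xs)
  case (Cons x xs)
  obtain a j k where x: "x = (a, j, k)" by (cases x) auto
  let ?m = "a * z ^ j * cnj z ^ Suc k"
  have "(\<lambda>t. zpoly (zpoly_cnj_integral (x # xs)) (of_real t * z)) =
      (\<lambda>t. ?m / of_nat (Suc (j + k)) * of_real t ^ Suc (j + k) + zpoly (zpoly_cnj_integral xs) (of_real t * z))"
    by (rule ext) (simp add: x zpoly_cnj_integral_def power_mult_distrib power_add mult_ac del: of_nat_Suc)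
  moreover have "cnj z * zpoly (x # xs) (of_real t * z) =
      ?m * of_real t ^ (j + k) + cnj z * zpoly xs (of_real t * z)"
    by (simp add: x power_mult_distrib power_add algebra_simps)
  ultimately show ?case
    using has_vector_derivative_add[OF monomial_ray_derivative[of ?m "j + k" t S] Cons] by (simp only:)
qed (simp add: zpoly_cnj_integral_def)

lemma zpoly_integral_0 [simp]: "zpoly (zpoly_integral xs) 0 = 0"
  and zpoly_cnj_integral_0 [simp]: "zpoly (zpoly_cnj_integral xs) 0 = 0"
  by (induction xs) (auto simp: zpoly_integral_def zpoly_cnj_integral_def)

text \<open>Taylor's theorem at the origin, by induction on the order: integrating the approximations of
  \<open>\<partial>g/\<partial>z\<close> and \<open>\<partial>g/\<partial>z\<^sup>-\<close> along rays gains one order. The bound \<open>j < N\<close> on the \<open>z\<close>-degree is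
  recorded because it excludes the rotational weight zero in \<open>ring_integral_zpoly\<close>.\<close>

lemma taylor_zpoly:
  assumes "smooth_on g (ball 0 r)" "0 < s" "s < r"
  shows "\<exists>xs C. 0 \<le> C \<and> (\<forall>(a, j, k)\<in>set xs. j < N) \<and>
    (\<forall>z\<in>cball 0 s. norm (g z - zpoly xs z) \<le> C * norm z ^ N)"
  using assms(1)
proof (induction N arbitrary: g)
  case 0
  have "continuous_on (cball 0 s) g"
    by (rule continuous_on_subset[OF smooth_on_imp_continuous_on[OF 0]]) (use assms in auto)
  from compact_imp_bounded[OF compact_continuous_image[OF this compact_cball]]
  obtain C where C: "\<And>z. z \<in> cball 0 s \<Longrightarrow> norm (g z) \<le> C"
    unfolding bounded_iff by blast
  have "0 \<le> C" using order_trans[OF norm_ge_zero C[of 0]] assms(2) by simp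
  then show ?case using C by (intro exI[of _ "[]"] exI[of _ C]) simp
next
  case (Suc N)
  let ?B = "ball (0::complex) r"
  let ?D = "\<lambda>z. frechet_derivative g (at z)"
  define p q where "p z = (?D z 1 - \<i> * ?D z \<i>) / 2" and "q z = (?D z 1 + \<i> * ?D z \<i>) / 2" for z
  have gC: "C_inf g ?B" using Suc.prems smooth_on_open_iff[of ?B g] by simp
  have D: "(g has_derivative ?D z) (at z)" if "z \<in> ?B" for z
    by (rule C_inf_derivative[OF gC that])
  have sD: "smooth_on (\<lambda>z. ?D z v) ?B" for v
    using smooth_on_open_iff[of ?B "\<lambda>z. ?D z v"] C_inf_frechet[OF gC] by simp
  have sp: "smooth_on p ?B" "smooth_on q ?B"
    unfolding p_def[abs_def] q_def[abs_def]
    by (intro smooth_on_divide smooth_on_add smooth_on_diff smooth_on_mult smooth_on_const sD; simp)+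
  obtain xs C where C: "0 \<le> C" "\<forall>(a, j, k)\<in>set xs. j < N"
      "\<forall>z\<in>cball 0 s. norm (p z - zpoly xs z) \<le> C * norm z ^ N"
    using Suc.IH[OF sp(1)] by blast
  obtain ys C' where C': "0 \<le> C'" "\<forall>(a, j, k)\<in>set ys. j < N"
      "\<forall>z\<in>cball 0 s. norm (q z - zpoly ys z) \<le> C' * norm z ^ N"
    using Suc.IH[OF sp(2)] by blast
  define zs where "zs = (g 0, 0, 0) # zpoly_integral xs @ zpoly_cnj_integral ys"
  have deg: "\<forall>(a, j, k)\<in>set zs. j < Suc N"
    using C(2) C'(2) by (auto simp: zs_def zpoly_integral_def zpoly_cnj_integral_def)
  have "norm (g z - zpoly zs z) \<le> (C + C') * norm z ^ Suc N" if z: "z \<in> cball 0 s" for z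
  proof -
    let ?R = "\<lambda>t::real. g (of_real t * z) - zpoly zs (of_real t * z)"
    let ?R' = "\<lambda>t::real. z * (p (of_real t * z) - zpoly xs (of_real t * z)) +
       cnj z * (q (of_real t * z) - zpoly ys (of_real t * z))"
    have tz: "of_real t * z \<in> cball 0 s" if "t \<in> {0..1}" for t :: real
    proof -
      have "\<bar>t\<bar> * norm z \<le> 1 * norm z" using that by (intro mult_right_mono) auto
      then show ?thesis using z by (simp add: norm_mult)
    qed
    have R': "(?R has_vector_derivative ?R' t) (at t within {0..1})" if t: "t \<in> {0..1}" for t
    proof -
      have w: "of_real t * z \<in> ?B" using tz[OF t] assms(3) by simp
      have "((\<lambda>t. g (of_real t * z)) has_derivative (\<lambda>h. ?D (of_real t * z) (of_real h * z))) (at t within {0..1})"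
      proof (rule has_derivative_compose[where g=g and f="\<lambda>t. of_real t * z", OF _ D[OF w]])
        show "((\<lambda>t. of_real t * z) has_derivative (\<lambda>h. of_real h * z)) (at t within {0..1})"
          by (rule bounded_linear_imp_has_derivative)
            (intro bounded_linear_mult_const bounded_linear_of_real)
      qed
      moreover have "?D (of_real t * z) (of_real h * z) = h *\<^sub>R (z * p (of_real t * z) + cnj z * q (of_real t * z))" for h
        unfolding real_linear_complex[OF has_derivative_linear[OF D[OF w]], of "of_real h * z"]
        by (simp add: p_def q_def scaleR_conv_of_real algebra_simps)
      ultimately have "((\<lambda>t. g (of_real t * z)) has_vector_derivative
          (z * p (of_real t * z) + cnj z * q (of_real t * z))) (at t within {0..1})"
        by (simp add: has_vector_derivative_def)
      moreover have "((\<lambda>t. zpoly zs (of_real t * z)) has_vector_derivative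
          (0 + (z * zpoly xs (of_real t * z) + cnj z * zpoly ys (of_real t * z)))) (at t within {0..1})"
        unfolding zs_def zpoly_Cons zpoly_append power_0 mult_1_right
        by (intro has_vector_derivative_add zpoly_integral_derivative zpoly_cnj_integral_derivative
            has_vector_derivative_const)
      ultimately have "(?R has_vector_derivative
          (z * p (of_real t * z) + cnj z * q (of_real t * z)) -
          (0 + (z * zpoly xs (of_real t * z) + cnj z * zpoly ys (of_real t * z)))) (at t within {0..1})"
        by (rule has_vector_derivative_diff)
      then show ?thesis by (simp add: algebra_simps)
    qed
    have bnd: "norm (?R' t) \<le> (C + C') * norm z ^ Suc N" if t: "t \<in> {0..1}" for t
    proof -
      have le: "norm (of_real t * z) ^ N \<le> norm z ^ N"
        using t by (intro power_mono) (auto simp: norm_mult mult_left_le_one_le)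
      have "norm (p (of_real t * z) - zpoly xs (of_real t * z)) \<le> C * norm z ^ N"
        using C(3)[rule_format, OF tz[OF t]] mult_left_mono[OF le C(1)] by linarith
      moreover have "norm (q (of_real t * z) - zpoly ys (of_real t * z)) \<le> C' * norm z ^ N"
        using C'(3)[rule_format, OF tz[OF t]] mult_left_mono[OF le C'(1)] by linarith
      ultimately have "norm (?R' t) \<le> norm z * (C * norm z ^ N) + norm (cnj z) * (C' * norm z ^ N)"
        by (intro norm_triangle_le add_mono) (auto simp: norm_mult intro!: mult_left_mono)
      then show ?thesis by (simp add: algebra_simps)
    qed
    have "norm (?R 1 - ?R 0) \<le> ((C + C') * norm z ^ Suc N) * norm (1 - 0 :: real)"
    proof (rule differentiable_bound[of "{0..1}"])
      show "(?R has_derivative (\<lambda>h. h *\<^sub>R ?R' t)) (at t within {0..1})" if "t \<in> {0..1}" for t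
        using R'[OF that] by (simp add: has_vector_derivative_def)
      show "onorm (\<lambda>h. h *\<^sub>R ?R' t) \<le> (C + C') * norm z ^ Suc N" if "t \<in> {0..1}" for t
        by (rule onorm_le) (use mult_left_mono[OF bnd[OF that]] in \<open>auto simp: mult.commute\<close>)
    qed auto
    then show ?thesis by (simp add: zs_def)
  qed
  then show ?case using deg C(1) C'(1) by (intro exI[of _ zs] exI[of _ "C + C'"]) auto
qed

text \<open>With \<open>c = N\<close> the Leibniz rule reads \<open>\<partial>(- g / (c z\<^sup>N)) = g / z\<^sup>N\<^sup>+\<^sup>1 - (\<partial>g / c) / z\<^sup>N\<close>; the induction
  hypothesis for \<open>\<partial>g / c\<close> absorbs the last term. The process stops at order one, where \<open>c = 0\<close> and
  the formula gives no primitive.\<close>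

lemma pole_reduction:
  assumes "open V" "smooth_on g V"
  shows "\<exists>b h. smooth_on b V \<and> smooth_on h V \<and>
    (\<forall>z\<in>V - {0}. wirtinger (\<lambda>z. b z / z ^ N) z (V - {0}) = g z / z ^ N - h z / z)"
  using assms(2)
proof (induction N arbitrary: g)
  case 0
  have "open (V - {0})" using assms(1) by (simp add: open_delete)
  then show ?case using 0
    by (intro exI[of _ "\<lambda>z. 0"] exI[of _ "\<lambda>z. z * g z"])
      (auto intro!: smooth_on_mult smooth_on_ident simp: wirtinger_const thick_open)
next
  case (Suc N)
  let ?T = "V - {0}"
  have oT: "open ?T" using assms(1) by (simp add: open_delete)
  note tT = thick_open[OF oT]
  show ?case
  proof (cases N)
    case 0
    then show ?thesis using Suc.prems
      by (intro exI[of _ "\<lambda>z. 0"] exI[of _ g]) (auto simp: wirtinger_const tT)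
  next
    case (Suc n)
    let ?c = "of_nat N :: complex"
    have c: "?c \<noteq> 0" using Suc by (simp del: of_nat_Suc)
    let ?p = "\<lambda>z. wirtinger g z V / ?c"
    have "smooth_on ?p V"
      by (intro smooth_on_divide smooth_on_wirtinger thick_open assms(1) Suc.prems smooth_on_const) (rule c)
    from Suc.IH[OF this] obtain b h where b: "smooth_on b V" and h: "smooth_on h V"
      and bh: "\<And>z. z \<in> ?T \<Longrightarrow> wirtinger (\<lambda>z. b z / z ^ N) z ?T = ?p z / z ^ N - h z / z" by blast
    have gT: "smooth_on g ?T" and bT: "smooth_on b ?T"
      using Suc.prems b smooth_on_subset[of _ V ?T] by auto
    have zT: "smooth_on (\<lambda>z. 1 / z ^ N) ?T"
      by (intro smooth_on_divide smooth_on_const smooth_on_power smooth_on_ident) auto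
    have bz: "smooth_on (\<lambda>z. b z / z ^ N) ?T"
      by (intro smooth_on_divide smooth_on_power smooth_on_ident bT) auto
    \<comment> \<open>The factor \<open>z\<close> brings the quotient by \<open>z\<^sup>N\<close> into the form of a quotient by \<open>z\<^sup>N\<^sup>+\<^sup>1\<close>.\<close>
    let ?b = "\<lambda>z. (b z - g z / ?c) * z"
    have "wirtinger (\<lambda>z. ?b z / z ^ Suc N) z ?T = g z / z ^ Suc N - h z / z" if z: "z \<in> ?T" for z
    proof -
      have gc: "smooth_on (\<lambda>z. g z / ?c) ?T" by (intro smooth_on_divide gT smooth_on_const c)
      have "wirtinger (\<lambda>z. ?b z / z ^ Suc N) z ?T = wirtinger (\<lambda>z. b z / z ^ N - g z / ?c * (1 / z ^ N)) z ?T"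
      proof (rule wirtinger_transfer[OF tT tT z open_UNIV])
        show "smooth_on (\<lambda>z. b z / z ^ N - g z / ?c * (1 / z ^ N)) ?T"
          by (intro smooth_on_diff bz smooth_on_mult[OF gc zT])
        show "?b y / y ^ Suc N = b y / y ^ N - g y / ?c * (1 / y ^ N)" if "y \<in> ?T" for y
          using that by (simp add: diff_divide_distrib)
      qed auto
      also have "\<dots> = wirtinger (\<lambda>z. b z / z ^ N) z ?T - wirtinger (\<lambda>z. g z / ?c * (1 / z ^ N)) z ?T"
        by (rule wirtinger_diff[OF tT z bz smooth_on_mult[OF gc zT]])
      also have "wirtinger (\<lambda>z. g z / ?c * (1 / z ^ N)) z ?T
          = g z / ?c * wirtinger (\<lambda>z. 1 / z ^ N) z ?T + wirtinger (\<lambda>z. g z / ?c) z ?T * (1 / z ^ N)"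
        by (rule wirtinger_mult[OF tT z gc zT])
      also have "wirtinger (\<lambda>z. 1 / z ^ N) z ?T = - ?c / z ^ Suc N"
      proof (rule wirtinger_holomorphic[OF tT z])
        have "((\<lambda>z. 1 / z ^ N) has_field_derivative - ?c / z ^ Suc N) (at z)"
        proof -
          have "((\<lambda>z. z ^ N) has_field_derivative ?c * z ^ n) (at z)"
            using DERIV_power[OF DERIV_ident, of N z UNIV] Suc by (simp del: of_nat_Suc power_Suc)
          from DERIV_inverse_fun[OF this] have
            "((\<lambda>z. inverse (z ^ N)) has_field_derivative - (?c * z ^ n * inverse ((z ^ N) ^ Suc (Suc 0)))) (at z)"
            using z by simp
          moreover have "- (?c * z ^ n * inverse ((z ^ N) ^ Suc (Suc 0))) = - ?c / z ^ Suc N"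
            using z Suc by (simp add: field_simps)
          ultimately show ?thesis by (simp only: inverse_eq_divide)
        qed
        then show "((\<lambda>z. 1 / z ^ N) has_field_derivative - ?c / z ^ Suc N) (at z within ?T)"
          by (rule has_field_derivative_at_within)
      qed
      also have "wirtinger (\<lambda>z. g z / ?c) z ?T = ?p z"
      proof -
        have "wirtinger (\<lambda>z. g z * (1 / ?c)) z ?T = wirtinger (\<lambda>z. g z * (1 / ?c)) z V"
          by (rule wirtinger_transfer[OF thick_open[OF assms(1)] tT z open_UNIV _ _ _
                smooth_on_mult[OF Suc.prems smooth_on_const]]) auto
        also have "\<dots> = g z * wirtinger (\<lambda>z. 1 / ?c) z V + wirtinger g z V * (1 / ?c)"
          by (rule wirtinger_mult[OF thick_open[OF assms(1)] _ Suc.prems smooth_on_const]) (use z in auto)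
        finally show ?thesis using wirtinger_const[OF thick_open[OF assms(1)]] z by simp
      qed
      also have "wirtinger (\<lambda>z. b z / z ^ N) z ?T = ?p z / z ^ N - h z / z" by (rule bh[OF z])
      finally show ?thesis using c by (simp add: field_simps)
    qed
    moreover have "smooth_on ?b V"
      by (intro smooth_on_mult smooth_on_diff smooth_on_divide smooth_on_ident smooth_on_const b Suc.prems c)
    ultimately show ?thesis using h by blast
  qed
qed

lemma cutoff_derivative:
  obtains c' M where "continuous_on UNIV c'" "\<And>s. (cutoff has_real_derivative c' s) (at s)"
    "\<And>s. \<bar>c' s\<bar> \<le> M" "\<And>s. s < 1/2 \<Longrightarrow> c' s = 0" "\<And>s. 1 < s \<Longrightarrow> c' s = 0"
proof -
  have C: "C_inf cutoff UNIV"
    using iffD1[OF smooth_on_open_iff[OF open_UNIV] smooth_on_cutoff] .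
  let ?c = "\<lambda>s. frechet_derivative cutoff (at s) 1"
  have d: "(cutoff has_real_derivative ?c s) (at s)" for s
  proof -
    have D: "(cutoff has_derivative frechet_derivative cutoff (at s)) (at s)"
      by (rule C_inf_derivative[OF C]) simp
    have "frechet_derivative cutoff (at s) = (\<lambda>h. ?c s * h)"
    proof
      fix h
      show "frechet_derivative cutoff (at s) h = ?c s * h"
        using linear_scale[OF has_derivative_linear[OF D], of h 1] by simp
    qed
    with D show ?thesis unfolding has_field_derivative_def by (simp only:)
  qed
  have cont: "continuous_on UNIV ?c" by (rule C_inf_continuous[OF C_inf_frechet[OF C]])
  have z1: "?c s = 0" if "s < 1/2" for s
  proof -
    have "(cutoff has_real_derivative 0) (at s)"
      by (rule has_field_derivative_transform_within_open[where f="\<lambda>_. 1" and S="{..<1/2}"])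
        (use that cutoff_eq_1 in auto)
    then show ?thesis using DERIV_unique[OF d] by blast
  qed
  have z2: "?c s = 0" if "1 < s" for s
  proof -
    have "(cutoff has_real_derivative 0) (at s)"
      by (rule has_field_derivative_transform_within_open[where f="\<lambda>_. 0" and S="{1<..}"])
        (use that cutoff_eq_0 in auto)
    then show ?thesis using DERIV_unique[OF d] by blast
  qed
  have "continuous_on {0..1} ?c" by (rule continuous_on_subset[OF cont]) simp
  from compact_imp_bounded[OF compact_continuous_image[OF this compact_Icc]]
  obtain M where "\<forall>x\<in>?c ` {0..1}. norm x \<le> M" unfolding bounded_iff by blast
  then have M: "\<bar>?c s\<bar> \<le> M" if "s \<in> {0..1}" for s using that by simp
  have "0 \<le> M" using order_trans[OF abs_ge_zero M[of 0]] by simp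
  have "\<bar>?c s\<bar> \<le> M" for s
    using M[of s] z1[of s] z2[of s] \<open>0 \<le> M\<close> by (cases "s < 0"; cases "1 < s") auto
  then show ?thesis using that[of ?c M] cont d z1 z2 by blast
qed

text \<open>The cutoff is radial, so its Wirtinger derivative is \<open>cnj z\<close> times a radial function.\<close>

lemma wirtinger_cutoff:
  assumes c': "\<And>s. (cutoff has_real_derivative c' s) (at s)"
  shows "wirtinger (\<lambda>z. of_real (cutoff ((cmod z)\<^sup>2 / e\<^sup>2))) z UNIV =
    of_real (c' ((cmod z)\<^sup>2 / e\<^sup>2)) * cnj z / of_real (e\<^sup>2)"
proof -
  have "((\<lambda>z. z \<bullet> z / e\<^sup>2) has_derivative (\<lambda>h. 2 * (z \<bullet> h) / e\<^sup>2)) (at z)"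
    by (auto intro!: derivative_eq_intros simp: inner_commute divide_inverse)
  then have n: "((\<lambda>z. (cmod z)\<^sup>2 / e\<^sup>2) has_derivative (\<lambda>h. 2 * (z \<bullet> h) / e\<^sup>2)) (at z)"
    by (simp add: power2_norm_eq_inner)
  have "((\<lambda>z. cutoff ((cmod z)\<^sup>2 / e\<^sup>2)) has_derivative
      (\<lambda>h. c' ((cmod z)\<^sup>2 / e\<^sup>2) * (2 * (z \<bullet> h) / e\<^sup>2))) (at z)"
    by (rule has_derivative_compose[OF n c'[unfolded has_field_derivative_def]])
  from bounded_linear.has_derivative[OF bounded_linear_of_real this]
  have "((\<lambda>z. complex_of_real (cutoff ((cmod z)\<^sup>2 / e\<^sup>2))) has_derivative
      (\<lambda>h. of_real (c' ((cmod z)\<^sup>2 / e\<^sup>2) * (2 * (z \<bullet> h) / e\<^sup>2)))) (at z)" .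
  from wirtinger_eq[OF thick_UNIV UNIV_I this] show ?thesis
    by (simp add: complex_eq_iff inner_complex_def Re_divide_of_real Im_divide_of_real
        del: of_real_power of_real_divide)
qed

text \<open>The pairing of a cutoff derivative with a polynomial divided by \<open>z\<^sup>N\<close> vanishes because each
  term is multiplied by a nontrivial character under rotations.\<close>

lemma ring_integral_zpoly:
  fixes c' :: "real \<Rightarrow> real" and e :: real
  defines "Q \<equiv> \<lambda>z. of_real (c' ((cmod z)\<^sup>2 / e\<^sup>2)) * cnj z / of_real (e\<^sup>2)"
  assumes int: "\<And>F. continuous_on (- {0}) F \<Longrightarrow> (\<lambda>z. Q z * F z) absolutely_integrable_on UNIV"
    and deg: "\<forall>(a, j, k)\<in>set xs. j < N"
  shows "integral UNIV (\<lambda>z. Q z * (zpoly xs z / z ^ N)) = 0"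
  using deg
proof (induction xs)
  case (Cons x xs)
  obtain a j k where x: "x = (a, j, k)" by (cases x) auto
  have j: "j < N" using Cons.prems x by simp
  let ?m = "\<lambda>z. a * z ^ j * cnj z ^ k / z ^ N"
  have i1: "(\<lambda>z. Q z * ?m z) absolutely_integrable_on UNIV"
    by (rule int) (auto intro!: continuous_intros)
  have "continuous_on (- {0}) (zpoly xs)"
  proof (induction xs)
    case Nil
    then show ?case by (simp add: zpoly_def[abs_def])
  next
    case (Cons x xs)
    obtain a j k where "x = (a, j, k)" by (cases x) auto
    then show ?case using Cons by (auto intro!: continuous_intros)
  qed
  then have i2: "(\<lambda>z. Q z * (zpoly xs z / z ^ N)) absolutely_integrable_on UNIV"
    by (intro int continuous_intros) auto
  \<comment> \<open>The integrand has the rotational weight \<open>- n\<close>, and \<open>u\<^sup>n = - 1\<close> for the following rotation \<open>u\<close>.\<close>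
  define n where "n = N + k + 1 - j"
  have n: "0 < n" "j + n = N + k + 1" using j by (simp_all add: n_def)
  define u where "u = cis (pi / real n)"
  have u: "norm u = 1" "u \<noteq> 0" by (simp_all add: u_def)
  have un: "u ^ n = -1" using n(1) Complex.DeMoivre[of "pi / real n" n] by (simp add: u_def)
  have cu: "cnj u = inverse u" by (simp add: u_def cis_cnj)
  have "(cnj u * u ^ j * cnj u ^ k / u ^ N) * u ^ n = u ^ (j + n) / u ^ (N + k + 1)"
    using u(2) by (simp add: cu power_add field_simps)
  also have "\<dots> = 1" unfolding n(2) using u(2) by simp
  finally have w: "cnj u * u ^ j * cnj u ^ k / u ^ N = -1" unfolding un by (simp add: minus_equation_iff)
  have "Q (u * z) * ?m (u * z) = (cnj u * u ^ j * cnj u ^ k / u ^ N) * (Q z * ?m z)" for z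
    using u by (simp add: Q_def norm_mult power_mult_distrib mult_ac)
  then have "Q (u * z) * ?m (u * z) = -1 * (Q z * ?m z)" for z unfolding w .
  from integral_rotation_eq_0[OF i1 u(1) this]
  have "integral UNIV (\<lambda>z. Q z * ?m z) = 0" by simp
  moreover have "integral UNIV (\<lambda>z. Q z * (zpoly xs z / z ^ N)) = 0" by (rule Cons.IH) (use Cons.prems in simp)
  moreover have "integral UNIV (\<lambda>z. Q z * ?m z + Q z * (zpoly xs z / z ^ N)) =
      integral UNIV (\<lambda>z. Q z * ?m z) + integral UNIV (\<lambda>z. Q z * (zpoly xs z / z ^ N))"
    using i1 i2 by (intro integral_add set_lebesgue_integral_eq_integral(1))
  ultimately show ?case by (simp add: x add_divide_distrib distrib_left)
qed simp

text \<open>The Taylor polynomial of \<open>g\<close> contributes nothing by \<open>ring_integral_zpoly\<close>. What remains is at most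
  \<open>M / e\<close> times a constant on a set of area at most \<open>4 e\<^sup>2\<close>. The first claim records that the cutoff derivative
  is supported in an annulus around the origin.\<close>

lemma ring_integral_small:
  fixes c' :: "real \<Rightarrow> real"
  defines "Q \<equiv> \<lambda>e z. of_real (c' ((cmod z)\<^sup>2 / e\<^sup>2)) * cnj z / of_real (e\<^sup>2)"
  assumes c': "continuous_on UNIV c'" "\<And>s. \<bar>c' s\<bar> \<le> M" "\<And>s. s < 1/2 \<Longrightarrow> c' s = 0" "\<And>s. 1 < s \<Longrightarrow> c' s = 0"
    and g: "smooth_on g (ball 0 r)" and s: "0 < s" "s < r"
  shows "\<And>e f. 0 < e \<Longrightarrow> e \<le> s \<Longrightarrow> continuous_on (ball 0 r - {0}) f \<Longrightarrow>
      (\<lambda>z. Q e z * f z) absolutely_integrable_on UNIV"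
    and "\<exists>B. \<forall>e. 0 < e \<longrightarrow> e \<le> s \<longrightarrow> norm (integral UNIV (\<lambda>z. Q e z * (g z / z ^ N))) \<le> B * e"
proof -
  show int: "(\<lambda>z. Q e z * f z) absolutely_integrable_on UNIV"
    if e: "0 < e" "e \<le> s" and f: "continuous_on (ball 0 r - {0}) f" for e f
  proof -
    let ?K = "cball (0::complex) e - ball 0 (e / 2)"
    have K: "?K \<subseteq> ball 0 r - {0}" using e s by auto
    show ?thesis
    proof (rule absolutely_integrable_compact_support(1)[of ?K])
      show "compact ?K" by (intro compact_diff) auto
      show "continuous_on ?K (\<lambda>z. Q e z * f z)" unfolding Q_def
        by (intro continuous_intros continuous_on_subset[OF f K] continuous_on_compose2[OF c'(1)])
          (use e in auto)
      show "Q e z * f z = 0" if z: "z \<in> UNIV - ?K" for z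
      proof (cases "norm z > e")
        case True
        then have "1 < (cmod z)\<^sup>2 / e\<^sup>2" using e by (simp add: power_strict_mono)
        then show ?thesis using c'(4) by (simp add: Q_def)
      next
        case False
        then have "norm z < e / 2" using z by auto
        then have "(norm z)\<^sup>2 < (e / 2)\<^sup>2" by (intro power_strict_mono) auto
        then have "4 * (norm z)\<^sup>2 < e\<^sup>2" by (simp add: power_divide)
        then have "2 * (norm z)\<^sup>2 < e\<^sup>2" using zero_le_power2[of "norm z"] by linarith
        then have "(cmod z)\<^sup>2 / e\<^sup>2 < 1/2" using e by (simp add: divide_less_eq)
        then show ?thesis using c'(3) by (simp add: Q_def)
      qed
    qed simp
  qed
  obtain xs C where C: "0 \<le> C" "\<forall>(a, j, k)\<in>set xs. j < N"
      "\<forall>z\<in>cball 0 s. norm (g z - zpoly xs z) \<le> C * norm z ^ N"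
    using taylor_zpoly[OF g s] by blast
  have M0: "0 \<le> M" using order_trans[OF abs_ge_zero c'(2)] .
  have cz: "continuous_on S (zpoly ys)" for S ys
  proof (induction ys)
    case Nil
    then show ?case by (simp add: zpoly_def[abs_def])
  next
    case (Cons x ys)
    obtain a j k where "x = (a, j, k)" by (cases x) auto
    then show ?case using Cons by (auto intro!: continuous_intros)
  qed
  have cg: "continuous_on (ball 0 r - {0}) g"
    by (rule continuous_on_subset[OF smooth_on_imp_continuous_on[OF g]]) auto
  have "norm (integral UNIV (\<lambda>z. Q e z * (g z / z ^ N))) \<le> 4 * M * C * e" if e: "0 < e" "e \<le> s" for e
  proof -
    let ?P = "\<lambda>z. zpoly xs z / z ^ N" and ?R = "\<lambda>z. (g z - zpoly xs z) / z ^ N"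
    have iP: "(\<lambda>z. Q e z * ?P z) absolutely_integrable_on UNIV"
      by (rule int[OF e]) (auto intro!: continuous_intros cz)
    have iR: "(\<lambda>z. Q e z * ?R z) absolutely_integrable_on UNIV"
      by (rule int[OF e]) (auto intro!: continuous_intros cz cg)
    have out: "Q e z = 0" if "e < norm z" for z
    proof -
      have "1 < (cmod z)\<^sup>2 / e\<^sup>2" using e that by (simp add: power_strict_mono)
      then show ?thesis using c'(4) by (simp add: Q_def)
    qed
    have intQ: "(\<lambda>z. of_real (c' ((cmod z)\<^sup>2 / e\<^sup>2)) * cnj z / of_real (e\<^sup>2) * F z)
        absolutely_integrable_on UNIV" if F: "continuous_on (- {0}) F" for F
    proof -
      have "(\<lambda>z. Q e z * F z) absolutely_integrable_on UNIV"
        by (rule int[OF e continuous_on_subset[OF F]]) auto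
      then show ?thesis unfolding Q_def .
    qed
    have "integral UNIV (\<lambda>z. Q e z * ?P z) = 0"
      using ring_integral_zpoly[OF intQ C(2)] unfolding Q_def .
    moreover have "integral UNIV (\<lambda>z. Q e z * ?P z + Q e z * ?R z) =
      integral UNIV (\<lambda>z. Q e z * ?P z) + integral UNIV (\<lambda>z. Q e z * ?R z)"
      using iP iR by (intro integral_add set_lebesgue_integral_eq_integral(1))
    moreover have "Q e z * ?P z + Q e z * ?R z = Q e z * (g z / z ^ N)" for z
      by (simp add: diff_divide_distrib right_diff_distrib)
    ultimately have eq: "integral UNIV (\<lambda>z. Q e z * (g z / z ^ N)) = integral UNIV (\<lambda>z. Q e z * ?R z)"
      by simp
    let ?B = "cbox (Complex (-e) (-e)) (Complex e e)"
    have "integral UNIV (\<lambda>z. Q e z * ?R z) = integral ?B (\<lambda>z. Q e z * ?R z)"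
    proof (rule integral_spike_set)
      have "{z \<in> UNIV - ?B. Q e z * ?R z \<noteq> 0} = {}"
      proof -
        have "e < norm z" if "z \<notin> ?B" for z
          using that abs_Re_le_cmod[of z] abs_Im_le_cmod[of z] by (auto simp: in_cbox_complex_iff)
        then show ?thesis using out by auto
      qed
      then show "negligible {z \<in> UNIV - ?B. Q e z * ?R z \<noteq> 0}" by (simp only: negligible_empty)
    qed auto
    moreover have "norm (integral ?B (\<lambda>z. Q e z * ?R z)) \<le> (M * C / e) * measure lborel ?B"
    proof (rule has_integral_bound)
      show "((\<lambda>z. Q e z * ?R z) has_integral integral ?B (\<lambda>z. Q e z * ?R z)) ?B"
        by (intro integrable_integral set_lebesgue_integral_eq_integral(1) set_integrable_subset[OF iR]) auto
      show "0 \<le> M * C / e" using M0 C(1) e by simp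
      show "norm (Q e z * ?R z) \<le> M * C / e" for z
      proof (cases "e < norm z \<or> z = 0")
        case True
        then show ?thesis using out[of z] M0 C(1) e by (auto simp: Q_def)
      next
        case False
        then have z: "norm z \<le> e" "z \<noteq> 0" by auto
        have "norm (Q e z) = \<bar>c' ((cmod z)\<^sup>2 / e\<^sup>2)\<bar> * norm z / e\<^sup>2"
          by (simp add: Q_def norm_mult norm_divide norm_power)
        also have "\<dots> \<le> M * e / e\<^sup>2"
          using z c'(2) M0 by (intro divide_right_mono mult_mono) auto
        finally have 1: "norm (Q e z) \<le> M / e" using e by (simp add: power2_eq_square)
        have "norm (?R z) \<le> C * norm z ^ N / norm z ^ N"
          unfolding norm_divide norm_power
          using C(3) z e by (intro divide_right_mono) auto
        then have 2: "norm (?R z) \<le> C" using z by simp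
        have "norm (Q e z) * norm (?R z) \<le> M / e * C"
          by (rule mult_mono[OF 1 2]) (use M0 e in auto)
        then show ?thesis by (simp only: norm_mult times_divide_eq_left)
      qed
    qed
    moreover have "measure lborel ?B = 4 * e\<^sup>2"
      using e by (simp add: content_cbox_if Basis_complex_def power2_eq_square box_eq_empty)
    ultimately have "norm (integral UNIV (\<lambda>z. Q e z * (g z / z ^ N))) \<le> (M * C / e) * (4 * e\<^sup>2)"
      unfolding eq by simp
    then show ?thesis using e by (simp add: power2_eq_square mult_ac)
  qed
  then show "\<exists>B. \<forall>e. 0 < e \<longrightarrow> e \<le> s \<longrightarrow> norm (integral UNIV (\<lambda>z. Q e z * (g z / z ^ N))) \<le> B * e"
    by blast
qed

text \<open>A pole of \<open>f\<close> at the origin contributes nothing to Stokes' theorem. Cutting \<open>f\<close> off in a disc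
  of radius \<open>e\<close> makes it smooth and creates the error term bounded by \<open>ring_integral_small\<close>. The bound on
  the Wirtinger derivative makes the limit \<open>e \<rightarrow> 0\<close> a case of dominated convergence.\<close>

lemma pole_stokes:
  assumes f: "smooth_on f (- {0})" and R: "\<And>z. R < norm z \<Longrightarrow> f z = 0"
    and g: "0 < r" "smooth_on g (ball 0 r)" "\<And>z. z \<in> ball 0 r - {0} \<Longrightarrow> f z = g z / z ^ N"
    and D: "0 < r'" "\<And>z. z \<noteq> 0 \<Longrightarrow> norm z < r' \<Longrightarrow> norm (wirtinger f z (- {0})) \<le> C / norm z"
  shows "(\<lambda>z. wirtinger f z (- {0})) absolutely_integrable_on (- {0})"
    and "integral (- {0}) (\<lambda>z. wirtinger f z (- {0})) = 0"
proof -
  let ?W = "- {0::complex}"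
  let ?D = "\<lambda>z. wirtinger f z ?W"
  have oW: "open ?W" by (simp add: open_Compl)
  note tW = thick_open[OF oW]
  have sD: "smooth_on ?D ?W" by (rule smooth_on_wirtinger[OF tW f])
  have D0: "?D z = 0" if "R < norm z" "z \<noteq> 0" for z
    by (rule wirtinger_eq_0_outside[OF tW, of "cball 0 R"]) (use that R in auto)
  show iD: "?D absolutely_integrable_on ?W"
  proof (rule log_singular_integrable[of "cball 0 R" _ _ r' C])
    show "continuous_on (cball 0 R - {0}) ?D"
      by (rule continuous_on_subset[OF smooth_on_imp_continuous_on[OF sD]]) auto
  qed (use D D0 in auto)
  obtain c' M where c': "continuous_on UNIV c'" "\<And>s. (cutoff has_real_derivative c' s) (at s)"
    "\<And>s. \<bar>c' s\<bar> \<le> M" "\<And>s. s < 1/2 \<Longrightarrow> c' s = 0" "\<And>s. 1 < s \<Longrightarrow> c' s = 0"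
    by (rule cutoff_derivative) (rule that)
  define s where "s = r / 2"
  have s: "0 < s" "s < r" using g(1) by (auto simp: s_def)
  let ?Q = "\<lambda>e z. of_real (c' ((cmod z)\<^sup>2 / e\<^sup>2)) * cnj z / of_real (e\<^sup>2) :: complex"
  let ?\<psi> = "\<lambda>e z. complex_of_real (cutoff ((cmod z)\<^sup>2 / e\<^sup>2))"
  obtain B where "\<forall>e. 0 < e \<longrightarrow> e \<le> s \<longrightarrow> norm (integral UNIV (\<lambda>z. ?Q e z * (g z / z ^ N))) \<le> B * e"
    using ring_integral_small(2)[OF c'(1,3,4,5) g(2) s] by blast
  then have B: "norm (integral UNIV (\<lambda>z. ?Q e z * (g z / z ^ N))) \<le> B * e" if "0 < e" "e \<le> s" for e
    using that by (simp only:)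
  \<comment> \<open>Stokes for the smooth function \<open>(1 - \<psi>) f\<close>; the derivative of the cutoff leaves the error term.\<close>
  have key: "((\<lambda>z. (1 - ?\<psi> e z) * ?D z) has_integral integral UNIV (\<lambda>z. ?Q e z * (g z / z ^ N))) ?W"
    if e: "0 < e" "e \<le> s" for e
  proof -
    let ?F = "\<lambda>z. (1 - ?\<psi> e z) * f z"
    have s\<psi>: "smooth_on (?\<psi> e) S" for S
    proof (rule smooth_on_of_real)
      have "smooth_on (\<lambda>z. (cmod z)\<^sup>2 * (1 / e\<^sup>2)) S"
        by (intro smooth_on_mult smooth_on_norm_square smooth_on_ident smooth_on_const)
      then have "smooth_on (\<lambda>z. (cmod z)\<^sup>2 / e\<^sup>2) S" by simp
      from smooth_on_compose[OF this smooth_on_cutoff[of UNIV]]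
      show "smooth_on (\<lambda>z. cutoff ((cmod z)\<^sup>2 / e\<^sup>2)) S" by simp
    qed
    have FW: "smooth_on ?F ?W" by (intro smooth_on_mult smooth_on_diff smooth_on_const s\<psi> f)
    have F: "smooth_on ?F UNIV"
    proof (rule smooth_on_local)
      fix x :: complex
      show "\<exists>U. open U \<and> x \<in> U \<and> smooth_on ?F (UNIV \<inter> U)"
      proof (cases "x = 0")
        case True
        have "?F z = 0" if "z \<in> ball 0 (e / 2)" for z
        proof -
          have "(norm z)\<^sup>2 \<le> (e / 2)\<^sup>2" using that by (intro power_mono) auto
          then have "4 * (norm z)\<^sup>2 \<le> e\<^sup>2" by (simp add: power_divide)
          then have "2 * (norm z)\<^sup>2 \<le> e\<^sup>2" using zero_le_power2[of "norm z"] by linarith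
          then have "(cmod z)\<^sup>2 / e\<^sup>2 \<le> 1/2" using e by (simp add: divide_le_eq)
          then show ?thesis by (simp add: cutoff_eq_1)
        qed
        then have "smooth_on ?F (ball 0 (e / 2))"
          using smooth_on_cong[of "ball 0 (e/2)" ?F "\<lambda>z. 0"] by simp
        then have "open (ball 0 (e / 2)) \<and> x \<in> ball 0 (e / 2) \<and> smooth_on ?F (UNIV \<inter> ball 0 (e / 2))"
          unfolding True using e by simp
        then show ?thesis by blast
      next
        case False
        then have "open ?W \<and> x \<in> ?W \<and> smooth_on ?F (UNIV \<inter> ?W)"
          using FW oW by (simp only: Int_UNIV_left) simp
        then show ?thesis by blast
      qed
    qed
    have F0: "?F z = 0" if "z \<in> UNIV - cball 0 R" for z using R that by auto
    have "integral UNIV (\<lambda>z. wirtinger ?F z UNIV * (- 2 * \<i>)) = 0"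
      by (rule compact_support_stokes_open[OF open_UNIV compact_cball[of 0 R] subset_UNIV F F0])
    then have int0: "integral UNIV (\<lambda>z. wirtinger ?F z UNIV) = 0" by simp
    have iF: "(\<lambda>z. wirtinger ?F z UNIV) absolutely_integrable_on UNIV"
    proof (rule absolutely_integrable_compact_support(1)[of "cball 0 R"])
      show "continuous_on (cball 0 R) (\<lambda>z. wirtinger ?F z UNIV)"
        by (rule continuous_on_subset[OF smooth_on_imp_continuous_on[OF smooth_on_wirtinger[OF thick_UNIV F]]]) simp
      show "wirtinger ?F z UNIV = 0" if "z \<in> UNIV - cball 0 R" for z
        by (rule wirtinger_eq_0_outside[OF thick_UNIV closed_cball that F0])
    qed auto
    have iQ: "(\<lambda>z. ?Q e z * (g z / z ^ N)) absolutely_integrable_on UNIV"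
      by (rule ring_integral_small(1)[OF c'(1,3,4,5) g(2) s e])
        (auto intro!: continuous_intros continuous_on_subset[OF smooth_on_imp_continuous_on[OF g(2)]])
    have I1: "((\<lambda>z. wirtinger ?F z UNIV + ?Q e z * (g z / z ^ N)) has_integral
        0 + integral UNIV (\<lambda>z. ?Q e z * (g z / z ^ N))) UNIV"
      using integrable_integral[OF set_lebesgue_integral_eq_integral(1)[OF iF]]
        integrable_integral[OF set_lebesgue_integral_eq_integral(1)[OF iQ]]
      unfolding int0 by (rule has_integral_add)
    have I2: "wirtinger ?F z UNIV + ?Q e z * (g z / z ^ N) = (1 - ?\<psi> e z) * ?D z" if z: "z \<in> ?W" for z
    proof -
      have "wirtinger ?F z UNIV = wirtinger ?F z ?W"
        by (rule wirtinger_transfer[OF tW thick_UNIV UNIV_I oW z _ _ FW]) auto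
      also have "\<dots> = (1 - ?\<psi> e z) * ?D z + wirtinger (\<lambda>z. 1 - ?\<psi> e z) z ?W * f z"
        by (rule wirtinger_mult[OF tW z _ f]) (intro smooth_on_diff smooth_on_const s\<psi>)
      also have "wirtinger (\<lambda>z. 1 - ?\<psi> e z) z ?W = wirtinger (\<lambda>z. 1) z ?W - wirtinger (?\<psi> e) z ?W"
        by (rule wirtinger_diff[OF tW z smooth_on_const s\<psi>])
      also have "wirtinger (\<lambda>z. 1) z ?W = 0" by (rule wirtinger_const[OF tW z])
      also have "wirtinger (?\<psi> e) z ?W = wirtinger (?\<psi> e) z UNIV"
        by (rule wirtinger_transfer[OF thick_UNIV tW z open_UNIV _ _ _ s\<psi>]) auto
      also have "\<dots> = ?Q e z" by (rule wirtinger_cutoff[OF c'(2)])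
      finally have 1: "wirtinger ?F z UNIV = (1 - ?\<psi> e z) * ?D z - ?Q e z * f z" by (simp only: diff_0 mult_minus_left add_uminus_conv_diff)
      have "?Q e z * f z = ?Q e z * (g z / z ^ N)"
      proof (cases "norm z < r")
        case True
        then show ?thesis using g(3)[of z] z by simp
      next
        case False
        then have "e < norm z" using e s by simp
        then have "1 < (cmod z)\<^sup>2 / e\<^sup>2" using e by (simp add: power_strict_mono)
        then show ?thesis using c'(5) by simp
      qed
      with 1 show ?thesis by simp
    qed
    have I3: "((\<lambda>z. (1 - ?\<psi> e z) * ?D z) has_integral
        0 + integral UNIV (\<lambda>z. ?Q e z * (g z / z ^ N))) UNIV"
    proof (rule has_integral_spike[OF _ _ I1])
      show "negligible {0::complex}" by simp
      show "(1 - ?\<psi> e z) * ?D z = wirtinger ?F z UNIV + ?Q e z * (g z / z ^ N)"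
        if "z \<in> UNIV - {0}" for z using that by (intro I2[symmetric]) simp
    qed
    have "((\<lambda>z. (1 - ?\<psi> e z) * ?D z) has_integral
        0 + integral UNIV (\<lambda>z. ?Q e z * (g z / z ^ N))) ?W"
    proof (rule iffD1[OF has_integral_spike_set_eq I3])
      show "negligible {z \<in> UNIV - ?W. (1 - ?\<psi> e z) * ?D z \<noteq> 0}"
        by (rule negligible_subset[of "{0}"]) auto
      show "negligible {z \<in> ?W - UNIV. (1 - ?\<psi> e z) * ?D z \<noteq> 0}"
        by (rule negligible_subset[of "{0}"]) auto
    qed
    then show ?thesis by (simp only: add_0_left)
  qed
  define e where "e n = s / real (Suc n)" for n
  have e: "0 < e n" "e n \<le> s" for n using s by (auto simp: e_def divide_le_eq)
  have elim: "e \<longlonglongrightarrow> 0" unfolding e_def[abs_def] by (rule LIMSEQ_Suc[OF lim_const_over_n])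
  have conv: "(\<lambda>n. integral ?W (\<lambda>z. (1 - ?\<psi> (e n) z) * ?D z)) \<longlonglongrightarrow> integral ?W ?D"
  proof (rule dominated_convergence(2))
    show "(\<lambda>z. (1 - ?\<psi> (e n) z) * ?D z) integrable_on ?W" for n
      using key[OF e] by (rule has_integral_integrable)
    show "(\<lambda>z. norm (?D z)) integrable_on ?W"
      using iD by (simp add: absolutely_integrable_on_def)
    show "norm ((1 - ?\<psi> (e n) z) * ?D z) \<le> norm (?D z)" if "z \<in> ?W" for n z
    proof -
      have "norm (1 - ?\<psi> (e n) z) = \<bar>1 - cutoff ((cmod z)\<^sup>2 / (e n)\<^sup>2)\<bar>"
        by (metis norm_of_real of_real_1 of_real_diff)
      also have "\<dots> \<le> 1" using cutoff_nonneg cutoff_le_1 by (simp add: abs_le_iff)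
      finally show ?thesis by (simp add: norm_mult mult_left_le_one_le)
    qed
    show "(\<lambda>n. (1 - ?\<psi> (e n) z) * ?D z) \<longlonglongrightarrow> ?D z" if "z \<in> ?W" for z
    proof (rule tendsto_eventually)
      have "\<forall>\<^sub>F n in sequentially. e n < norm z"
        using order_tendstoD(2)[OF elim] that by simp
      then show "\<forall>\<^sub>F n in sequentially. (1 - ?\<psi> (e n) z) * ?D z = ?D z"
      proof (rule eventually_mono)
        fix n assume "e n < norm z"
        then have "1 \<le> (cmod z)\<^sup>2 / (e n)\<^sup>2" using e[of n] by (simp add: power_mono)
        then show "(1 - ?\<psi> (e n) z) * ?D z = ?D z" by (simp add: cutoff_eq_0)
      qed
    qed
  qed
  have "(\<lambda>n. integral ?W (\<lambda>z. (1 - ?\<psi> (e n) z) * ?D z)) \<longlonglongrightarrow> 0"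
  proof (rule Lim_null_comparison)
    show "(\<lambda>n. B * e n) \<longlonglongrightarrow> 0" using tendsto_mult_right_zero[OF elim] .
    show "\<forall>\<^sub>F n in sequentially. norm (integral ?W (\<lambda>z. (1 - ?\<psi> (e n) z) * ?D z)) \<le> B * e n"
      using B[OF e] integral_unique[OF key[OF e]] by (intro always_eventually allI) simp
  qed
  then show "integral ?W ?D = 0" using LIMSEQ_unique[OF conv] by blast
qed

section \<open>Charts of a Riemann surface\<close>

lemma thick_field_derivative_unique:
  assumes "thick S" "z \<in> S" "(f has_field_derivative d) (at z within S)"
    "(f has_field_derivative d') (at z within S)"
  shows "d = d'"
  using wirtinger_holomorphic[OF assms(1,2,3)] wirtinger_holomorphic[OF assms(1,2,4)] by simp

locale riemann =
  fixes X :: "'a topology" and A :: "'a chart set"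
  assumes surface: "riemann_surface X A"
begin

lemma hausdorff: "Hausdorff_space X"
  and chart: "c \<in> A \<Longrightarrow> is_chart X c"
  and cover: "(\<Union>c\<in>A. chart_dom c) = topspace X"
  and compat: "c \<in> A \<Longrightarrow> c' \<in> A \<Longrightarrow> compatible c c'"
  and maximal: "is_chart X c \<Longrightarrow> (\<And>c'. c' \<in> A \<Longrightarrow> compatible c c') \<Longrightarrow> c \<in> A"
proof -
  note s = surface[unfolded riemann_surface_def]
  show "Hausdorff_space X" using s by (elim conjE)
  show "is_chart X c" if "c \<in> A" using conjunct1[OF conjunct2[OF s]] that by (rule bspec)
  show "(\<Union>c\<in>A. chart_dom c) = topspace X" using s by (elim conjE)
  show "compatible c c'" if "c \<in> A" "c' \<in> A"
    using conjunct1[OF conjunct2[OF conjunct2[OF conjunct2[OF s]]]] that by blast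
  show "c \<in> A" if "is_chart X c" "\<And>c'. c' \<in> A \<Longrightarrow> compatible c c'"
  proof -
    have m: "\<forall>c. is_chart X c \<and> (\<forall>c'\<in>A. compatible c c') \<longrightarrow> c \<in> A" using s by (elim conjE)
    show ?thesis by (rule spec[OF m, THEN mp, OF conjI[OF that(1) ballI[OF that(2)]]])
  qed
qed

lemma dom_open: "c \<in> A \<Longrightarrow> openin X (chart_dom c)"
  using chart unfolding is_chart_def by blast

lemma dom_subset: "c \<in> A \<Longrightarrow> chart_dom c \<subseteq> topspace X"
  using dom_open openin_subset by blast

lemma topspace_dom: "c \<in> A \<Longrightarrow> topspace (subtopology X (chart_dom c)) = chart_dom c"
  by (simp add: topspace_subtopology dom_subset inf.absorb2)

lemma coord_homeo: "c \<in> A \<Longrightarrow>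
    homeomorphic_map (subtopology X (chart_dom c)) (top_of_set (chart_img c)) (coord c)"
  using chart unfolding is_chart_def by blast

lemma hopen_img: "c \<in> A \<Longrightarrow> hopen (chart_img c)"
  using chart unfolding is_chart_def hopen_def by blast

lemma coord_inj: "c \<in> A \<Longrightarrow> inj_on (coord c) (chart_dom c)"
  using homeomorphic_imp_injective_map[OF coord_homeo, of c] topspace_dom[of c] by simp

lemma inv_coord: "c \<in> A \<Longrightarrow> x \<in> chart_dom c \<Longrightarrow> chart_inv c (coord c x) = x"
  by (rule inv_into_f_f[OF coord_inj])

lemma coord_inv: "z \<in> coord c ` (chart_dom c \<inter> U) \<Longrightarrow> coord c (chart_inv c z) = z"
  by (rule f_inv_into_f) auto

lemma inv_in: "c \<in> A \<Longrightarrow> z \<in> coord c ` (chart_dom c \<inter> U) \<Longrightarrow> chart_inv c z \<in> chart_dom c \<inter> U"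
  by (elim imageE) (simp add: inv_coord)

lemma img_openin:
  assumes "c \<in> A" "openin X U"
  shows "openin (top_of_set (chart_img c)) (coord c ` (chart_dom c \<inter> U))"
proof -
  have "open_map (subtopology X (chart_dom c)) (top_of_set (chart_img c)) (coord c)"
    by (rule homeomorphic_imp_open_map[OF coord_homeo[OF assms(1)]])
  moreover have "openin (subtopology X (chart_dom c)) (chart_dom c \<inter> U)"
    using assms(2) by (auto simp: openin_subtopology)
  ultimately show ?thesis unfolding open_map_def by blast
qed

lemma hopen_chart: "c \<in> A \<Longrightarrow> openin X U \<Longrightarrow> hopen (coord c ` (chart_dom c \<inter> U))"
  by (rule hopen_openin[OF hopen_img img_openin])

lemma img_openE:
  assumes "c \<in> A" "openin X U"
  obtains V where "open V" "coord c ` (chart_dom c \<inter> U) = chart_img c \<inter> V"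
  using img_openin[OF assms] unfolding openin_open by blast

lemma preimage_openin:
  assumes "c \<in> A" "open V"
  shows "openin X {x \<in> chart_dom c. coord c x \<in> V}"
proof -
  have "continuous_map (subtopology X (chart_dom c)) (top_of_set (chart_img c)) (coord c)"
    by (rule homeomorphic_imp_continuous_map[OF coord_homeo[OF assms(1)]])
  moreover have "openin (top_of_set (chart_img c)) (chart_img c \<inter> V)"
    using assms(2) by (rule openin_open_Int)
  ultimately have "openin (subtopology X (chart_dom c))
      {x \<in> topspace (subtopology X (chart_dom c)). coord c x \<in> chart_img c \<inter> V}"
    by (rule openin_continuous_map_preimage)
  moreover have "{x \<in> topspace (subtopology X (chart_dom c)). coord c x \<in> chart_img c \<inter> V}
      = {x \<in> chart_dom c. coord c x \<in> V}"
    using topspace_dom[OF assms(1)] by auto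
  ultimately have "openin (subtopology X (chart_dom c)) {x \<in> chart_dom c. coord c x \<in> V}"
    by (simp only:)
  then show ?thesis by (simp only: openin_open_subtopology[OF dom_open[OF assms(1)]])
qed

lemma compact_coord_image:
  assumes "c \<in> A" "compactin X K" "K \<subseteq> chart_dom c"
  shows "compact (coord c ` K)"
proof -
  have "compactin (subtopology X (chart_dom c)) K" using assms by (simp add: compactin_subtopology)
  from image_compactin[OF this homeomorphic_imp_continuous_map[OF coord_homeo[OF assms(1)]]]
  show ?thesis by (simp add: compactin_subtopology)
qed

lemma finite_complement_openin:
  "finite D \<Longrightarrow> D \<subseteq> topspace X \<Longrightarrow> openin X (topspace X - D)"
  using closedin_Hausdorff_finite[OF hausdorff] by (simp add: closedin_def)

text \<open>Only the part of the finite set on the surface matters.\<close>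

lemma finite_complement_openin':
  assumes "finite D" shows "openin X (topspace X - D)"
proof -
  have "topspace X - D = topspace X - (D \<inter> topspace X)" by auto
  then show ?thesis using finite_complement_openin[of "D \<inter> topspace X"] assms by simp
qed

lemma chart_dom_minus: "c \<in> A \<Longrightarrow> chart_dom c - D = chart_dom c \<inter> (topspace X - D)"
  using dom_subset[of c] by auto

lemma hopen_minus: "c \<in> A \<Longrightarrow> finite D \<Longrightarrow> hopen (coord c ` (chart_dom c - D))"
  unfolding chart_dom_minus by (rule hopen_chart[OF _ finite_complement_openin'])

subsection \<open>Transition maps\<close>

text \<open>The workhorse for all changes of charts: near each point the transition map extends to a holomorphic
  \<open>F\<close> on an open set of the plane, also at the boundary, and the one-sided derivative in \<open>transition_deriv\<close>
  is that of \<open>F\<close> because chart images are thick.\<close>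

lemma transition:
  assumes c: "c \<in> A" and c': "c' \<in> A" and x: "x \<in> chart_dom c \<inter> chart_dom c'"
  obtains W F where "open W" "coord c x \<in> W" "F holomorphic_on W"
    "\<And>y. y \<in> chart_dom c \<inter> chart_dom c' \<Longrightarrow> coord c y \<in> W \<Longrightarrow>
      F (coord c y) = coord c' y \<and> transition_deriv c c' y = deriv F (coord c y)"
proof -
  let ?S = "coord c ` (chart_dom c \<inter> chart_dom c')"
  have tS: "thick ?S" by (rule hopen_thick[OF hopen_chart[OF c dom_open[OF c']]])
  obtain W F where W: "open W" "coord c x \<in> W" "F holomorphic_on W"
    "\<And>y. y \<in> chart_dom c \<inter> chart_dom c' \<Longrightarrow> coord c y \<in> W \<Longrightarrow> F (coord c y) = coord c' y"
    using compat[OF c c'] x unfolding compatible_def holo_transition_def by meson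
  have "transition_deriv c c' y = deriv F (coord c y)"
    if y: "y \<in> chart_dom c \<inter> chart_dom c'" "coord c y \<in> W" for y
  proof -
    obtain r where r: "r > 0" "ball (coord c y) r \<subseteq> W" using W(1) y(2) open_contains_ball by blast
    have "(F has_field_derivative deriv F (coord c y)) (at (coord c y) within ?S)"
      by (rule has_field_derivative_at_within[OF holomorphic_derivI[OF W(3,1) y(2)]])
    then have D: "((coord c' \<circ> chart_inv c) has_field_derivative deriv F (coord c y)) (at (coord c y) within ?S)"
    proof (rule has_field_derivative_transform_within)
      show "0 < r" by (rule r(1))
      show "F w = (coord c' \<circ> chart_inv c) w" if "w \<in> ?S" "dist w (coord c y) < r" for w
      proof -
        from that(1) obtain u where u: "u \<in> chart_dom c \<inter> chart_dom c'" "w = coord c u" ..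
        have "w \<in> W" using \<open>dist w (coord c y) < r\<close> r(2) by (auto simp: dist_commute)
        then show ?thesis using W(4)[OF u(1)] u inv_coord[OF c, of u] by simp
      qed
    qed (use y in auto)
    show ?thesis unfolding transition_deriv_def
      by (rule the_equality, rule D, rule thick_field_derivative_unique[OF tS _ _ D]) (use y in auto)
  qed
  then show ?thesis by (intro that[OF W(1-3)] conjI W(4))
qed

lemma smooth_transition:
  assumes c: "c \<in> A" and c': "c' \<in> A"
  shows "smooth_on (\<lambda>z. coord c' (chart_inv c z)) (coord c ` (chart_dom c \<inter> chart_dom c'))" (is "smooth_on ?f ?S")
    and "smooth_on (\<lambda>z. transition_deriv c c' (chart_inv c z)) (coord c ` (chart_dom c \<inter> chart_dom c'))" (is "smooth_on ?g _")
proof -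
  have *: "\<exists>W. open W \<and> z \<in> W \<and> smooth_on ?f (?S \<inter> W) \<and> smooth_on ?g (?S \<inter> W)" if zS: "z \<in> ?S" for z
  proof -
    from zS obtain x where x: "z = coord c x" "x \<in> chart_dom c \<inter> chart_dom c'" ..
    obtain W F where W: "open W" "coord c x \<in> W" "F holomorphic_on W"
      "\<And>y. y \<in> chart_dom c \<inter> chart_dom c' \<Longrightarrow> coord c y \<in> W \<Longrightarrow>
        F (coord c y) = coord c' y \<and> transition_deriv c c' y = deriv F (coord c y)"
      by (rule transition[OF c c' x(2)]) (rule that)
    have eq: "?f w = F w \<and> ?g w = deriv F w" if "w \<in> ?S \<inter> W" for w
      using that W(4) inv_coord[OF c] by auto
    have "smooth_on F (?S \<inter> W)" "smooth_on (deriv F) (?S \<inter> W)"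
      by (rule smooth_on_subset[OF smooth_on_holomorphic[OF W(1,3)]], simp)
        (rule smooth_on_subset[OF smooth_on_holomorphic[OF W(1) holomorphic_deriv[OF W(3,1)]]], simp)
    then have "smooth_on ?f (?S \<inter> W)" "smooth_on ?g (?S \<inter> W)"
      using smooth_on_cong[of "?S \<inter> W" ?f F] smooth_on_cong[of "?S \<inter> W" ?g "deriv F"] eq by auto
    then show ?thesis using W x by blast
  qed
  show "smooth_on ?f ?S" by (rule smooth_on_local) (use * in blast)
  show "smooth_on ?g ?S" by (rule smooth_on_local) (use * in blast)
qed

lemma smooth_chart_change:
  fixes f :: "'a \<Rightarrow> 'b::real_normed_vector"
  assumes c: "c \<in> A" and c': "c' \<in> A"
    and f: "smooth_on (\<lambda>z. f (chart_inv c' z)) (coord c' ` (chart_dom c' \<inter> U))"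
  shows "smooth_on (\<lambda>z. f (chart_inv c z)) (coord c ` (chart_dom c \<inter> chart_dom c' \<inter> U))"
proof -
  let ?S = "coord c ` (chart_dom c \<inter> chart_dom c' \<inter> U)"
  have "smooth_on (\<lambda>z. coord c' (chart_inv c z)) ?S"
    by (rule smooth_on_subset[OF smooth_transition(1)[OF c c']]) auto
  from this f
  have "smooth_on (\<lambda>z. f (chart_inv c' (coord c' (chart_inv c z)))) ?S"
    by (rule smooth_on_compose) (use inv_coord[OF c] in auto)
  moreover have "f (chart_inv c' (coord c' (chart_inv c z))) = f (chart_inv c z)" if "z \<in> ?S" for z
    using that inv_coord[OF c] inv_coord[OF c'] by auto
  ultimately show ?thesis
    using smooth_on_cong[of ?S "\<lambda>z. f (chart_inv c' (coord c' (chart_inv c z)))" "\<lambda>z. f (chart_inv c z)"]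
    by blast
qed

lemma transition_deriv_cocycle:
  assumes c: "c \<in> A" "c' \<in> A" "c'' \<in> A"
    and x: "x \<in> chart_dom c" "x \<in> chart_dom c'" "x \<in> chart_dom c''"
  shows "transition_deriv c c'' x = transition_deriv c c' x * transition_deriv c' c'' x"
proof -
  obtain U F where F: "open U" "coord c x \<in> U" "F holomorphic_on U"
    "\<And>y. y \<in> chart_dom c \<inter> chart_dom c' \<Longrightarrow> coord c y \<in> U \<Longrightarrow>
        F (coord c y) = coord c' y \<and> transition_deriv c c' y = deriv F (coord c y)"
    by (rule transition[OF c(1,2), of x]) (use x that in auto)
  obtain V G where G: "open V" "coord c' x \<in> V" "G holomorphic_on V"
    "\<And>y. y \<in> chart_dom c' \<inter> chart_dom c'' \<Longrightarrow> coord c' y \<in> V \<Longrightarrow>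
        G (coord c' y) = coord c'' y \<and> transition_deriv c' c'' y = deriv G (coord c' y)"
    by (rule transition[OF c(2,3), of x]) (use x that in auto)
  obtain W H where H: "open W" "coord c x \<in> W" "H holomorphic_on W"
    "\<And>y. y \<in> chart_dom c \<inter> chart_dom c'' \<Longrightarrow> coord c y \<in> W \<Longrightarrow>
        H (coord c y) = coord c'' y \<and> transition_deriv c c'' y = deriv H (coord c y)"
    by (rule transition[OF c(1,3), of x]) (use x that in auto)
  let ?z = "coord c x"
  define P where "P = U \<inter> F -` V \<inter> W"
  have P: "open P" "?z \<in> P"
    using continuous_open_preimage[OF holomorphic_on_imp_continuous_on[OF F(3)] F(1) G(1)] H(1,2) F(2,4) G(2) x
    by (auto simp: P_def)
  let ?S = "coord c ` (chart_dom c \<inter> (chart_dom c' \<inter> chart_dom c''))"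
  have tS: "thick ?S"
    by (rule hopen_thick[OF hopen_chart[OF c(1) openin_Int[OF dom_open[OF c(2)] dom_open[OF c(3)]]]])
  have z: "?z \<in> ?S" using x by auto
  have dF: "(F has_field_derivative deriv F ?z) (at ?z within ?S)"
    by (rule has_field_derivative_at_within[OF holomorphic_derivI[OF F(3,1,2)]])
  have Fz: "F ?z = coord c' x" using F(4)[of x] F(2) x by simp
  obtain r where r: "r > 0" "ball ?z r \<subseteq> P" using P open_contains_ball by blast
  have "(G has_field_derivative deriv G (F ?z)) (at (F ?z))"
    by (rule holomorphic_derivI[OF G(3,1)]) (use G(2) Fz in simp)
  from DERIV_chain2[OF this dF]
  have "((\<lambda>w. G (F w)) has_field_derivative deriv G (F ?z) * deriv F ?z) (at ?z within ?S)" .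
  then have D: "(H has_field_derivative deriv G (F ?z) * deriv F ?z) (at ?z within ?S)"
  proof (rule has_field_derivative_transform_within)
    show "0 < r" by (rule r(1))
    show "G (F w) = H w" if w: "w \<in> ?S" "dist w ?z < r" for w
    proof -
      obtain u where u: "u \<in> chart_dom c" "u \<in> chart_dom c'" "u \<in> chart_dom c''" "w = coord c u"
        using w(1) by blast
      have "w \<in> P" using w(2) r(2) by (auto simp: dist_commute)
      then show ?thesis using F(4)[of u] G(4)[of u] H(4)[of u] u by (auto simp: P_def)
    qed
  qed (use z in auto)
  have dH: "(H has_field_derivative deriv H ?z) (at ?z within ?S)"
    by (rule has_field_derivative_at_within[OF holomorphic_derivI[OF H(3,1,2)]])
  have "deriv H ?z = deriv G (F ?z) * deriv F ?z"
    by (rule thick_field_derivative_unique[OF tS z dH D])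
  then show ?thesis using F(2,4) G(2,4) H(2,4) x Fz by simp
qed

lemma transition_deriv_same:
  assumes c: "c \<in> A" and c': "c' \<in> A" and x: "x \<in> chart_dom c \<inter> chart_dom c'"
    and eq: "\<And>y. y \<in> chart_dom c \<inter> chart_dom c' \<Longrightarrow> coord c' y = coord c y"
  shows "transition_deriv c c' x = 1"
proof -
  let ?S = "coord c ` (chart_dom c \<inter> chart_dom c')"
  have tS: "thick ?S" by (rule hopen_thick[OF hopen_chart[OF c dom_open[OF c']]])
  have "((\<lambda>w. w) has_field_derivative 1) (at (coord c x) within ?S)" by (rule DERIV_ident)
  then have D: "((coord c' \<circ> chart_inv c) has_field_derivative 1) (at (coord c x) within ?S)"
    by (rule has_field_derivative_transform_within[of _ _ _ _ 1]) (use x eq inv_coord[OF c] in auto)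
  show ?thesis unfolding transition_deriv_def
    by (rule the_equality, rule D, rule thick_field_derivative_unique[OF tS _ _ D]) (use x in auto)
qed

lemma transition_deriv_inverse:
  assumes "c \<in> A" "c' \<in> A" "x \<in> chart_dom c" "x \<in> chart_dom c'"
  shows "transition_deriv c c' x * transition_deriv c' c x = 1"
  using transition_deriv_cocycle[of c c' c x] transition_deriv_same[of c c x] assms by simp

lemma transition_deriv_nonzero:
  assumes "c \<in> A" "c' \<in> A" "x \<in> chart_dom c" "x \<in> chart_dom c'"
  shows "transition_deriv c c' x \<noteq> 0"
  using transition_deriv_inverse[OF assms] by auto

subsection \<open>The boundary\<close>

text \<open>An injective holomorphic map is open, so interior points of one chart image go to interior points of
  the other. Hence the boundary can be read off in any chart.\<close>

lemma interior_transition: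
  assumes c: "c \<in> A" and c': "c' \<in> A" and x: "x \<in> chart_dom c" "x \<in> chart_dom c'"
    and i: "coord c x \<in> interior (chart_img c)"
  shows "coord c' x \<in> interior (chart_img c')"
proof -
  obtain W F where W: "open W" "coord c x \<in> W" "F holomorphic_on W"
    "\<And>y. y \<in> chart_dom c \<inter> chart_dom c' \<Longrightarrow> coord c y \<in> W \<Longrightarrow>
      F (coord c y) = coord c' y \<and> transition_deriv c c' y = deriv F (coord c y)"
    by (rule transition[OF c c', of x]) (use x that in auto)
  obtain V where V: "open V" "coord c ` (chart_dom c \<inter> chart_dom c') = chart_img c \<inter> V"
    by (rule img_openE[OF c dom_open[OF c']]) (rule that)
  define U where "U = interior (chart_img c) \<inter> V \<inter> W"
  have "coord c x \<in> V" using V(2) x by blast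
  then have U: "open U" "coord c x \<in> U" using V W i by (auto simp: U_def)
  have Us: "\<exists>y. y \<in> chart_dom c \<inter> chart_dom c' \<and> w = coord c y \<and> F w = coord c' y" if "w \<in> U" for w
  proof -
    have "w \<in> coord c ` (chart_dom c \<inter> chart_dom c')" "w \<in> W"
      unfolding V(2) using that interior_subset[of "chart_img c"] by (auto simp: U_def)
    then show ?thesis using W(4) by blast
  qed
  have "inj_on F U"
  proof (rule inj_onI)
    fix v w assume "v \<in> U" "w \<in> U" "F v = F w"
    then obtain y y' where "y \<in> chart_dom c \<inter> chart_dom c'" "v = coord c y" "F v = coord c' y"
      "y' \<in> chart_dom c \<inter> chart_dom c'" "w = coord c y'" "F w = coord c' y'"
      using Us by meson
    then show "v = w" using \<open>F v = F w\<close> coord_inj[OF c'] by (auto simp: inj_on_def)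
  qed
  then have "open (F ` U)"
    by (intro open_mapping_thm3[OF holomorphic_on_subset[OF W(3)]] U(1)) (auto simp: U_def)
  moreover have "F ` U \<subseteq> chart_img c'" using Us by blast
  moreover have "coord c' x \<in> F ` U" using W(4)[of x] W(2) x U(2) by (metis IntI image_eqI)
  ultimately show ?thesis using interiorI by metis
qed

lemma boundary_iff:
  assumes "c \<in> A" "x \<in> chart_dom c"
  shows "x \<in> surface_boundary A \<longleftrightarrow> coord c x \<notin> interior (chart_img c)"
  using interior_transition[OF assms(1) _ assms(2)] interior_transition[OF _ assms(1) _ assms(2)] assms
  unfolding surface_boundary_def by blast

lemma boundary_img_open: "c \<in> A \<Longrightarrow> open (chart_img c) \<Longrightarrow> boundary_img A c = {}"
  unfolding boundary_img_def using boundary_iff[of c] by (auto simp: interior_open)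

lemma not_interior_real:
  assumes "S \<subseteq> {z. 0 \<le> Im z}" shows "complex_of_real t \<notin> interior S"
proof
  assume "complex_of_real t \<in> interior S"
  then obtain e where e: "e > 0" "ball (complex_of_real t) e \<subseteq> S" unfolding mem_interior by blast
  have "Complex t (- e / 2) \<in> ball (complex_of_real t) e"
    using e(1) by (simp add: dist_norm complex_of_real_def cmod_def)
  then have "Complex t (- e / 2) \<in> S" using e(2) by blast
  then have "0 \<le> Im (Complex t (- e / 2))" using assms by blast
  then show False using e(1) by simp
qed

lemma boundary_img_halfplane:
  assumes c: "c \<in> A" and o: "openin (top_of_set {z. 0 \<le> Im z}) (chart_img c)"
  shows "boundary_img A c = {t. complex_of_real t \<in> chart_img c}"
proof -
  have "complex_of_real t \<notin> interior (chart_img c)" for t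
    by (rule not_interior_real[OF openin_imp_subset[OF o]])
  then have b: "x \<in> surface_boundary A" if "x \<in> chart_dom c" "complex_of_real t = coord c x" for t x
    using boundary_iff[OF c that(1)] unfolding that(2)[symmetric] by blast
  show ?thesis
  proof (intro set_eqI iffI)
    fix t assume "t \<in> {t. complex_of_real t \<in> chart_img c}"
    then obtain x where "complex_of_real t = coord c x" "x \<in> chart_dom c" by blast
    then show "t \<in> boundary_img A c" unfolding boundary_img_def using b by blast
  next
    fix t assume "t \<in> boundary_img A c"
    then show "t \<in> {t. complex_of_real t \<in> chart_img c}" unfolding boundary_img_def by blast
  qed
qed

subsection \<open>Restricted charts\<close>

lemma restrict_chart:
  assumes c: "c \<in> A" and U: "openin X U"
  shows "(chart_dom c \<inter> U, coord c) \<in> A"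
proof (rule maximal)
  let ?V = "chart_dom c \<inter> U"
  have oV: "openin X ?V" using dom_open[OF c] U by blast
  have im: "openin (top_of_set (chart_img c)) (coord c ` ?V)" by (rule img_openin[OF c U])
  have "homeomorphic_map (subtopology (subtopology X (chart_dom c)) ?V)
      (subtopology (top_of_set (chart_img c)) (coord c ` ?V)) (coord c)"
    by (rule homeomorphic_map_subtopologies_alt[OF coord_homeo[OF c]])
      (use dom_subset[OF c] openin_subset[OF oV] coord_inj[OF c] in \<open>auto simp: inj_on_def\<close>)
  moreover have "subtopology (subtopology X (chart_dom c)) ?V = subtopology X ?V"
    by (simp add: subtopology_subtopology Int_absorb1 inf.absorb2 Int_assoc[symmetric])
  moreover have "subtopology (top_of_set (chart_img c)) (coord c ` ?V) = top_of_set (coord c ` ?V)"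
    using openin_imp_subset[OF im] by (simp add: subtopology_subtopology inf.absorb2)
  ultimately have "homeomorphic_map (subtopology X ?V) (top_of_set (coord c ` ?V)) (coord c)" by simp
  moreover have "hopen (coord c ` ?V)" by (rule hopen_chart[OF c U])
  ultimately show "is_chart X (?V, coord c)"
    using oV unfolding is_chart_def hopen_def by simp
  fix c' assume c': "c' \<in> A"
  have "holo_transition c c'" "holo_transition c' c" using compat[OF c c'] unfolding compatible_def by auto
  then show "compatible (?V, coord c) c'"
    unfolding compatible_def holo_transition_def by (simp add: Ball_def) meson
qed

end

section \<open>Smooth forms and poles\<close>

lemma pole_smooth_quotient:
  assumes "smooth_on g (ball 0 r)" shows "smooth_on (\<lambda>z. g z / z ^ N) (ball 0 r - {0::complex})"
  by (intro smooth_on_divide smooth_on_subset[OF assms] smooth_on_power smooth_on_ident) auto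

text \<open>A statement about the germ at the origin of a fixed chart. It is easier to transport and to combine than
  membership in \<open>pole_forms\<close>, which asks for a chart on all of whose domain the form is a quotient.\<close>

definition has_pole :: "'a chart \<Rightarrow> nat \<Rightarrow> 'a form \<Rightarrow> bool" where
  "has_pole c N \<omega> \<longleftrightarrow> (\<exists>r>0. \<exists>g. ball 0 r \<subseteq> chart_img c \<and> smooth_on g (ball 0 r) \<and>
     (\<forall>z\<in>ball 0 r - {0}. \<omega> c (chart_inv c z) = g z / z ^ N))"

lemma has_poleE:
  assumes "has_pole c N \<omega>"
  obtains r g where "0 < r" "ball 0 r \<subseteq> chart_img c" "smooth_on g (ball 0 r)"
    "\<And>z. z \<in> ball 0 r \<Longrightarrow> z \<noteq> 0 \<Longrightarrow> \<omega> c (chart_inv c z) = g z / z ^ N"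
  using assms unfolding has_pole_def by (meson DiffI singletonD)

lemma has_poleI:
  assumes "0 < r" "ball 0 r \<subseteq> chart_img c" "smooth_on g (ball 0 r)"
    "\<And>z. z \<in> ball 0 r \<Longrightarrow> z \<noteq> 0 \<Longrightarrow> \<omega> c (chart_inv c z) = g z / z ^ N"
  shows "has_pole c N \<omega>"
  unfolding has_pole_def by (intro exI[of _ r] exI[of _ g] conjI ballI assms) auto

lemma has_pole_raise:
  assumes "has_pole c N \<omega>" shows "has_pole c (N + k) \<omega>"
proof -
  obtain r g where g: "0 < r" "ball 0 r \<subseteq> chart_img c" "smooth_on g (ball 0 r)"
    "\<And>z. z \<in> ball 0 r \<Longrightarrow> z \<noteq> 0 \<Longrightarrow> \<omega> c (chart_inv c z) = g z / z ^ N"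
    by (rule has_poleE[OF assms]) (rule that)
  show ?thesis
  proof (rule has_poleI[OF g(1,2)])
    show "smooth_on (\<lambda>z. g z * z ^ k) (ball 0 r)"
      by (intro smooth_on_mult g(3) smooth_on_power smooth_on_ident)
    show "\<omega> c (chart_inv c z) = g z * z ^ k / z ^ (N + k)" if "z \<in> ball 0 r" "z \<noteq> 0" for z
      using g(4)[OF that] that(2) by (simp add: power_add)
  qed
qed

lemma has_pole_diff:
  assumes "has_pole c N \<omega>" "has_pole c N \<omega>'"
  shows "has_pole c N (\<lambda>c x. \<omega> c x - \<omega>' c x)"
proof -
  obtain r g where g: "0 < r" "ball 0 r \<subseteq> chart_img c" "smooth_on g (ball 0 r)"
    "\<And>z. z \<in> ball 0 r \<Longrightarrow> z \<noteq> 0 \<Longrightarrow> \<omega> c (chart_inv c z) = g z / z ^ N"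
    by (rule has_poleE[OF assms(1)]) (rule that)
  obtain s h where h: "0 < s" "ball 0 s \<subseteq> chart_img c" "smooth_on h (ball 0 s)"
    "\<And>z. z \<in> ball 0 s \<Longrightarrow> z \<noteq> 0 \<Longrightarrow> \<omega>' c (chart_inv c z) = h z / z ^ N"
    by (rule has_poleE[OF assms(2)]) (rule that)
  show ?thesis
  proof (rule has_poleI[of "min r s" _ "\<lambda>z. g z - h z"])
    show "smooth_on (\<lambda>z. g z - h z) (ball 0 (min r s))"
      by (intro smooth_on_diff smooth_on_subset[OF g(3)] smooth_on_subset[OF h(3)]) auto
    show "\<omega> c (chart_inv c z) - \<omega>' c (chart_inv c z) = (g z - h z) / z ^ N"
      if "z \<in> ball 0 (min r s)" "z \<noteq> 0" for z
      using g(4)[of z] h(4)[of z] that by (simp add: diff_divide_distrib)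
    show "ball 0 (min r s) \<subseteq> chart_img c" by (rule order_trans[OF _ g(2)]) auto
  qed (use g h in simp)
qed

locale marked_surface = riemann X A for X :: "'a topology" and A :: "'a chart set" +
  fixes D :: "'a set"
  assumes finD: "finite D" and DX: "D \<subseteq> topspace X" and Dbd: "D \<inter> surface_boundary A = {}"
begin

lemma smooth_formsD:
  assumes "\<omega> \<in> smooth_forms A p q D"
  shows "c \<in> A \<Longrightarrow> smooth_on (\<lambda>z. \<omega> c (chart_inv c z)) (coord c ` (chart_dom c - D))"
    and "c \<in> A \<Longrightarrow> c' \<in> A \<Longrightarrow> x \<in> chart_dom c \<Longrightarrow> x \<in> chart_dom c' \<Longrightarrow> x \<notin> D \<Longrightarrow>
      \<omega> c x = \<omega> c' x * transition_deriv c c' x ^ p * cnj (transition_deriv c c' x) ^ q"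
  using assms unfolding smooth_forms_def by blast+

lemma smooth_formsI:
  assumes "\<And>c. c \<in> A \<Longrightarrow> smooth_on (\<lambda>z. \<omega> c (chart_inv c z)) (coord c ` (chart_dom c - D))"
    and "\<And>c c' x. c \<in> A \<Longrightarrow> c' \<in> A \<Longrightarrow> x \<in> chart_dom c \<Longrightarrow> x \<in> chart_dom c' \<Longrightarrow> x \<notin> D \<Longrightarrow>
      \<omega> c x = \<omega> c' x * transition_deriv c c' x ^ p * cnj (transition_deriv c c' x) ^ q"
  shows "\<omega> \<in> smooth_forms A p q D"
  unfolding smooth_forms_def by (intro CollectI conjI ballI assms) auto

text \<open>Given the transformation law, smoothness near a point may be checked in any one chart.\<close>

lemma smooth_forms_localI:
  assumes law: "\<And>c c' x. c \<in> A \<Longrightarrow> c' \<in> A \<Longrightarrow> x \<in> chart_dom c \<Longrightarrow> x \<in> chart_dom c' \<Longrightarrow> x \<notin> D \<Longrightarrow>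
      \<omega> c x = \<omega> c' x * transition_deriv c c' x ^ p * cnj (transition_deriv c c' x) ^ q"
    and loc: "\<And>x. x \<in> topspace X \<Longrightarrow> x \<notin> D \<Longrightarrow> \<exists>c\<in>A. \<exists>U. openin X U \<and> x \<in> U \<and> x \<in> chart_dom c \<and>
      U \<inter> D = {} \<and> smooth_on (\<lambda>z. \<omega> c (chart_inv c z)) (coord c ` (chart_dom c \<inter> U))"
  shows "\<omega> \<in> smooth_forms A p q D"
proof (rule smooth_formsI[OF _ law])
  fix c assume c: "c \<in> A"
  show "smooth_on (\<lambda>z. \<omega> c (chart_inv c z)) (coord c ` (chart_dom c - D))"
  proof (rule smooth_on_local)
    fix z assume "z \<in> coord c ` (chart_dom c - D)"
    then obtain x where x: "z = coord c x" "x \<in> chart_dom c - D" ..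
    then have "x \<in> topspace X" "x \<notin> D" using dom_subset[OF c] by auto
    from loc[OF this] obtain k U where k: "k \<in> A" "openin X U" "x \<in> U" "x \<in> chart_dom k" "U \<inter> D = {}"
      and sm: "smooth_on (\<lambda>z. \<omega> k (chart_inv k z)) (coord k ` (chart_dom k \<inter> U))" by blast
    let ?S = "coord c ` (chart_dom c \<inter> chart_dom k \<inter> U)"
    obtain V where V: "open V" "coord c ` (chart_dom c \<inter> (chart_dom k \<inter> U)) = chart_img c \<inter> V"
      by (rule img_openE[OF c openin_Int[OF dom_open[OF k(1)] k(2)]]) (rule that)
    have td: "smooth_on (\<lambda>z. transition_deriv c k (chart_inv c z)) ?S"
      by (rule smooth_on_subset[OF smooth_transition(2)[OF c k(1)]]) auto
    have "smooth_on (\<lambda>z. \<omega> k (chart_inv c z)) ?S" by (rule smooth_chart_change[OF c k(1) sm])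
    then have sm': "smooth_on (\<lambda>z. \<omega> k (chart_inv c z) * transition_deriv c k (chart_inv c z) ^ p *
        cnj (transition_deriv c k (chart_inv c z)) ^ q) ?S"
      by (intro smooth_on_mult smooth_on_power smooth_on_cnj td)
    have eq: "\<omega> k (chart_inv c z) * transition_deriv c k (chart_inv c z) ^ p *
        cnj (transition_deriv c k (chart_inv c z)) ^ q = \<omega> c (chart_inv c z)" if z: "z \<in> ?S" for z
    proof -
      have "chart_inv c z \<in> chart_dom c \<inter> (chart_dom k \<inter> U)"
        by (rule inv_in[OF c]) (use z in \<open>simp add: Int_assoc\<close>)
      then have "chart_inv c z \<in> chart_dom c" "chart_inv c z \<in> chart_dom k" "chart_inv c z \<notin> D"
        using k(5) by blast+
      from law[OF c k(1) this] show ?thesis by (rule sym)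
    qed
    have "smooth_on (\<lambda>z. \<omega> c (chart_inv c z)) ?S"
      by (rule iffD1[OF smooth_on_cong[OF eq] sm'])
    moreover have "coord c ` (chart_dom c - D) \<inter> V \<subseteq> ?S"
      using V(2) by (auto simp: Int_assoc)
    ultimately have "smooth_on (\<lambda>z. \<omega> c (chart_inv c z)) (coord c ` (chart_dom c - D) \<inter> V)"
      by (rule smooth_on_subset)
    moreover have "z \<in> V" using V(2) x k by blast
    ultimately show "\<exists>V. open V \<and> z \<in> V \<and> smooth_on (\<lambda>z. \<omega> c (chart_inv c z)) (coord c ` (chart_dom c - D) \<inter> V)"
      using V(1) by blast
  qed
qed

lemma smooth_forms_diff:
  assumes "\<omega> \<in> smooth_forms A p q D" "\<omega>' \<in> smooth_forms A p q D"
  shows "(\<lambda>c x. \<omega> c x - \<omega>' c x) \<in> smooth_forms A p q D"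
proof (rule smooth_formsI)
  show "smooth_on (\<lambda>z. \<omega> c (chart_inv c z) - \<omega>' c (chart_inv c z)) (coord c ` (chart_dom c - D))"
    if "c \<in> A" for c
    by (intro smooth_on_diff smooth_formsD(1)[OF assms(1) that] smooth_formsD(1)[OF assms(2) that])
  show "\<omega> c x - \<omega>' c x = (\<omega> c' x - \<omega>' c' x) * transition_deriv c c' x ^ p * cnj (transition_deriv c c' x) ^ q"
    if "c \<in> A" "c' \<in> A" "x \<in> chart_dom c" "x \<in> chart_dom c'" "x \<notin> D" for c c' x
    by (simp only: left_diff_distrib smooth_formsD(2)[OF assms(1) that, symmetric]
        smooth_formsD(2)[OF assms(2) that, symmetric])
qed

lemma smooth_forms_sum:
  assumes "\<And>i. i \<in> I \<Longrightarrow> \<omega> i \<in> smooth_forms A p q D"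
  shows "(\<lambda>c x. \<Sum>i\<in>I. \<omega> i c x) \<in> smooth_forms A p q D"
proof (rule smooth_formsI)
  show "smooth_on (\<lambda>z. \<Sum>i\<in>I. \<omega> i c (chart_inv c z)) (coord c ` (chart_dom c - D))" if "c \<in> A" for c
    by (intro smooth_on_sum smooth_formsD(1)[OF assms that])
  show "(\<Sum>i\<in>I. \<omega> i c x) = (\<Sum>i\<in>I. \<omega> i c' x) * transition_deriv c c' x ^ p * cnj (transition_deriv c c' x) ^ q"
    if "c \<in> A" "c' \<in> A" "x \<in> chart_dom c" "x \<in> chart_dom c'" "x \<notin> D" for c c' x
    unfolding sum_distrib_right by (rule sum.cong[OF refl]) (rule smooth_formsD(2)[OF assms that])
qed

definition smooth_fun :: "('a \<Rightarrow> real) \<Rightarrow> bool" where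
  "smooth_fun r \<longleftrightarrow> (\<forall>k\<in>A. smooth_on (\<lambda>z. r (chart_inv k z)) (chart_img k))"

lemma smooth_forms_scale:
  assumes r: "smooth_fun r" and w: "\<omega> \<in> smooth_forms A p q D"
  shows "(\<lambda>c x. of_real (r x) * \<omega> c x) \<in> smooth_forms A p q D"
proof (rule smooth_formsI)
  show "smooth_on (\<lambda>z. of_real (r (chart_inv c z)) * \<omega> c (chart_inv c z)) (coord c ` (chart_dom c - D))"
    if c: "c \<in> A" for c
  proof (intro smooth_on_mult smooth_on_of_real smooth_formsD(1)[OF w c])
    show "smooth_on (\<lambda>z. r (chart_inv c z)) (coord c ` (chart_dom c - D))"
      by (rule smooth_on_subset[of _ "chart_img c"]) (use r c in \<open>auto simp: smooth_fun_def\<close>)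
  qed
  show "of_real (r x) * \<omega> c x = of_real (r x) * \<omega> c' x * transition_deriv c c' x ^ p * cnj (transition_deriv c c' x) ^ q"
    if "c \<in> A" "c' \<in> A" "x \<in> chart_dom c" "x \<in> chart_dom c'" "x \<notin> D" for c c' x
    by (subst smooth_formsD(2)[OF w that]) (simp only: mult.assoc)
qed

lemma thick_minus: "c \<in> A \<Longrightarrow> thick (coord c ` (chart_dom c - D))"
  by (rule hopen_thick[OF hopen_minus[OF _ finD]])

lemma del_inv:
  "z \<in> coord c ` (chart_dom c - D) \<Longrightarrow> del D \<beta> c (chart_inv c z) =
    wirtinger (\<lambda>z. \<beta> c (chart_inv c z)) z (coord c ` (chart_dom c - D))"
  unfolding del_def using coord_inv[of z c "- D"] by (simp add: Diff_eq)

lemma del_smooth_forms: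
  assumes b: "\<beta> \<in> smooth_forms A 0 1 D"
  shows "del D \<beta> \<in> smooth_forms A 1 1 D"
proof (rule smooth_formsI)
  fix c assume c: "c \<in> A"
  let ?S = "coord c ` (chart_dom c - D)"
  have "smooth_on (\<lambda>z. wirtinger (\<lambda>z. \<beta> c (chart_inv c z)) z ?S) ?S"
    by (rule smooth_on_wirtinger[OF thick_minus[OF c] smooth_formsD(1)[OF b c]])
  then show "smooth_on (\<lambda>z. del D \<beta> c (chart_inv c z)) ?S"
    by (rule iffD1[OF smooth_on_cong, rotated]) (simp add: del_inv)
next
  fix c c' x assume c: "c \<in> A" "c' \<in> A" and x: "x \<in> chart_dom c" "x \<in> chart_dom c'" "x \<notin> D"
  let ?S = "coord c ` (chart_dom c - D)" and ?T = "coord c' ` (chart_dom c' - D)"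
  obtain W F where W: "open W" "coord c x \<in> W" "F holomorphic_on W"
    "\<And>y. y \<in> chart_dom c \<inter> chart_dom c' \<Longrightarrow> coord c y \<in> W \<Longrightarrow>
      F (coord c y) = coord c' y \<and> transition_deriv c c' y = deriv F (coord c y)"
    by (rule transition[OF c, of x]) (use x that in auto)
  obtain V where V: "open V" "coord c ` (chart_dom c \<inter> chart_dom c') = chart_img c \<inter> V"
    by (rule img_openE[OF c(1) dom_open[OF c(2)]]) (rule that)
  have "wirtinger (\<lambda>z. \<beta> c (chart_inv c z)) (coord c x) ?S =
      wirtinger (\<lambda>z. \<beta> c' (chart_inv c' z)) (F (coord c x)) ?T * deriv F (coord c x) * cnj (deriv F (coord c x))"
  proof (rule wirtinger_pullback[OF thick_minus[OF c(1)] thick_minus[OF c(2)] _ smooth_formsD(1)[OF b c(2)], of _ "W \<inter> V"])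
    show "coord c x \<in> ?S" "open (W \<inter> V)" using x W V by auto
    show "coord c x \<in> W \<inter> V" using W(2) V(2) x by blast
    show "F holomorphic_on W \<inter> V" by (rule holomorphic_on_subset[OF W(3)]) auto
    fix w assume w: "w \<in> ?S" "w \<in> W \<inter> V"
    obtain y where y: "y \<in> chart_dom c" "y \<notin> D" "w = coord c y" using w(1) by blast
    have "w \<in> coord c ` (chart_dom c \<inter> chart_dom c')" using V(2) y w(2) by blast
    then have y': "y \<in> chart_dom c'" using coord_inj[OF c(1)] y by (auto simp: inj_on_def)
    have F: "F w = coord c' y" "transition_deriv c c' y = deriv F w" using W(4)[of y] y y' w(2) by auto
    show "F w \<in> ?T \<and> \<beta> c (chart_inv c w) = \<beta> c' (chart_inv c' (F w)) * cnj (deriv F w)"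
      using F y y' inv_coord[OF c(1)] inv_coord[OF c(2)] smooth_formsD(2)[OF b c y(1) y' y(2)] by auto
  qed
  then show "del D \<beta> c x = del D \<beta> c' x * transition_deriv c c' x ^ 1 * cnj (transition_deriv c c' x) ^ 1"
    unfolding del_def using W(4)[of x] W(2) x by simp
qed

lemma del_diff:
  assumes "\<beta> \<in> smooth_forms A 0 1 D" "\<beta>' \<in> smooth_forms A 0 1 D" "c \<in> A" "x \<in> chart_dom c - D"
  shows "del D (\<lambda>c x. \<beta> c x - \<beta>' c x) c x = del D \<beta> c x - del D \<beta>' c x"
  unfolding del_def
  by (rule wirtinger_diff[OF thick_minus[OF assms(3)] _ smooth_formsD(1)[OF assms(1,3)]
        smooth_formsD(1)[OF assms(2,3)]]) (use assms in auto)

lemma del_sum: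
  assumes "\<And>i. i \<in> I \<Longrightarrow> \<beta> i \<in> smooth_forms A 0 1 D" "c \<in> A" "x \<in> chart_dom c - D"
  shows "del D (\<lambda>c x. \<Sum>i\<in>I. \<beta> i c x) c x = (\<Sum>i\<in>I. del D (\<beta> i) c x)"
  unfolding del_def
  by (rule wirtinger_sum[OF thick_minus[OF assms(2)] _ smooth_formsD(1)[OF assms(1) assms(2)]]) (use assms in auto)

text \<open>\<open>\<partial>\<beta>\<close> is determined by germs, so that the image of the chart may be replaced by any thick set with the
  same germ.\<close>

lemma del_eqI:
  assumes "\<beta> \<in> smooth_forms A 0 1 D" "c \<in> A" "z \<in> coord c ` (chart_dom c - D)"
    and "thick T" "z \<in> T" "open V" "z \<in> V" "T \<inter> V \<subseteq> coord c ` (chart_dom c - D)"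
    and "\<And>w. w \<in> T \<Longrightarrow> w \<in> V \<Longrightarrow> f w = \<beta> c (chart_inv c w)"
  shows "del D \<beta> c (chart_inv c z) = wirtinger f z T"
  unfolding del_inv[OF assms(3)]
  by (rule wirtinger_transfer[OF thick_minus[OF assms(2)] assms(4-9) smooth_formsD(1)[OF assms(1,2)], symmetric])

text \<open>At an interior point of the surface the coordinate covers a full disc, also in a half plane chart.\<close>

lemma nbhd_ball:
  assumes c: "c \<in> A" and a: "a \<in> chart_dom c" "coord c a = 0" "a \<notin> surface_boundary A" and U: "openin X U" "a \<in> U"
  obtains r where "0 < r" "ball 0 r \<subseteq> coord c ` (chart_dom c \<inter> U)"
proof -
  obtain V where V: "open V" "coord c ` (chart_dom c \<inter> U) = chart_img c \<inter> V"
    by (rule img_openE[OF c U(1)]) (rule that)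
  have "0 \<in> interior (chart_img c) \<inter> V" using boundary_iff[OF c a(1)] a V(2) U(2) by force
  moreover have "open (interior (chart_img c) \<inter> V)" using V(1) by auto
  ultimately obtain r where "0 < r" "ball 0 r \<subseteq> interior (chart_img c) \<inter> V"
    unfolding open_contains_ball by blast
  then show ?thesis using V(2) interior_subset by (intro that[of r]) blast+
qed

lemma openin_minus_D: "openin X (topspace X - (D - E))"
  by (rule finite_complement_openin') (use finD in auto)

text \<open>The transition map \<open>F\<close> fixes the origin and has nonzero derivative, so \<open>F z = z u z\<close> with \<open>u\<close> holomorphic and
  nonvanishing: the order of the pole does not depend on the centred chart.\<close>

lemma has_pole_change:
  assumes w: "\<omega> \<in> smooth_forms A p q D" and a: "a \<in> D" and c: "c \<in> A" "c' \<in> A"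
    and ac: "a \<in> chart_dom c" "coord c a = 0" "a \<in> chart_dom c'" "coord c' a = 0"
    and pole: "has_pole c' N \<omega>"
  shows "has_pole c N \<omega>"
proof -
  obtain s g where g: "0 < s" "ball 0 s \<subseteq> chart_img c'" "smooth_on g (ball 0 s)"
    "\<And>z. z \<in> ball 0 s \<Longrightarrow> z \<noteq> 0 \<Longrightarrow> \<omega> c' (chart_inv c' z) = g z / z ^ N"
    by (rule has_poleE[OF pole]) (rule that)
  obtain W F where W: "open W" "coord c a \<in> W" "F holomorphic_on W"
    "\<And>y. y \<in> chart_dom c \<inter> chart_dom c' \<Longrightarrow> coord c y \<in> W \<Longrightarrow>
      F (coord c y) = coord c' y \<and> transition_deriv c c' y = deriv F (coord c y)"
    by (rule transition[OF c, of a]) (use ac that in auto)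
  have abd: "a \<notin> surface_boundary A" using a Dbd by blast
  let ?U = "{x \<in> chart_dom c'. coord c' x \<in> ball 0 s} \<inter> {x \<in> chart_dom c. coord c x \<in> W} \<inter> (topspace X - (D - {a}))"
  have U: "openin X ?U"
    by (intro openin_Int preimage_openin c W(1) open_ball openin_minus_D)
  have aU: "a \<in> ?U" using ac g(1) W(2) DX a by auto
  obtain r where r: "0 < r" "ball 0 r \<subseteq> coord c ` (chart_dom c \<inter> ?U)"
    by (rule nbhd_ball[OF c(1) ac(1,2) abd U aU]) (rule that)
  have pt: "\<exists>y. y \<in> chart_dom c \<and> y \<in> chart_dom c' \<and> z = coord c y \<and> F z = coord c' y \<and> F z \<in> ball 0 s \<and>
      z \<in> W \<and> transition_deriv c c' y = deriv F z \<and> chart_inv c z = y \<and> (y \<in> D \<longrightarrow> y = a)" if z: "z \<in> ball 0 r" for z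
  proof -
    from r(2) z obtain y where y: "z = coord c y" "y \<in> chart_dom c \<inter> ?U" by blast
    then show ?thesis using W(4)[of y] inv_coord[OF c(1)] by (intro exI[of _ y]) auto
  qed
  have F0: "F 0 = 0" "deriv F 0 = transition_deriv c c' a"
    using W(4)[of a] ac W(2) by auto
  have nz: "deriv F 0 \<noteq> 0" using F0(2) transition_deriv_nonzero[OF c ac(1,3)] by simp
  have BW: "ball 0 r \<subseteq> W" using pt by blast
  have F1: "F z \<noteq> 0" if z: "z \<in> ball 0 r" "z \<noteq> 0" for z
  proof
    assume "F z = 0"
    obtain y where y: "y \<in> chart_dom c" "y \<in> chart_dom c'" "z = coord c y" "F z = coord c' y"
      using pt[OF z(1)] by blast
    then have "coord c' y = coord c' a" using \<open>F z = 0\<close> ac(4) by simp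
    then have "y = a" by (rule inj_onD[OF coord_inj[OF c(2)] _ y(2) ac(3)])
    then show False using z(2) y(3) ac(2) by simp
  qed
  \<comment> \<open>The holomorphic quotient of \<open>F\<close> by the coordinate; the singularity at the origin is removable.\<close>
  define u where "u z = (if z = 0 then deriv F 0 else (F z - F 0) / (z - 0))" for z
  have FB: "F holomorphic_on ball 0 r" by (rule holomorphic_on_subset[OF W(3) BW])
  have "u holomorphic_on ball 0 r"
    unfolding u_def[abs_def] by (rule pole_lemma[OF FB]) (use r in auto)
  then have su: "smooth_on u (ball 0 r)" by (rule smooth_on_holomorphic[OF open_ball])
  have u0: "u z \<noteq> 0" if "z \<in> ball 0 r" for z using nz F1[OF that] F0 by (auto simp: u_def)
  have sF: "smooth_on F (ball 0 r)" by (rule smooth_on_holomorphic[OF open_ball FB])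
  have sF': "smooth_on (deriv F) (ball 0 r)"
    by (rule smooth_on_holomorphic[OF open_ball holomorphic_deriv[OF FB open_ball]])
  let ?g = "\<lambda>z. g (F z) * deriv F z ^ p * cnj (deriv F z) ^ q / u z ^ N"
  show ?thesis
  proof (rule has_poleI[OF r(1)])
    show "ball 0 r \<subseteq> chart_img c" using r(2) by blast
    have "smooth_on (\<lambda>z. g (F z)) (ball 0 r)"
      by (rule smooth_on_compose[OF sF g(3)]) (use pt in blast)
    then show "smooth_on ?g (ball 0 r)"
      by (intro smooth_on_divide smooth_on_mult smooth_on_power smooth_on_cnj su sF') (use u0 in auto)
    fix z :: complex assume z: "z \<in> ball 0 r" "z \<noteq> 0"
    obtain y where y: "y \<in> chart_dom c" "y \<in> chart_dom c'" "z = coord c y" "F z = coord c' y" "F z \<in> ball 0 s"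
      "transition_deriv c c' y = deriv F z" "chart_inv c z = y" "y \<in> D \<longrightarrow> y = a"
      using pt[OF z(1)] by blast
    have yD: "y \<notin> D" using y(3,8) z(2) ac by auto
    have "\<omega> c' y = g (F z) / F z ^ N"
      using g(4)[OF y(5) F1[OF z]] y inv_coord[OF c(2)] by simp
    moreover have "F z = z * u z" using z(2) F0 by (simp add: u_def)
    ultimately have "\<omega> c' y = g (F z) / (z ^ N * u z ^ N)" by (simp only: power_mult_distrib)
    then show "\<omega> c (chart_inv c z) = ?g z / z ^ N"
      unfolding y(7) smooth_formsD(2)[OF w c y(1,2) yD] y(6) by simp
  qed
qed

lemma pole_form_chart:
  assumes c: "c \<in> A" "a \<in> chart_dom c" "coord c a = 0" "chart_dom c \<inter> D = {a}"
    and g: "smooth_on g (chart_img c)" "\<And>x. x \<in> chart_dom c - {a} \<Longrightarrow> \<omega> c x = g (coord c x) / coord c x ^ N"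
  shows "has_pole c N \<omega>"
proof -
  have abd: "a \<notin> surface_boundary A" using c(4) Dbd by blast
  obtain r where r: "0 < r" "ball 0 r \<subseteq> coord c ` (chart_dom c \<inter> topspace X)"
    by (rule nbhd_ball[OF c(1-3) abd openin_topspace]) (use c dom_subset[OF c(1)] that in auto)
  have rs: "ball 0 r \<subseteq> chart_img c" using r(2) by blast
  show ?thesis
  proof (rule has_poleI[OF r(1) rs smooth_on_subset[OF g(1) rs]])
    fix z :: complex assume z: "z \<in> ball 0 r" "z \<noteq> 0"
    then obtain x where x: "z = coord c x" "x \<in> chart_dom c" using rs by blast
    then show "\<omega> c (chart_inv c z) = g z / z ^ N" using g(2)[of x] inv_coord[OF c(1)] z c by auto
  qed
qed

lemma pole_formsD:
  assumes w: "\<omega> \<in> pole_forms A p q D" and a: "a \<in> D" and c: "c \<in> A" "a \<in> chart_dom c" "coord c a = 0"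
  shows "\<omega> \<in> smooth_forms A p q D" "\<exists>N. has_pole c N \<omega>"
proof -
  show s: "\<omega> \<in> smooth_forms A p q D" using w unfolding pole_forms_def by blast
  have "\<exists>c\<in>A. a \<in> chart_dom c \<and> coord c a = 0 \<and> chart_dom c \<inter> D = {a} \<and>
       (\<exists>(N::nat) g. smooth_on g (chart_img c) \<and>
          (\<forall>x \<in> chart_dom c - {a}. \<omega> c x = g (coord c x) / coord c x ^ N))"
    using w a unfolding pole_forms_def by blast
  then obtain k N g where k: "k \<in> A" "a \<in> chart_dom k" "coord k a = 0" "chart_dom k \<inter> D = {a}"
    "smooth_on g (chart_img k)" "\<forall>x \<in> chart_dom k - {a}. \<omega> k x = g (coord k x) / coord k x ^ N"
    by (elim bexE exE conjE) (rule that)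
  have "has_pole k N \<omega>" by (rule pole_form_chart[OF k(1-5)]) (use k(6) in blast)
  then have "has_pole c N \<omega>" by (rule has_pole_change[OF s a c(1) k(1) c(2,3) k(2,3)])
  then show "\<exists>N. has_pole c N \<omega>" ..
qed

lemma log_formsD:
  assumes w: "\<omega> \<in> log_forms A D" and a: "a \<in> D" and c: "c \<in> A" "a \<in> chart_dom c" "coord c a = 0"
  shows "\<omega> \<in> smooth_forms A 1 1 D" "has_pole c 1 \<omega>"
proof -
  show s: "\<omega> \<in> smooth_forms A 1 1 D" using w unfolding log_forms_def pole_forms_def by blast
  have "\<exists>c\<in>A. a \<in> chart_dom c \<and> coord c a = 0 \<and> chart_dom c \<inter> D = {a} \<and>
       (\<exists>g. smooth_on g (chart_img c) \<and>
          (\<forall>x \<in> chart_dom c - {a}. \<omega> c x = (1 / coord c x) * g (coord c x)))"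
    using w a unfolding log_forms_def by blast
  then obtain k g where k: "k \<in> A" "a \<in> chart_dom k" "coord k a = 0" "chart_dom k \<inter> D = {a}"
    "smooth_on g (chart_img k)" "\<forall>x \<in> chart_dom k - {a}. \<omega> k x = (1 / coord k x) * g (coord k x)"
    by (elim bexE exE conjE) (rule that)
  have "has_pole k 1 \<omega>" by (rule pole_form_chart[OF k(1-5)]) (use k(6) in simp)
  then show "has_pole c 1 \<omega>" by (rule has_pole_change[OF s a c(1) k(1) c(2,3) k(2,3)])
qed

text \<open>The definitions of \<open>pole_forms\<close> and \<open>log_forms\<close> ask for a quotient on the whole domain of a chart that
  meets \<open>D\<close> in one point. The atlas is maximal, so it contains the restriction of \<open>c\<close> to a small disc.\<close>

lemma has_pole_small_chart:
  assumes w: "\<omega> \<in> smooth_forms A p q D" and a: "a \<in> D" and c: "c \<in> A" "a \<in> chart_dom c" "coord c a = 0"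
    and pole: "has_pole c N \<omega>"
  shows "\<exists>c\<in>A. a \<in> chart_dom c \<and> coord c a = 0 \<and> chart_dom c \<inter> D = {a} \<and>
       (\<exists>g. smooth_on g (chart_img c) \<and>
          (\<forall>x \<in> chart_dom c - {a}. \<omega> c x = g (coord c x) / coord c x ^ N))"
proof -
  obtain r g where g: "0 < r" "ball 0 r \<subseteq> chart_img c" "smooth_on g (ball 0 r)"
    "\<And>z. z \<in> ball 0 r \<Longrightarrow> z \<noteq> 0 \<Longrightarrow> \<omega> c (chart_inv c z) = g z / z ^ N"
    by (rule has_poleE[OF pole]) (rule that)
  let ?U = "{x \<in> chart_dom c. coord c x \<in> ball 0 r} \<inter> (topspace X - (D - {a}))"
  have U: "openin X ?U" by (intro openin_Int preimage_openin c open_ball openin_minus_D)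
  let ?k = "(chart_dom c \<inter> ?U, coord c)"
  have k: "?k \<in> A" by (rule restrict_chart[OF c(1) U])
  have aU: "a \<in> ?U" using c g(1) DX a by auto
  have "\<omega> ?k x = g (coord ?k x) / coord ?k x ^ N" if x: "x \<in> chart_dom ?k - {a}" for x
  proof -
    have x': "x \<in> chart_dom c" "x \<notin> D" "coord c x \<in> ball 0 r" using x by auto
    have "coord c x \<noteq> 0" using x coord_inj[OF c(1)] c by (auto simp: inj_on_def)
    then have "\<omega> c x = g (coord c x) / coord c x ^ N" using g(4)[OF x'(3)] inv_coord[OF c(1) x'(1)] by simp
    moreover have "transition_deriv ?k c x = 1"
      by (rule transition_deriv_same[OF k c(1)]) (use x in auto)
    ultimately show ?thesis using smooth_formsD(2)[OF w k c(1), of x] x x' by simp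
  qed
  moreover have "smooth_on g (chart_img ?k)" by (rule smooth_on_subset[OF g(3)]) auto
  moreover have "a \<in> chart_dom ?k" "coord ?k a = 0" "chart_dom ?k \<inter> D = {a}" using aU c a by auto
  ultimately show ?thesis using k by (intro bexI[of _ ?k]) blast+
qed

lemma pole_formsI:
  assumes "\<omega> \<in> smooth_forms A p q D"
    and "\<And>a. a \<in> D \<Longrightarrow> \<exists>c\<in>A. \<exists>N. a \<in> chart_dom c \<and> coord c a = 0 \<and> has_pole c N \<omega>"
  shows "\<omega> \<in> pole_forms A p q D"
  unfolding pole_forms_def
proof (intro CollectI conjI ballI assms(1))
  fix a assume a: "a \<in> D"
  obtain c N where "c \<in> A" "a \<in> chart_dom c" "coord c a = 0" "has_pole c N \<omega>" using assms(2)[OF a] by blast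
  from has_pole_small_chart[OF assms(1) a this]
  show "\<exists>c\<in>A. a \<in> chart_dom c \<and> coord c a = 0 \<and> chart_dom c \<inter> D = {a} \<and>
       (\<exists>(N::nat) g. smooth_on g (chart_img c) \<and>
          (\<forall>x \<in> chart_dom c - {a}. \<omega> c x = g (coord c x) / coord c x ^ N))" by blast
qed

lemma log_formsI:
  assumes "\<omega> \<in> smooth_forms A 1 1 D"
    and "\<And>a. a \<in> D \<Longrightarrow> \<exists>c\<in>A. a \<in> chart_dom c \<and> coord c a = 0 \<and> has_pole c 1 \<omega>"
  shows "\<omega> \<in> log_forms A D"
  unfolding log_forms_def
proof (intro CollectI conjI ballI)
  show "\<omega> \<in> pole_forms A 1 1 D" by (rule pole_formsI[OF assms(1)]) (use assms(2) in blast)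
  fix a assume a: "a \<in> D"
  obtain c where "c \<in> A" "a \<in> chart_dom c" "coord c a = 0" "has_pole c 1 \<omega>" using assms(2)[OF a] by blast
  from has_pole_small_chart[OF assms(1) a this]
  show "\<exists>c\<in>A. a \<in> chart_dom c \<and> coord c a = 0 \<and> chart_dom c \<inter> D = {a} \<and>
       (\<exists>g. smooth_on g (chart_img c) \<and>
          (\<forall>x \<in> chart_dom c - {a}. \<omega> c x = (1 / coord c x) * g (coord c x)))" by simp
qed

end

section \<open>Partitions of unity\<close>

context riemann
begin

lemma compactin_chart_preimage:
  assumes c: "c \<in> A" and K: "compact K" "K \<subseteq> chart_img c"
  shows "compactin X {y \<in> chart_dom c. coord c y \<in> K}" "closedin X {y \<in> chart_dom c. coord c y \<in> K}"
proof -
  let ?L = "{y \<in> chart_dom c. coord c y \<in> K}"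
  have im: "coord c ` ?L = K" using K(2) by auto
  have "compactin (top_of_set (chart_img c)) (coord c ` ?L)"
    unfolding im using K by (simp add: compactin_subtopology)
  moreover have "?L \<subseteq> topspace (subtopology X (chart_dom c))" using topspace_dom[OF c] by auto
  ultimately have "compactin (subtopology X (chart_dom c)) ?L"
    using homeomorphic_map_compactness[OF coord_homeo[OF c]] by blast
  then show 1: "compactin X ?L" by (simp add: compactin_subtopology)
  show "closedin X ?L" by (rule compactin_imp_closedin[OF hausdorff 1])
qed

lemma hopen_cball:
  assumes "hopen S" "z \<in> S"
  obtains e where "0 < e" "compact (S \<inter> cball z e)"
proof -
  obtain T V where T: "closed T" "open V" "S = T \<inter> V"
  proof (cases "open S")
    case True
    then show ?thesis using that[of UNIV S] by simp
  next
    case False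
    then have "openin (top_of_set {z. 0 \<le> Im z}) S" using assms(1) unfolding hopen_def by simp
    then obtain V where "open V" "S = {z. 0 \<le> Im z} \<inter> V" by (auto simp: openin_open)
    moreover have "closed {z. 0 \<le> Im z}" by (intro closed_Collect_le continuous_intros)
    ultimately show ?thesis using that by blast
  qed
  then obtain e where e: "0 < e" "cball z e \<subseteq> V" using assms(2) open_contains_cball by blast
  then have "S \<inter> cball z e = T \<inter> cball z e" using T(3) by blast
  moreover have "compact (T \<inter> cball z e)" by (rule closed_Int_compact[OF T(1) compact_cball])
  ultimately show ?thesis using that e(1) by simp
qed

lemma smooth_extension_by_zero:
  fixes f :: "'a \<Rightarrow> 'b::real_normed_vector"
  assumes c: "c \<in> A" and K: "closedin X K" "K \<subseteq> chart_dom c"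
    and f: "smooth_on (\<lambda>z. f (chart_inv c z)) (chart_img c)" and 0: "\<And>y. y \<in> topspace X - K \<Longrightarrow> f y = 0"
    and k: "k \<in> A"
  shows "smooth_on (\<lambda>z. f (chart_inv k z)) (chart_img k)"
proof (rule smooth_on_local)
  fix z assume "z \<in> chart_img k"
  then obtain y where y: "z = coord k y" "y \<in> chart_dom k" ..
  show "\<exists>U. open U \<and> z \<in> U \<and> smooth_on (\<lambda>z. f (chart_inv k z)) (chart_img k \<inter> U)"
  proof (cases "y \<in> chart_dom c")
    case True
    obtain V where V: "open V" "coord k ` (chart_dom k \<inter> chart_dom c) = chart_img k \<inter> V"
      by (rule img_openE[OF k dom_open[OF c]]) (rule that)
    have "smooth_on (\<lambda>z. f (chart_inv k z)) (coord k ` (chart_dom k \<inter> chart_dom c \<inter> UNIV))"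
      by (rule smooth_chart_change[OF k c]) (use f in simp)
    then have "smooth_on (\<lambda>z. f (chart_inv k z)) (chart_img k \<inter> V)" using V(2) by simp
    moreover have "z \<in> V" using V(2) y True by blast
    ultimately show ?thesis using V(1) by blast
  next
    case False
    have o: "openin X (topspace X - K)" using K(1) by blast
    obtain V where V: "open V" "coord k ` (chart_dom k \<inter> (topspace X - K)) = chart_img k \<inter> V"
      by (rule img_openE[OF k o]) (rule that)
    have "f (chart_inv k w) = 0" if w: "w \<in> chart_img k \<inter> V" for w
      using inv_in[OF k, of w "topspace X - K"] w 0 unfolding V(2) by blast
    then have "smooth_on (\<lambda>z. f (chart_inv k z)) (chart_img k \<inter> V)"
      by (subst smooth_on_cong[where g="\<lambda>z. 0"]) auto
    moreover have "y \<in> topspace X - K" using False K(2) dom_subset[OF k] y(2) by blast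
    then have "z \<in> V" using V(2) y by blast
    ultimately show ?thesis using V(1) by blast
  qed
qed

end

context marked_surface
begin

text \<open>The cutoff of the squared distance in the coordinate, with a radius so small that its support is compact
  in the chart image; compactness makes it closed in the surface, so that the extension by zero is smooth.\<close>

lemma bump:
  assumes c: "c \<in> A" and x: "x \<in> chart_dom c" and U: "openin X U" "x \<in> U"
  shows "\<exists>r N. smooth_fun r \<and> (\<forall>y. 0 \<le> r y) \<and> openin X N \<and> x \<in> N \<and> (\<forall>y\<in>N. r y = 1) \<and>
    X closure_of {y \<in> topspace X. r y \<noteq> 0} \<subseteq> chart_dom c \<inter> U"
proof -
  let ?S = "coord c ` (chart_dom c \<inter> U)" and ?z = "coord c x"
  have "?z \<in> ?S" using x U(2) by blast
  obtain V where V: "open V" "?S = chart_img c \<inter> V" by (rule img_openE[OF c U(1)]) (rule that)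
  obtain e' where e': "0 < e'" "compact (chart_img c \<inter> cball ?z e')"
    by (rule hopen_cball[OF hopen_img[OF c], of ?z]) (use x that in auto)
  have "?z \<in> V" using V(2) x U(2) by blast
  then obtain e'' where e'': "0 < e''" "cball ?z e'' \<subseteq> V" using V(1) open_contains_cball by blast
  define e where "e = min e' e''"
  have e: "0 < e" "cball ?z e \<subseteq> V" using e'(1) e'' by (auto simp: e_def)
  have "chart_img c \<inter> cball ?z e = (chart_img c \<inter> cball ?z e') \<inter> cball ?z e" by (auto simp: e_def)
  then have comp: "compact (chart_img c \<inter> cball ?z e)" using e'(2) by (metis compact_Int_closed closed_cball)
  let ?K = "{y \<in> chart_dom c. coord c y \<in> chart_img c \<inter> cball ?z e}"
  have K: "closedin X ?K" by (rule compactin_chart_preimage(2)[OF c comp]) simp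
  have KU: "?K \<subseteq> chart_dom c \<inter> U"
  proof
    fix y assume y: "y \<in> ?K"
    then have "coord c y \<in> ?S" unfolding V(2) using e(2) by blast
    then show "y \<in> chart_dom c \<inter> U" using y coord_inj[OF c] by (auto simp: inj_on_def)
  qed
  define b where "b z = cutoff ((norm (z - ?z))\<^sup>2 * (1 / e\<^sup>2))" for z
  define r where "r y = (if y \<in> chart_dom c then b (coord c y) else 0)" for y
  have out: "r y = 0" if "y \<notin> ?K" for y
  proof (cases "y \<in> chart_dom c")
    case True
    then have "e < norm (coord c y - ?z)" using that by (auto simp: dist_norm norm_minus_commute)
    then have "e\<^sup>2 \<le> (norm (coord c y - ?z))\<^sup>2" using e(1) by (intro power_mono) auto
    then have "1 \<le> (norm (coord c y - ?z))\<^sup>2 * (1 / e\<^sup>2)" using e(1) by (simp add: le_divide_eq)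
    then show ?thesis by (simp add: r_def b_def cutoff_eq_0)
  qed (simp add: r_def)
  have sb: "smooth_on b S" for S
  proof -
    have "smooth_on (\<lambda>z. (norm (z - ?z))\<^sup>2 * (1 / e\<^sup>2)) S"
      by (intro smooth_on_mult smooth_on_norm_square smooth_on_diff smooth_on_ident smooth_on_const)
    from smooth_on_compose[OF this smooth_on_cutoff[of UNIV]]
    show ?thesis unfolding b_def by simp
  qed
  have sr: "smooth_on (\<lambda>z. r (chart_inv c z)) (chart_img c)"
    by (rule iffD2[OF smooth_on_cong sb]) (auto simp: r_def inv_coord[OF c])
  have "smooth_on (\<lambda>z. r (chart_inv k z)) (chart_img k)" if "k \<in> A" for k
    by (rule smooth_extension_by_zero[where f=r and K="?K", OF c K _ sr _ that])
      (use out in \<open>blast+\<close>)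
  then have "smooth_fun r" unfolding smooth_fun_def by (rule ballI)
  moreover have "0 \<le> r y" for y by (simp add: r_def b_def cutoff_nonneg)
  moreover have "openin X {y \<in> chart_dom c. coord c y \<in> ball ?z (e / 2)}"
    by (rule preimage_openin[OF c open_ball])
  moreover have "x \<in> {y \<in> chart_dom c. coord c y \<in> ball ?z (e / 2)}" using x e by simp
  moreover have "\<forall>y\<in>{y \<in> chart_dom c. coord c y \<in> ball ?z (e / 2)}. r y = 1"
  proof
    fix y assume y: "y \<in> {y \<in> chart_dom c. coord c y \<in> ball ?z (e / 2)}"
    then have "(norm (coord c y - ?z))\<^sup>2 \<le> (e / 2)\<^sup>2"
      by (intro power_mono) (auto simp: dist_norm norm_minus_commute)
    then have "4 * (norm (coord c y - ?z))\<^sup>2 \<le> e\<^sup>2" by (simp add: power_divide)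
    then have "2 * (norm (coord c y - ?z))\<^sup>2 \<le> e\<^sup>2"
      using zero_le_power2[of "norm (coord c y - ?z)"] by linarith
    then have "(norm (coord c y - ?z))\<^sup>2 * (1 / e\<^sup>2) \<le> 1 / 2" using e by (simp add: divide_le_eq)
    then show "r y = 1" using y by (simp add: r_def b_def cutoff_eq_1)
  qed
  moreover have "X closure_of {y \<in> topspace X. r y \<noteq> 0} \<subseteq> chart_dom c \<inter> U"
  proof -
    have "X closure_of {y \<in> topspace X. r y \<noteq> 0} \<subseteq> ?K"
      by (rule closure_of_minimal[OF _ K]) (use out in blast)
    then show ?thesis using KU by blast
  qed
  ultimately show ?thesis by blast
qed

text \<open>The germ is multiplied by a bump function and carried to the other charts by the transformation law.
  Vanishing near the other points of \<open>D\<close> is what keeps such forms from interfering when they are added.\<close>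

lemma form_with_germ:
  assumes c: "c \<in> A" "a \<in> chart_dom c" "coord c a = 0" "chart_dom c \<inter> D = {a}"
    and f: "0 < r" "ball 0 r \<subseteq> chart_img c" "smooth_on f (ball 0 r - {0})"
  shows "\<exists>\<beta>\<in>smooth_forms A 0 1 D. (\<exists>s. 0 < s \<and> s \<le> r \<and>
      (\<forall>z\<in>ball 0 s - {0}. \<beta> c (chart_inv c z) = f z)) \<and>
    (\<exists>U. openin X U \<and> D - {a} \<subseteq> U \<and> (\<forall>k\<in>A. \<forall>x\<in>chart_dom k \<inter> U. \<beta> k x = 0))"
proof -
  have abd: "a \<notin> surface_boundary A" using c(4) Dbd by blast
  let ?B = "{x \<in> chart_dom c. coord c x \<in> ball 0 r}"
  have B: "openin X ?B" by (rule preimage_openin[OF c(1) open_ball])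
  have aB: "a \<in> ?B" using c f(1) by simp
  obtain \<eta> N where chi: "smooth_fun \<eta>" "openin X N" "a \<in> N" "\<forall>y\<in>N. \<eta> y = 1"
    "X closure_of {y \<in> topspace X. \<eta> y \<noteq> 0} \<subseteq> chart_dom c \<inter> ?B"
    using bump[OF c(1,2) B aB] by (elim exE conjE) (rule that)
  let ?Z = "X closure_of {y \<in> topspace X. \<eta> y \<noteq> 0}"
  have Z0: "\<eta> y = 0" if "y \<in> topspace X - ?Z" for y
    using closure_of_subset[of "{y \<in> topspace X. \<eta> y \<noteq> 0}" X] that by blast
  define \<beta> where "\<beta> k x = (if x \<in> chart_dom c then of_real (\<eta> x) * f (coord c x) * cnj (transition_deriv k c x) else 0)"
    for k x
  have oZ: "openin X (topspace X - ?Z)" by (simp add: openin_diff closedin_closure_of)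
  have sm: "\<beta> \<in> smooth_forms A 0 1 D"
  proof (rule smooth_forms_localI)
    show "\<beta> k x = \<beta> k' x * transition_deriv k k' x ^ 0 * cnj (transition_deriv k k' x) ^ 1"
      if "k \<in> A" "k' \<in> A" "x \<in> chart_dom k" "x \<in> chart_dom k'" "x \<notin> D" for k k' x
      using transition_deriv_cocycle[OF that(1,2) c(1) that(3,4)] by (simp add: \<beta>_def)
    fix x assume x: "x \<in> topspace X" "x \<notin> D"
    show "\<exists>k\<in>A. \<exists>U. openin X U \<and> x \<in> U \<and> x \<in> chart_dom k \<and>
      U \<inter> D = {} \<and> smooth_on (\<lambda>z. \<beta> k (chart_inv k z)) (coord k ` (chart_dom k \<inter> U))"
    proof (cases "x \<in> ?B")
      case True
      let ?U = "?B \<inter> (topspace X - D)"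
      let ?S = "coord c ` (chart_dom c \<inter> ?U)"
      have S: "?S \<subseteq> ball 0 r - {0}"
      proof
        fix z assume "z \<in> ?S"
        then obtain y where y: "z = coord c y" "y \<in> chart_dom c" "coord c y \<in> ball 0 r" "y \<notin> D" by blast
        then have "y \<noteq> a" using c(4) by blast
        then have "coord c y \<noteq> coord c a" using coord_inj[OF c(1)] y(2) c(2) by (auto simp: inj_on_def)
        then show "z \<in> ball 0 r - {0}" using y c(3) by simp
      qed
      have s1: "smooth_on (\<lambda>z. of_real (\<eta> (chart_inv c z)) * f z) ?S"
      proof (intro smooth_on_mult smooth_on_of_real smooth_on_subset[OF f(3) S])
        show "smooth_on (\<lambda>z. \<eta> (chart_inv c z)) ?S"
          by (rule smooth_on_subset[of _ "chart_img c"]) (use chi(1) c(1) in \<open>auto simp: smooth_fun_def\<close>)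
      qed
      have s2: "\<beta> c (chart_inv c z) = of_real (\<eta> (chart_inv c z)) * f z" if z: "z \<in> ?S" for z
      proof -
        have "chart_inv c z \<in> chart_dom c" using inv_in[OF c(1) z] by blast
        then show ?thesis using coord_inv[OF z] transition_deriv_same[OF c(1) c(1)] by (simp add: \<beta>_def)
      qed
      have "smooth_on (\<lambda>z. \<beta> c (chart_inv c z)) ?S" by (rule iffD2[OF smooth_on_cong[OF s2] s1])
      moreover have "openin X ?U" by (rule openin_Int[OF B finite_complement_openin'[OF finD]])
      moreover have "x \<in> ?U" "?U \<inter> D = {}" "x \<in> chart_dom c" using True x by auto
      ultimately show ?thesis by (intro bexI[OF _ c(1)] exI[of _ ?U] conjI)
    next
      case False
      from x(1) have "x \<in> (\<Union>c\<in>A. chart_dom c)" by (simp only: cover)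
      then obtain k where k: "k \<in> A" "x \<in> chart_dom k" by (rule UN_E) (rule that)
      let ?U = "(topspace X - ?Z) \<inter> (topspace X - D)"
      let ?S = "coord k ` (chart_dom k \<inter> ?U)"
      have b0: "\<beta> k (chart_inv k z) = 0" if z: "z \<in> ?S" for z
      proof -
        have "chart_inv k z \<in> topspace X - ?Z" using inv_in[OF k(1) z] by blast
        then show ?thesis using Z0 by (simp add: \<beta>_def)
      qed
      have "smooth_on (\<lambda>z. \<beta> k (chart_inv k z)) ?S"
        by (rule iffD2[OF smooth_on_cong[OF b0] smooth_on_const])
      moreover have "openin X ?U" by (rule openin_Int[OF oZ finite_complement_openin'[OF finD]])
      moreover have "x \<in> ?U" using False x chi(5) by blast
      moreover have "?U \<inter> D = {}" by blast
      ultimately show ?thesis using k(2) by (intro bexI[OF _ k(1)] exI[of _ ?U] conjI)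
    qed
  qed
  moreover have "\<exists>s. 0 < s \<and> s \<le> r \<and> (\<forall>z\<in>ball 0 s - {0}. \<beta> c (chart_inv c z) = f z)"
  proof -
    obtain s where s: "0 < s" "ball 0 s \<subseteq> coord c ` (chart_dom c \<inter> N)"
      by (rule nbhd_ball[OF c(1-3) abd chi(2,3)]) (rule that)
    have "\<beta> c (chart_inv c z) = f z" if z: "z \<in> ball 0 s" for z
    proof -
      have z': "z \<in> coord c ` (chart_dom c \<inter> N)" using s(2) z by blast
      have "chart_inv c z \<in> chart_dom c \<inter> N" by (rule inv_in[OF c(1) z'])
      then show ?thesis using coord_inv[OF z'] chi(4) transition_deriv_same[OF c(1) c(1)] by (simp add: \<beta>_def)
    qed
    then show ?thesis using s(1) f(1) by (intro exI[of _ "min r s"]) auto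
  qed
  moreover have "\<exists>U. openin X U \<and> D - {a} \<subseteq> U \<and> (\<forall>k\<in>A. \<forall>x\<in>chart_dom k \<inter> U. \<beta> k x = 0)"
  proof (intro exI conjI)
    show "openin X (topspace X - ?Z)" by (rule oZ)
    show "D - {a} \<subseteq> topspace X - ?Z" using DX chi(5) c(4) by blast
    show "\<forall>k\<in>A. \<forall>x\<in>chart_dom k \<inter> (topspace X - ?Z). \<beta> k x = 0" using Z0 by (simp add: \<beta>_def)
  qed
  ultimately show ?thesis by blast
qed

end

locale compact_marked_surface = marked_surface X A D
  for X :: "'a topology" and A :: "'a chart set" and D :: "'a set" +
  assumes compact_X: "compact_space X"
    and centred: "\<And>a. a \<in> D \<Longrightarrow> \<exists>c\<in>A. a \<in> chart_dom c \<and> coord c a = 0"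
begin

definition adapted_chart :: "'a chart \<Rightarrow> 'a \<Rightarrow> bool" where
  "adapted_chart c x \<longleftrightarrow> c \<in> A \<and> x \<in> chart_dom c \<and> chart_dom c \<inter> D \<subseteq> {x} \<and>
     (x \<in> D \<longrightarrow> coord c x = 0 \<and> open (chart_img c))"

lemma adapted_chart_exists: assumes x: "x \<in> topspace X" shows "\<exists>c. adapted_chart c x"
proof (cases "x \<in> D")
  case True
  obtain c where c: "c \<in> A" "x \<in> chart_dom c" "coord c x = 0" using centred[OF True] by blast
  have bd: "x \<notin> surface_boundary A" using True Dbd by blast
  obtain r where r: "0 < r" "ball 0 r \<subseteq> coord c ` (chart_dom c \<inter> (topspace X - (D - {x})))"
    by (rule nbhd_ball[OF c bd openin_minus_D[of "{x}"]]) (use x that in auto)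
  let ?U = "{y \<in> chart_dom c. coord c y \<in> ball 0 r}"
  let ?k = "(chart_dom c \<inter> ?U, coord c)"
  have "?k \<in> A" by (rule restrict_chart[OF c(1) preimage_openin[OF c(1) open_ball]])
  moreover have "chart_img ?k = ball 0 r" using r(2) by auto
  moreover have "?U \<inter> D \<subseteq> {x}"
  proof
    fix y assume y: "y \<in> ?U \<inter> D"
    then obtain y' where y': "y' \<in> chart_dom c" "y' \<notin> D - {x}" "coord c y = coord c y'" using r(2) by blast
    then have "y = y'" using y coord_inj[OF c(1)] by (auto simp: inj_on_def)
    then show "y \<in> {x}" using y y' by blast
  qed
  ultimately have "adapted_chart ?k x" unfolding adapted_chart_def using c r(1) by auto
  then show ?thesis ..
next
  case False
  obtain c where c: "c \<in> A" "x \<in> chart_dom c" using cover x by blast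
  have "(chart_dom c \<inter> (topspace X - D), coord c) \<in> A"
    by (rule restrict_chart[OF c(1) finite_complement_openin'[OF finD]])
  then have "adapted_chart (chart_dom c \<inter> (topspace X - D), coord c) x"
    unfolding adapted_chart_def using c x False by auto
  then show ?thesis ..
qed

text \<open>The usual construction by compactness, except that the points of \<open>D\<close> are always among the centres and
  that the chart at a centre contains no other point of \<open>D\<close>. Hence near \<open>a \<in> D\<close> only one bump function is nonzero, and
  normalising makes it equal to one there: multiplication by it does not disturb a pole.\<close>

lemma adapted_partition:
  shows "\<exists>n c \<rho>. partition_of_unity X A n c \<rho> \<and>
    (\<forall>i<n. chart_dom (c i) \<inter> D = {} \<or>
      (\<exists>a\<in>D. chart_dom (c i) \<inter> D = {a} \<and> coord (c i) a = 0 \<and> open (chart_img (c i)) \<and>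
        (\<exists>N. openin X N \<and> a \<in> N \<and> (\<forall>y\<in>N. \<rho> i y = 1))))"
proof -
  have "\<forall>x\<in>topspace X. \<exists>p. adapted_chart (fst p) x \<and> smooth_fun (fst (snd p)) \<and> (\<forall>y. 0 \<le> fst (snd p) y) \<and>
      openin X (snd (snd p)) \<and> x \<in> snd (snd p) \<and> (\<forall>y\<in>snd (snd p). fst (snd p) y = 1) \<and>
      X closure_of {y \<in> topspace X. fst (snd p) y \<noteq> 0} \<subseteq> chart_dom (fst p)"
  proof
    fix x assume x: "x \<in> topspace X"
    obtain c where c: "adapted_chart c x" using adapted_chart_exists[OF x] ..
    then have cA: "c \<in> A" "x \<in> chart_dom c" by (auto simp: adapted_chart_def)
    obtain r N where "smooth_fun r" "\<forall>y. 0 \<le> r y" "openin X N" "x \<in> N" "\<forall>y\<in>N. r y = 1"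
      "X closure_of {y \<in> topspace X. r y \<noteq> 0} \<subseteq> chart_dom c \<inter> topspace X"
      using bump[OF cA openin_topspace x] by (elim exE conjE) (rule that)
    then show "\<exists>p. adapted_chart (fst p) x \<and> smooth_fun (fst (snd p)) \<and> (\<forall>y. 0 \<le> fst (snd p) y) \<and>
      openin X (snd (snd p)) \<and> x \<in> snd (snd p) \<and> (\<forall>y\<in>snd (snd p). fst (snd p) y = 1) \<and>
      X closure_of {y \<in> topspace X. fst (snd p) y \<noteq> 0} \<subseteq> chart_dom (fst p)"
      using c by (intro exI[of _ "(c, r, N)"]) auto
  qed
  from bchoice[OF this] obtain P where P: "\<forall>x\<in>topspace X. adapted_chart (fst (P x)) x \<and>
      smooth_fun (fst (snd (P x))) \<and> (\<forall>y. 0 \<le> fst (snd (P x)) y) \<and>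
      openin X (snd (snd (P x))) \<and> x \<in> snd (snd (P x)) \<and> (\<forall>y\<in>snd (snd (P x)). fst (snd (P x)) y = 1) \<and>
      X closure_of {y \<in> topspace X. fst (snd (P x)) y \<noteq> 0} \<subseteq> chart_dom (fst (P x))" ..
  define k b N where "k x = fst (P x)" and "b x = fst (snd (P x))" and "N x = snd (snd (P x))" for x
  have k: "adapted_chart (k x) x" and b: "smooth_fun (b x)" "0 \<le> b x y" and N: "openin X (N x)" "x \<in> N x"
    and b1: "y \<in> N x \<Longrightarrow> b x y = 1"
    and supp: "X closure_of {y \<in> topspace X. b x y \<noteq> 0} \<subseteq> chart_dom (k x)"
    if "x \<in> topspace X" for x y
    using P[rule_format, OF that] by (auto simp: k_def b_def N_def)
  have "compactin X (topspace X)" using compact_X by (simp add: compact_space_def)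
  moreover have "\<forall>U\<in>N ` topspace X. openin X U" using N(1) by blast
  moreover have "topspace X \<subseteq> \<Union> (N ` topspace X)" using N(2) by blast
  ultimately obtain \<F> where F: "finite \<F>" "\<F> \<subseteq> N ` topspace X" "topspace X \<subseteq> \<Union> \<F>"
    unfolding compactin_def by meson
  obtain G where G: "G \<subseteq> topspace X" "finite G" "\<F> = N ` G"
    using finite_subset_image[OF F(1,2)] by blast
  \<comment> \<open>Every point of \<open>D\<close> is a centre, so that its own bump function occurs in the sum.\<close>
  define I where "I = G \<union> D"
  have I: "finite I" "I \<subseteq> topspace X" "topspace X \<subseteq> (\<Union>x\<in>I. N x)"
    using G F(3) finD DX by (auto simp: I_def)
  define s where "s y = (\<Sum>x\<in>I. b x y)" for y
  have s: "1 \<le> s y" if y: "y \<in> topspace X" for y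
  proof -
    obtain x where x: "x \<in> I" "y \<in> N x" using I(3) y by blast
    have "x \<in> topspace X" using x(1) I(2) by (rule rev_subsetD)
    from b1[OF this x(2)] have "1 = b x y" by (rule sym)
    also have "\<dots> \<le> s y" unfolding s_def
    proof (rule member_le_sum[OF x(1) _ I(1)])
      show "0 \<le> b x y" if "x \<in> I - {x'}" for x x'
        by (rule b(2)) (use that I(2) in blast)
    qed
    finally show ?thesis .
  qed
  obtain h where h: "bij_betw h {0..<card I} I" using ex_bij_betw_nat_finite[OF I(1)] by blast
  have hI: "h i \<in> I" if "i < card I" for i using bij_betwE[OF h] that by auto
  define \<rho> where "\<rho> i y = b (h i) y / s y" for i y
  have "partition_of_unity X A (card I) (\<lambda>i. k (h i)) \<rho>"
    unfolding partition_of_unity_def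
  proof (intro conjI allI impI ballI)
    fix i assume i: "i < card I"
    have hX: "h i \<in> topspace X" using hI[OF i] I(2) by blast
    show "k (h i) \<in> A" using k[OF hX] by (simp add: adapted_chart_def)
    show "smooth_on (\<lambda>z. \<rho> i (chart_inv c z)) (chart_img c)" if c: "c \<in> A" for c
      unfolding \<rho>_def
    proof (rule smooth_on_divide)
      show "smooth_on (\<lambda>z. b (h i) (chart_inv c z)) (chart_img c)"
        using b(1)[OF hX] c by (simp add: smooth_fun_def)
      show "smooth_on (\<lambda>z. s (chart_inv c z)) (chart_img c)" unfolding s_def
        by (rule smooth_on_sum) (use b(1) I(2) c in \<open>auto simp: smooth_fun_def\<close>)
      fix z assume "z \<in> chart_img c"
      then have "chart_inv c z \<in> topspace X" using inv_in[OF c, of z UNIV] dom_subset[OF c] by auto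
      then show "s (chart_inv c z) \<noteq> 0" using s[of "chart_inv c z"] by auto
    qed
    show "0 \<le> \<rho> i x" if "x \<in> topspace X" for x
      unfolding \<rho>_def using b(2)[OF hX] s[OF that] by (intro divide_nonneg_nonneg) auto
    have "X closure_of {x \<in> topspace X. \<rho> i x \<noteq> 0} \<subseteq> X closure_of {x \<in> topspace X. b (h i) x \<noteq> 0}"
      by (rule closure_of_mono) (auto simp: \<rho>_def)
    then show "X closure_of {x \<in> topspace X. \<rho> i x \<noteq> 0} \<subseteq> chart_dom (k (h i))" using supp[OF hX] by (rule order_trans)
  next
    fix x assume x: "x \<in> topspace X"
    have "(\<Sum>i<card I. \<rho> i x) = (\<Sum>i\<in>{0..<card I}. b (h i) x) / s x"
      unfolding \<rho>_def by (simp add: sum_divide_distrib atLeast0LessThan)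
    also have "(\<Sum>i\<in>{0..<card I}. b (h i) x) = s x"
      unfolding s_def by (rule sum.reindex_bij_betw[OF h])
    finally show "(\<Sum>i<card I. \<rho> i x) = 1" using s[OF x] by simp
  qed
  moreover have "chart_dom (k (h i)) \<inter> D = {} \<or>
      (\<exists>a\<in>D. chart_dom (k (h i)) \<inter> D = {a} \<and> coord (k (h i)) a = 0 \<and> open (chart_img (k (h i))) \<and>
        (\<exists>N. openin X N \<and> a \<in> N \<and> (\<forall>y\<in>N. \<rho> i y = 1)))" if i: "i < card I" for i
  proof (cases "h i \<in> D")
    case False
    have "adapted_chart (k (h i)) (h i)" using k hI[OF i] I(2) by blast
    then show ?thesis using False unfolding adapted_chart_def by blast
  next
    case True
    let ?a = "h i"
    have aX: "?a \<in> topspace X" using True DX by blast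
    have ad: "adapted_chart (k ?a) ?a" by (rule k[OF aX])
    let ?Z = "\<lambda>x. X closure_of {y \<in> topspace X. b x y \<noteq> 0}"
    \<comment> \<open>On this set the other bump functions vanish; it contains the point because the other charts do not.\<close>
    let ?N = "N ?a \<inter> (topspace X - (\<Union>x\<in>I - {?a}. ?Z x))"
    have "closedin X (\<Union>x\<in>I - {?a}. ?Z x)"
      by (rule closedin_Union) (use I(1) in \<open>auto simp: closedin_closure_of\<close>)
    then have "openin X ?N" using N(1)[OF aX] by (intro openin_Int) (auto simp: closedin_def)
    moreover have "?a \<in> ?N"
    proof -
      have "?a \<notin> ?Z x" if x: "x \<in> I - {?a}" for x
      proof
        assume "?a \<in> ?Z x"
        have xX: "x \<in> topspace X" using x I(2) by blast
        then have "?a \<in> chart_dom (k x)" using supp[OF xX] \<open>?a \<in> ?Z x\<close> by blast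
        then show False using k[OF xX] True x unfolding adapted_chart_def by blast
      qed
      then show ?thesis using N(2)[OF aX] aX by blast
    qed
    moreover have "\<forall>y\<in>?N. \<rho> i y = 1"
    proof
      fix y assume y: "y \<in> ?N"
      have b0: "b x y = 0" if x: "x \<in> I - {?a}" for x
      proof -
        have "y \<notin> ?Z x" "y \<in> topspace X" using y x by auto
        then show ?thesis using closure_of_subset[of "{y \<in> topspace X. b x y \<noteq> 0}" X] by blast
      qed
      have "s y = b ?a y + (\<Sum>x\<in>I - {?a}. b x y)"
        unfolding s_def by (rule sum.remove[OF I(1) hI[OF i]])
      also have "(\<Sum>x\<in>I - {?a}. b x y) = 0" by (rule sum.neutral) (use b0 in blast)
      finally show "\<rho> i y = 1" using b1[OF aX] y by (simp add: \<rho>_def)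
    qed
    ultimately have "\<exists>N. openin X N \<and> ?a \<in> N \<and> (\<forall>y\<in>N. \<rho> i y = 1)" by blast
    moreover have "chart_dom (k ?a) \<inter> D = {?a}" "coord (k ?a) ?a = 0" "open (chart_img (k ?a))"
      using ad True unfolding adapted_chart_def by auto
    ultimately show ?thesis using True by blast
  qed
  ultimately show ?thesis by (intro exI[of _ "card I"] exI[of _ "\<lambda>i. k (h i)"] exI[of _ \<rho>]) simp
qed

section \<open>Existence of the decomposition\<close>

text \<open>Near each \<open>a \<in> D\<close> the primitive of the polar part of order two and higher comes from
  \<open>pole_reduction\<close>; \<open>form_with_germ\<close> makes it global, and the sum over \<open>a\<close> is \<open>\<beta>\<close>.\<close>

lemma log_decomposition_exists:
  assumes w: "\<omega> \<in> pole_forms A 1 1 D"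
  shows "\<exists>\<alpha> \<beta>. log_decomposition A D \<omega> \<alpha> \<beta>"
proof -
  have ws: "\<omega> \<in> smooth_forms A 1 1 D" using w unfolding pole_forms_def by blast
  let ?P = "\<lambda>a c \<beta>. c \<in> A \<and> a \<in> chart_dom c \<and> coord c a = 0 \<and> chart_dom c \<inter> D = {a} \<and> \<beta> \<in> smooth_forms A 0 1 D \<and>
      (\<exists>r N g h b. 0 < r \<and> ball 0 r \<subseteq> chart_img c \<and> smooth_on b (ball 0 r) \<and> smooth_on h (ball 0 r) \<and>
        (\<forall>z\<in>ball 0 r - {0}. \<beta> c (chart_inv c z) = b z / z ^ N \<and> \<omega> c (chart_inv c z) = g z / z ^ N \<and>
          wirtinger (\<lambda>z. b z / z ^ N) z (ball 0 r - {0}) = g z / z ^ N - h z / z)) \<and>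
      (\<exists>U. openin X U \<and> D - {a} \<subseteq> U \<and> (\<forall>k\<in>A. \<forall>x\<in>chart_dom k \<inter> U. \<beta> k x = 0))"
  have "\<forall>a\<in>D. \<exists>p. ?P a (fst p) (snd p)"
  proof
    fix a assume a: "a \<in> D"
    obtain c where "adapted_chart c a" using adapted_chart_exists a DX by blast
    then have c: "c \<in> A" "a \<in> chart_dom c" "coord c a = 0" "chart_dom c \<inter> D = {a}"
      using a unfolding adapted_chart_def by auto
    obtain N where N: "has_pole c N \<omega>" using pole_formsD(2)[OF w a c(1-3)] ..
    obtain r g where g: "0 < r" "ball 0 r \<subseteq> chart_img c" "smooth_on g (ball 0 r)"
      "\<And>z. z \<in> ball 0 r \<Longrightarrow> z \<noteq> 0 \<Longrightarrow> \<omega> c (chart_inv c z) = g z / z ^ N"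
      by (rule has_poleE[OF N]) (rule that)
    obtain b h where bh: "smooth_on b (ball 0 r)" "smooth_on h (ball 0 r)"
      "\<forall>z\<in>ball 0 r - {0}. wirtinger (\<lambda>z. b z / z ^ N) z (ball 0 r - {0}) = g z / z ^ N - h z / z"
      using pole_reduction[OF open_ball g(3)] by blast
    obtain \<beta> s U where \<beta>: "\<beta> \<in> smooth_forms A 0 1 D" "0 < s" "s \<le> r"
      "\<forall>z\<in>ball 0 s - {0}. \<beta> c (chart_inv c z) = b z / z ^ N"
      "openin X U" "D - {a} \<subseteq> U" "\<forall>k\<in>A. \<forall>x\<in>chart_dom k \<inter> U. \<beta> k x = 0"
      using form_with_germ[OF c g(1,2) pole_smooth_quotient[OF bh(1), of N]] by (elim bexE exE conjE) (rule that)
    have sr: "ball 0 s \<subseteq> ball (0::complex) r" using \<beta>(3) by auto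
    have tr: "wirtinger (\<lambda>z. b z / z ^ N) z (ball 0 s - {0}) = wirtinger (\<lambda>z. b z / z ^ N) z (ball 0 r - {0})"
      if z: "z \<in> ball 0 s - {0}" for z
    proof (rule wirtinger_transfer[OF _ _ z open_UNIV])
      show "thick (ball 0 r - {0})" "thick (ball 0 s - {0})" by (intro thick_open open_delete open_ball)+
      show "smooth_on (\<lambda>z. b z / z ^ N) (ball 0 r - {0})" by (rule pole_smooth_quotient[OF bh(1)])
    qed (use sr in auto)
    have germ: "\<forall>z\<in>ball 0 s - {0}. \<beta> c (chart_inv c z) = b z / z ^ N \<and> \<omega> c (chart_inv c z) = g z / z ^ N \<and>
          wirtinger (\<lambda>z. b z / z ^ N) z (ball 0 s - {0}) = g z / z ^ N - h z / z"
    proof (intro ballI conjI)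
      fix z :: complex assume z: "z \<in> ball 0 s - {0}"
      then have z': "z \<in> ball 0 r - {0}" using sr by blast
      show "\<beta> c (chart_inv c z) = b z / z ^ N" using \<beta>(4) z by blast
      show "\<omega> c (chart_inv c z) = g z / z ^ N" using g(4) z' by blast
      show "wirtinger (\<lambda>z. b z / z ^ N) z (ball 0 s - {0}) = g z / z ^ N - h z / z"
        unfolding tr[OF z] using bh(3) z' by blast
    qed
    have sub: "ball 0 s \<subseteq> chart_img c" using g(2) sr by (rule order_trans[rotated])
    have "?P a c \<beta>"
      by (intro conjI c \<beta>(1) exI[of _ s] exI[of _ N] exI[of _ g] exI[of _ h] exI[of _ b] exI[of _ U]
          \<beta>(2,5,6,7) sub germ smooth_on_subset[OF bh(1) sr] smooth_on_subset[OF bh(2) sr])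
    then show "\<exists>p. ?P a (fst p) (snd p)" by (intro exI[of _ "(c, \<beta>)"]) simp
  qed
  from bchoice[OF this] obtain p where p: "\<forall>a\<in>D. ?P a (fst (p a)) (snd (p a))" ..
  define \<beta> where "\<beta> = (\<lambda>c x. \<Sum>a\<in>D. snd (p a) c x)"
  define \<alpha> where "\<alpha> = (\<lambda>c x. \<omega> c x - del D \<beta> c x)"
  have \<beta>s: "\<beta> \<in> smooth_forms A 0 1 D" unfolding \<beta>_def by (rule smooth_forms_sum) (use p in blast)
  have \<alpha>s: "\<alpha> \<in> smooth_forms A 1 1 D" unfolding \<alpha>_def by (rule smooth_forms_diff[OF ws del_smooth_forms[OF \<beta>s]])
  have poles: "\<exists>c\<in>A. \<exists>N. a \<in> chart_dom c \<and> coord c a = 0 \<and> has_pole c N \<beta> \<and> has_pole c 1 \<alpha>" if a: "a \<in> D" for a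
  proof -
    have pa: "?P a (fst (p a)) (snd (p a))" using p a by blast
    let ?c = "fst (p a)"
    have c: "?c \<in> A" "a \<in> chart_dom ?c" "coord ?c a = 0" "chart_dom ?c \<inter> D = {a}" using pa by blast+
    obtain r N g h b where r: "0 < r" "ball 0 r \<subseteq> chart_img ?c" "smooth_on b (ball 0 r)" "smooth_on h (ball 0 r)"
      "\<forall>z\<in>ball 0 r - {0}. snd (p a) ?c (chart_inv ?c z) = b z / z ^ N \<and> \<omega> ?c (chart_inv ?c z) = g z / z ^ N \<and>
          wirtinger (\<lambda>z. b z / z ^ N) z (ball 0 r - {0}) = g z / z ^ N - h z / z"
      using pa by (elim conjE exE) (rule that)
    have "\<forall>a'\<in>D - {a}. \<exists>U. openin X U \<and> a \<in> U \<and> (\<forall>k\<in>A. \<forall>x\<in>chart_dom k \<inter> U. snd (p a') k x = 0)"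
    proof
      fix a' assume a': "a' \<in> D - {a}"
      then have "\<exists>U. openin X U \<and> D - {a'} \<subseteq> U \<and> (\<forall>k\<in>A. \<forall>x\<in>chart_dom k \<inter> U. snd (p a') k x = 0)"
        using p by blast
      then show "\<exists>U. openin X U \<and> a \<in> U \<and> (\<forall>k\<in>A. \<forall>x\<in>chart_dom k \<inter> U. snd (p a') k x = 0)"
        using a a' by blast
    qed
    from bchoice[OF this] obtain U where U: "\<forall>a'\<in>D - {a}. openin X (U a') \<and> a \<in> U a' \<and>
      (\<forall>k\<in>A. \<forall>x\<in>chart_dom k \<inter> U a'. snd (p a') k x = 0)" ..
    let ?V = "topspace X \<inter> \<Inter> (U ` (D - {a}))"
    have V: "openin X ?V"
    proof (cases "D - {a} = {}")
      case True
      show ?thesis unfolding True by simp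
    next
      case False
      show ?thesis
        by (intro openin_Int openin_topspace openin_Inter) (use False finD U in auto)
    qed
    have aV: "a \<in> ?V" using U a DX by blast
    have abd: "a \<notin> surface_boundary A" using a Dbd by blast
    obtain s' where s': "0 < s'" "ball 0 s' \<subseteq> coord ?c ` (chart_dom ?c \<inter> ?V)"
      by (rule nbhd_ball[OF c(1-3) abd V aV]) (rule that)
    define s where "s = min r s'"
    have s: "0 < s" "ball 0 s \<subseteq> ball (0::complex) r" "ball 0 s \<subseteq> coord ?c ` (chart_dom ?c \<inter> ?V)"
      using r(1) s' by (auto simp: s_def)
    have \<beta>b: "\<beta> ?c (chart_inv ?c z) = b z / z ^ N" if z: "z \<in> ball 0 s" "z \<noteq> 0" for z
    proof -
      have x: "chart_inv ?c z \<in> chart_dom ?c \<inter> ?V" by (rule inv_in[OF c(1)]) (use s(3) z in blast)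
      have "\<beta> ?c (chart_inv ?c z) = snd (p a) ?c (chart_inv ?c z) + (\<Sum>a'\<in>D - {a}. snd (p a') ?c (chart_inv ?c z))"
        unfolding \<beta>_def by (rule sum.remove[OF finD a])
      also have "(\<Sum>a'\<in>D - {a}. snd (p a') ?c (chart_inv ?c z)) = 0"
        by (rule sum.neutral) (use U x c(1) in blast)
      finally show ?thesis using r(5) z s(2) by auto
    qed
    have "has_pole ?c N \<beta>"
      by (rule has_poleI[OF s(1) order_trans[OF s(2) r(2)] smooth_on_subset[OF r(3) s(2)]])
        (rule \<beta>b)
    moreover have "has_pole ?c 1 \<alpha>"
    proof (rule has_poleI[OF s(1) order_trans[OF s(2) r(2)] smooth_on_subset[OF r(4) s(2)]])
      fix z :: complex assume z: "z \<in> ball 0 s" "z \<noteq> 0"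
      have sub: "ball 0 s - {0} \<subseteq> coord ?c ` (chart_dom ?c - D)"
      proof
        fix w :: complex assume w: "w \<in> ball 0 s - {0}"
        then obtain y where y: "w = coord ?c y" "y \<in> chart_dom ?c" using s(3) by blast
        then have "y \<noteq> a" using w c(3) by auto
        then show "w \<in> coord ?c ` (chart_dom ?c - D)" using y c(4) by blast
      qed
      have "del D \<beta> ?c (chart_inv ?c z) = wirtinger (\<lambda>z. b z / z ^ N) z (ball 0 r - {0})"
      proof (rule del_eqI[OF \<beta>s c(1), of _ _ "ball 0 s"])
        show "thick (ball 0 r - {0::complex})" by (intro thick_open open_delete open_ball)
        show "z \<in> coord ?c ` (chart_dom ?c - D)" using sub z by blast
        show "(ball 0 r - {0}) \<inter> ball 0 s \<subseteq> coord ?c ` (chart_dom ?c - D)" using sub by blast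
        show "b w / w ^ N = \<beta> ?c (chart_inv ?c w)" if "w \<in> ball 0 r - {0}" "w \<in> ball 0 s" for w
          using \<beta>b[of w] that by simp
      qed (use z s(2) in auto)
      then show "\<alpha> ?c (chart_inv ?c z) = h z / z ^ 1"
        using r(5)[rule_format, of z] z s(2) by (auto simp: \<alpha>_def)
    qed
    ultimately show ?thesis using c by blast
  qed
  have "\<beta> \<in> pole_forms A 0 1 D" by (rule pole_formsI[OF \<beta>s]) (use poles in blast)
  moreover have "\<alpha> \<in> log_forms A D" by (rule log_formsI[OF \<alpha>s]) (use poles in blast)
  ultimately have "log_decomposition A D \<omega> \<alpha> \<beta>" unfolding log_decomposition_def by (simp add: \<alpha>_def)
  then show ?thesis by blast
qed

end

section \<open>Independence of charts and partitions of unity\<close>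

context marked_surface
begin

text \<open>What the change of variables formula uses of a form.\<close>

definition form_law :: "nat \<Rightarrow> nat \<Rightarrow> 'a form \<Rightarrow> bool" where
  "form_law p q \<omega> \<longleftrightarrow> (\<forall>c\<in>A. \<forall>c'\<in>A. \<forall>x \<in> chart_dom c \<inter> chart_dom c' - D.
        \<omega> c x = \<omega> c' x * transition_deriv c c' x ^ p * cnj (transition_deriv c c' x) ^ q)"

lemma smooth_forms_law: "\<omega> \<in> smooth_forms A p q D \<Longrightarrow> form_law p q \<omega>"
  unfolding smooth_forms_def form_law_def by blast

definition weighted :: "('a \<Rightarrow> real) \<Rightarrow> 'a form \<Rightarrow> 'a form" where
  "weighted r \<omega> = (\<lambda>c x. of_real (r x) * \<omega> c x)"

lemma form_lawD:
  "form_law p q \<omega> \<Longrightarrow> c \<in> A \<Longrightarrow> c' \<in> A \<Longrightarrow> x \<in> chart_dom c \<inter> chart_dom c' - D \<Longrightarrow>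
    \<omega> c x = \<omega> c' x * transition_deriv c c' x ^ p * cnj (transition_deriv c c' x) ^ q"
  unfolding form_law_def by blast

lemma form_law_weighted: assumes "form_law p q \<omega>" shows "form_law p q (weighted r \<omega>)"
  unfolding form_law_def weighted_def
proof (intro ballI)
  fix c c' x assume "c \<in> A" "c' \<in> A" "x \<in> chart_dom c \<inter> chart_dom c' - D"
  then show "of_real (r x) * \<omega> c x = of_real (r x) * \<omega> c' x * transition_deriv c c' x ^ p * cnj (transition_deriv c c' x) ^ q"
    by (simp only: form_lawD[OF assms] mult.assoc)
qed

definition weight :: "('a \<Rightarrow> real) \<Rightarrow> bool" where
  "weight r \<longleftrightarrow> smooth_fun r \<and> (\<forall>x\<in>topspace X. 0 \<le> r x \<and> r x \<le> 1)"

definition vanishes_off :: "'a set \<Rightarrow> 'a form \<Rightarrow> bool" where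
  "vanishes_off S \<omega> \<longleftrightarrow> (\<forall>k\<in>A. \<forall>x\<in>chart_dom k - D. x \<notin> S \<longrightarrow> \<omega> k x = 0)"

lemma partition_weight:
  assumes P: "partition_of_unity X A n c \<rho>" and i: "i < n"
  shows "c i \<in> A" "weight (\<rho> i)" "vanishes_off (chart_dom (c i)) (weighted (\<rho> i) \<omega>)"
    "X closure_of {x \<in> topspace X. \<rho> i x \<noteq> 0} \<subseteq> chart_dom (c i)"
proof -
  note P' = P[unfolded partition_of_unity_def]
  have Pi: "c i \<in> A" "\<forall>k\<in>A. smooth_on (\<lambda>z. \<rho> i (chart_inv k z)) (chart_img k)"
    "\<forall>x\<in>topspace X. 0 \<le> \<rho> i x" "X closure_of {x \<in> topspace X. \<rho> i x \<noteq> 0} \<subseteq> chart_dom (c i)"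
    using conjunct1[OF P'] i by blast+
  show "c i \<in> A" by (rule Pi(1))
  show "X closure_of {x \<in> topspace X. \<rho> i x \<noteq> 0} \<subseteq> chart_dom (c i)" by (rule Pi(4))
  have "\<rho> i x \<le> 1" if x: "x \<in> topspace X" for x
  proof -
    have "\<rho> i x \<le> (\<Sum>j<n. \<rho> j x)"
    proof (rule member_le_sum)
      show "0 \<le> \<rho> j x" if "j \<in> {..<n} - {i}" for j using conjunct1[OF P'] that x by blast
    qed (use i in auto)
    also have "\<dots> = 1" using conjunct2[OF P'] x by blast
    finally show ?thesis .
  qed
  then show "weight (\<rho> i)" unfolding weight_def smooth_fun_def using Pi by blast
  have "\<rho> i x = 0" if "x \<in> topspace X" "x \<notin> chart_dom (c i)" for x
    using closure_of_subset[of "{x \<in> topspace X. \<rho> i x \<noteq> 0}" X] Pi(4) that by blast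
  then show "vanishes_off (chart_dom (c i)) (weighted (\<rho> i) \<omega>)"
    unfolding vanishes_off_def weighted_def
  proof (intro ballI impI)
    fix k x assume "k \<in> A" "x \<in> chart_dom k - D" "x \<notin> chart_dom (c i)"
    moreover have "x \<in> topspace X" using dom_subset[of k] calculation by blast
    ultimately show "of_real (\<rho> i x) * \<omega> k x = 0"
      using \<open>\<And>x. x \<in> topspace X \<Longrightarrow> x \<notin> chart_dom (c i) \<Longrightarrow> \<rho> i x = 0\<close> by simp
  qed
qed

lemma partition_sum: "partition_of_unity X A n c \<rho> \<Longrightarrow> x \<in> topspace X \<Longrightarrow> (\<Sum>i<n. \<rho> i x) = 1"
  unfolding partition_of_unity_def by blast

end

text \<open>The integrals over the surface and over its boundary are both glued from an integral in charts: \<open>ig c\<close>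
  says that the coefficient of a form is integrable in the chart \<open>c\<close>, and \<open>it c\<close> is its integral. The gluing
  argument only uses the following properties, of which \<open>it_change\<close> is the change of variables formula.\<close>

locale chart_integral = marked_surface X A D
  for X :: "'a topology" and A :: "'a chart set" and D :: "'a set" +
  fixes p q :: nat and ig :: "'a chart \<Rightarrow> 'a form \<Rightarrow> bool" and it :: "'a chart \<Rightarrow> 'a form \<Rightarrow> complex"
  assumes ig_sum: "c \<in> A \<Longrightarrow> (\<And>i. i < (n::nat) \<Longrightarrow> ig c (f i)) \<Longrightarrow> ig c (\<lambda>c x. \<Sum>i<n. f i c x)"
    and it_sum: "c \<in> A \<Longrightarrow> (\<And>i. i < (n::nat) \<Longrightarrow> ig c (f i)) \<Longrightarrow>
      it c (\<lambda>c x. \<Sum>i<n. f i c x) = (\<Sum>i<n. it c (f i))"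
    and it_cong: "c \<in> A \<Longrightarrow> (\<And>x. x \<in> chart_dom c - D \<Longrightarrow> \<omega> c x = \<omega>' c x) \<Longrightarrow> ig c \<omega> \<Longrightarrow>
      ig c \<omega>' \<and> it c \<omega>' = it c \<omega>"
    and ig_weighted: "c \<in> A \<Longrightarrow> ig c \<omega> \<Longrightarrow> weight r \<Longrightarrow> ig c (weighted r \<omega>)"
    and it_change: "c \<in> A \<Longrightarrow> c' \<in> A \<Longrightarrow> form_law p q \<omega> \<Longrightarrow> vanishes_off (chart_dom c \<inter> chart_dom c') \<omega> \<Longrightarrow>
      ig c \<omega> \<Longrightarrow> ig c' \<omega> \<and> it c' \<omega> = it c \<omega>"
begin

text \<open>Each form \<open>f i\<close> is split by the partition \<open>\<sigma>\<close>; the pieces live in the overlap of two charts, may be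
  computed in either, and are summed in the other order.\<close>

lemma it_partition:
  fixes n m :: nat and f :: "nat \<Rightarrow> 'a form"
  assumes P: "partition_of_unity X A m d \<sigma>"
    and f: "\<And>i. i < n \<Longrightarrow> c i \<in> A" "\<And>i. i < n \<Longrightarrow> form_law p q (f i)"
      "\<And>i. i < n \<Longrightarrow> vanishes_off (chart_dom (c i)) (f i)" "\<And>i. i < n \<Longrightarrow> ig (c i) (f i)"
  shows "(\<Sum>i<n. it (c i) (f i)) = (\<Sum>k<m. it (d k) (weighted (\<sigma> k) (\<lambda>c x. \<Sum>i<n. f i c x)))"
proof -
  note w = partition_weight[OF P]
  have 1: "ig (c i) (weighted (\<sigma> k) (f i))" if "i < n" "k < m" for i k
    by (rule ig_weighted[OF f(1)[OF that(1)] f(4)[OF that(1)] w(2)[OF that(2)]])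
  have v: "vanishes_off (chart_dom (c i) \<inter> chart_dom (d k)) (weighted (\<sigma> k) (f i))" if "i < n" "k < m" for i k
    using f(3)[OF that(1)] w(3)[OF that(2), of "f i"] unfolding vanishes_off_def weighted_def by auto
  have 2: "ig (d k) (weighted (\<sigma> k) (f i)) \<and> it (d k) (weighted (\<sigma> k) (f i)) = it (c i) (weighted (\<sigma> k) (f i))"
    if "i < n" "k < m" for i k
    by (rule it_change[OF f(1)[OF that(1)] w(1)[OF that(2)] form_law_weighted[OF f(2)[OF that(1)]] v[OF that] 1[OF that]])
  have "(\<Sum>i<n. it (c i) (f i)) = (\<Sum>i<n. \<Sum>k<m. it (c i) (weighted (\<sigma> k) (f i)))"
  proof (rule sum.cong[OF refl])
    fix i assume "i \<in> {..<n}"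
    then have i: "i < n" by simp
    have "f i (c i) x = (\<Sum>k<m. weighted (\<sigma> k) (f i) (c i) x)" if x: "x \<in> chart_dom (c i) - D" for x
    proof -
      have "x \<in> topspace X" using x dom_subset[OF f(1)[OF i]] by blast
      then have "of_real (\<Sum>k<m. \<sigma> k x) = (1::complex)" using partition_sum[OF P] by simp
      then show ?thesis unfolding weighted_def sum_distrib_right[symmetric] of_real_sum[symmetric] by simp
    qed
    from it_cong[where \<omega>="f i" and \<omega>'="\<lambda>c x. \<Sum>k<m. weighted (\<sigma> k) (f i) c x", OF f(1)[OF i] this f(4)[OF i]]
    have "it (c i) (f i) = it (c i) (\<lambda>c x. \<Sum>k<m. weighted (\<sigma> k) (f i) c x)" by simp
    also have "\<dots> = (\<Sum>k<m. it (c i) (weighted (\<sigma> k) (f i)))" by (rule it_sum[where f="\<lambda>k. weighted (\<sigma> k) (f i)", OF f(1)[OF i] 1[OF i]])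
    finally show "it (c i) (f i) = (\<Sum>k<m. it (c i) (weighted (\<sigma> k) (f i)))" .
  qed
  also have "\<dots> = (\<Sum>i<n. \<Sum>k<m. it (d k) (weighted (\<sigma> k) (f i)))"
    by (intro sum.cong refl) (use 2 in simp)
  also have "\<dots> = (\<Sum>k<m. \<Sum>i<n. it (d k) (weighted (\<sigma> k) (f i)))" by (rule sum.swap)
  also have "\<dots> = (\<Sum>k<m. it (d k) (weighted (\<sigma> k) (\<lambda>c x. \<Sum>i<n. f i c x)))"
  proof (rule sum.cong[OF refl])
    fix k assume "k \<in> {..<m}"
    then have k: "k < m" by simp
    have "(\<Sum>i<n. it (d k) (weighted (\<sigma> k) (f i))) = it (d k) (\<lambda>c x. \<Sum>i<n. weighted (\<sigma> k) (f i) c x)"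
      by (rule it_sum[where f="\<lambda>i. weighted (\<sigma> k) (f i)", symmetric, OF w(1)[OF k]]) (use 2 k in blast)
    also have "(\<lambda>c x. \<Sum>i<n. weighted (\<sigma> k) (f i) c x) = weighted (\<sigma> k) (\<lambda>c x. \<Sum>i<n. f i c x)"
      by (simp add: weighted_def sum_distrib_left)
    finally show "(\<Sum>i<n. it (d k) (weighted (\<sigma> k) (f i))) = it (d k) (weighted (\<sigma> k) (\<lambda>c x. \<Sum>i<n. f i c x))" .
  qed
  finally show ?thesis .
qed

lemma it_partition_independent:
  assumes P: "partition_of_unity X A n c \<rho>" and Q: "partition_of_unity X A m d \<sigma>"
    and law: "form_law p q \<omega>"
    and ig: "\<And>i. i < n \<Longrightarrow> ig (c i) (weighted (\<rho> i) \<omega>)" "\<And>k. k < m \<Longrightarrow> ig (d k) (weighted (\<sigma> k) \<omega>)"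
  shows "(\<Sum>i<n. it (c i) (weighted (\<rho> i) \<omega>)) = (\<Sum>k<m. it (d k) (weighted (\<sigma> k) \<omega>))"
proof -
  have "(\<Sum>i<n. it (c i) (weighted (\<rho> i) \<omega>)) = (\<Sum>k<m. it (d k) (weighted (\<sigma> k) (\<lambda>c x. \<Sum>i<n. weighted (\<rho> i) \<omega> c x)))"
    by (rule it_partition[OF Q partition_weight(1)[OF P] form_law_weighted[OF law] partition_weight(3)[OF P] ig(1)])
  also have "\<dots> = (\<Sum>k<m. it (d k) (weighted (\<sigma> k) \<omega>))"
  proof (rule sum.cong[OF refl])
    fix k assume "k \<in> {..<m}"
    then have k: "k < m" by simp
    have "weighted (\<sigma> k) \<omega> (d k) x = weighted (\<sigma> k) (\<lambda>c x. \<Sum>i<n. weighted (\<rho> i) \<omega> c x) (d k) x"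
      if x: "x \<in> chart_dom (d k) - D" for x
    proof -
      have "x \<in> topspace X" using x dom_subset[OF partition_weight(1)[OF Q k]] by blast
      then have "of_real (\<Sum>i<n. \<rho> i x) = (1::complex)" using partition_sum[OF P] by simp
      then show ?thesis unfolding weighted_def sum_distrib_right[symmetric] of_real_sum[symmetric] by simp
    qed
    from it_cong[where \<omega>="weighted (\<sigma> k) \<omega>" and \<omega>'="weighted (\<sigma> k) (\<lambda>c x. \<Sum>i<n. weighted (\<rho> i) \<omega> c x)",
        OF partition_weight(1)[OF Q k] this ig(2)[OF k]]
    show "it (d k) (weighted (\<sigma> k) (\<lambda>c x. \<Sum>i<n. weighted (\<rho> i) \<omega> c x)) = it (d k) (weighted (\<sigma> k) \<omega>)" by simp
  qed
  finally show ?thesis .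
qed

end

context marked_surface
begin

subsection \<open>The surface integral in charts\<close>

definition surface_integrable :: "'a chart \<Rightarrow> 'a form \<Rightarrow> bool" where
  "surface_integrable c \<omega> \<longleftrightarrow> (\<lambda>z. \<omega> c (chart_inv c z) * (- 2 * \<i>)) absolutely_integrable_on chart_img c"

definition surface_integral :: "'a chart \<Rightarrow> 'a form \<Rightarrow> complex" where
  "surface_integral c \<omega> = integral (chart_img c) (\<lambda>z. \<omega> c (chart_inv c z) * (- 2 * \<i>))"

lemma hopen_lebesgue: "hopen S \<Longrightarrow> S \<in> sets lebesgue"
  using hopen_borel by (simp add: sets_completionI_sets)

lemma smooth_fun_bounded_measurable:
  assumes r: "weight r" and c: "c \<in> A"
  shows "continuous_on (chart_img c) (\<lambda>z. r (chart_inv c z))"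
    "z \<in> chart_img c \<Longrightarrow> \<bar>r (chart_inv c z)\<bar> \<le> 1"
proof -
  show "continuous_on (chart_img c) (\<lambda>z. r (chart_inv c z))"
    using r c smooth_on_imp_continuous_on unfolding weight_def smooth_fun_def by blast
  assume "z \<in> chart_img c"
  then have "chart_inv c z \<in> topspace X" using inv_in[OF c, of z UNIV] dom_subset[OF c] by auto
  then show "\<bar>r (chart_inv c z)\<bar> \<le> 1" using r unfolding weight_def by auto
qed

lemma transition_field_derivative:
  assumes c: "c \<in> A" "c' \<in> A" and x: "x \<in> chart_dom c" "x \<in> chart_dom c'"
  shows "((\<lambda>z. coord c' (chart_inv c z)) has_field_derivative transition_deriv c c' x)
    (at (coord c x) within coord c ` (chart_dom c \<inter> chart_dom c'))"
proof -
  let ?S = "coord c ` (chart_dom c \<inter> chart_dom c')"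
  obtain W F where W: "open W" "coord c x \<in> W" "F holomorphic_on W"
    "\<And>y. y \<in> chart_dom c \<inter> chart_dom c' \<Longrightarrow> coord c y \<in> W \<Longrightarrow>
      F (coord c y) = coord c' y \<and> transition_deriv c c' y = deriv F (coord c y)"
    by (rule transition[OF c, of x]) (use x that in auto)
  obtain r where r: "r > 0" "ball (coord c x) r \<subseteq> W" using W(1,2) open_contains_ball by blast
  have "(F has_field_derivative deriv F (coord c x)) (at (coord c x) within ?S)"
    by (rule has_field_derivative_at_within[OF holomorphic_derivI[OF W(3,1,2)]])
  then have "((\<lambda>z. coord c' (chart_inv c z)) has_field_derivative deriv F (coord c x)) (at (coord c x) within ?S)"
  proof (rule has_field_derivative_transform_within[OF _ r(1)])
    show "F w = coord c' (chart_inv c w)" if w: "w \<in> ?S" "dist w (coord c x) < r" for w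
    proof -
      obtain u where u: "u \<in> chart_dom c \<inter> chart_dom c'" "w = coord c u" using w(1) by blast
      have "w \<in> W" using w(2) r(2) by (auto simp: dist_commute)
      then show ?thesis using W(4)[OF u(1)] u inv_coord[OF c(1), of u] by simp
    qed
  qed (use x in auto)
  then show ?thesis using W(4)[of x] W(2) x by simp
qed

sublocale surface: chart_integral X A D 1 1 surface_integrable surface_integral
proof
  fix c :: "'a chart" and n and f :: "nat \<Rightarrow> 'a form" assume c: "c \<in> A" and f: "\<And>i. i < n \<Longrightarrow> surface_integrable c (f i)"
  have eq: "(\<lambda>z. (\<Sum>i<n. f i c (chart_inv c z)) * (- 2 * \<i>)) = (\<lambda>z. \<Sum>i<n. f i c (chart_inv c z) * (- 2 * \<i>))"
    by (rule ext) (rule sum_distrib_right)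
  show "surface_integrable c (\<lambda>c x. \<Sum>i<n. f i c x)"
    unfolding surface_integrable_def eq
    by (rule absolutely_integrable_sum) (use f in \<open>auto simp: surface_integrable_def\<close>)
  show "surface_integral c (\<lambda>c x. \<Sum>i<n. f i c x) = (\<Sum>i<n. surface_integral c (f i))"
    unfolding surface_integral_def eq
    by (rule integral_sum) (use f in \<open>auto simp: surface_integrable_def intro: set_lebesgue_integral_eq_integral(1)\<close>)
next
  fix c and \<omega> \<omega>' :: "'a form" assume c: "c \<in> A" and eq: "\<And>x. x \<in> chart_dom c - D \<Longrightarrow> \<omega> c x = \<omega>' c x"
    and ig: "surface_integrable c \<omega>"
  let ?E = "coord c ` D"
  have E: "negligible ?E" using finD by (simp add: negligible_finite)
  have *: "\<omega>' c (chart_inv c z) * (- 2 * \<i>) = \<omega> c (chart_inv c z) * (- 2 * \<i>)" if z: "z \<in> chart_img c - ?E" for z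
  proof -
    obtain x where x: "z = coord c x" "x \<in> chart_dom c" using z by blast
    then have "x \<in> chart_dom c - D" using z by blast
    from eq[OF this] show ?thesis using inv_coord[OF c x(2)] x(1) by simp
  qed
  show "surface_integrable c \<omega>' \<and> surface_integral c \<omega>' = surface_integral c \<omega>"
    unfolding surface_integrable_def surface_integral_def
  proof
    show "(\<lambda>z. \<omega>' c (chart_inv c z) * (- 2 * \<i>)) absolutely_integrable_on chart_img c"
      by (rule absolutely_integrable_spike[OF ig[unfolded surface_integrable_def] E *])
    show "integral (chart_img c) (\<lambda>z. \<omega>' c (chart_inv c z) * (- 2 * \<i>)) =
        integral (chart_img c) (\<lambda>z. \<omega> c (chart_inv c z) * (- 2 * \<i>))"
      by (rule integral_spike[OF E]) (rule *[symmetric])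
  qed
next
  fix c r and \<omega> :: "'a form" assume c: "c \<in> A" and ig: "surface_integrable c \<omega>" and r: "weight r"
  have m: "chart_img c \<in> sets lebesgue" by (rule hopen_lebesgue[OF hopen_img[OF c]])
  have "(\<lambda>z. r (chart_inv c z) *\<^sub>R (\<omega> c (chart_inv c z) * (- 2 * \<i>))) absolutely_integrable_on chart_img c"
  proof (rule absolutely_integrable_bounded_measurable_product[OF
        bilinear_conv_bounded_bilinear[THEN iffD2, OF bounded_bilinear_scaleR] _ m _ ig[unfolded surface_integrable_def]])
    show "(\<lambda>z. r (chart_inv c z)) \<in> borel_measurable (lebesgue_on (chart_img c))"
      by (rule continuous_imp_measurable_on_sets_lebesgue[OF smooth_fun_bounded_measurable(1)[OF r c] m])
    show "bounded ((\<lambda>z. r (chart_inv c z)) ` chart_img c)"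
      unfolding bounded_iff by (rule exI[of _ 1]) (use smooth_fun_bounded_measurable(2)[OF r c] in auto)
  qed
  then show "surface_integrable c (weighted r \<omega>)"
    unfolding surface_integrable_def weighted_def by (simp add: scaleR_conv_of_real mult.assoc)
next
  fix c c' and \<omega> :: "'a form" assume c: "c \<in> A" "c' \<in> A" and law: "form_law 1 1 \<omega>"
    and v: "vanishes_off (chart_dom c \<inter> chart_dom c') \<omega>" and ig: "surface_integrable c \<omega>"
  let ?U = "chart_dom c \<inter> chart_dom c' - D"
  let ?F = "\<lambda>k z. \<omega> k (chart_inv k z) * (- 2 * \<i>)"
  let ?g = "\<lambda>z. coord c' (chart_inv c z)" and ?g' = "\<lambda>z. transition_deriv c c' (chart_inv c z)"
  have spike: "negligible {z \<in> chart_img k - coord k ` ?U. ?F k z \<noteq> 0}"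
    "negligible {z \<in> coord k ` ?U - chart_img k. ?F k z \<noteq> 0}" if k: "k \<in> {c, c'}" for k
  proof -
    have kA: "k \<in> A" using k c by blast
    have "{z \<in> chart_img k - coord k ` ?U. ?F k z \<noteq> 0} \<subseteq> coord k ` D"
    proof
      fix z assume z: "z \<in> {z \<in> chart_img k - coord k ` ?U. ?F k z \<noteq> 0}"
      then obtain x where x: "z = coord k x" "x \<in> chart_dom k" by blast
      have "x \<in> D"
      proof (rule ccontr)
        assume "x \<notin> D"
        then have "x \<notin> chart_dom c \<inter> chart_dom c'" using z x by blast
        then have "\<omega> k x = 0" using v kA x(2) \<open>x \<notin> D\<close> unfolding vanishes_off_def by blast
        then show False using z inv_coord[OF kA x(2)] x(1) by simp
      qed
      then show "z \<in> coord k ` D" using x(1) by blast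
    qed
    then show "negligible {z \<in> chart_img k - coord k ` ?U. ?F k z \<noteq> 0}"
      by (rule negligible_subset[OF negligible_finite, rotated]) (use finD in simp)
    have e: "{z \<in> coord k ` ?U - chart_img k. ?F k z \<noteq> 0} = {}" using k by blast
    show "negligible {z \<in> coord k ` ?U - chart_img k. ?F k z \<noteq> 0}"
      unfolding e by (rule negligible_empty)
  qed
  have sub: "(?F k absolutely_integrable_on chart_img k \<longleftrightarrow> ?F k absolutely_integrable_on coord k ` ?U) \<and>
      integral (chart_img k) (?F k) = integral (coord k ` ?U) (?F k)" if k: "k \<in> {c, c'}" for k
    by (rule conjI[OF absolutely_integrable_spike_set_eq[OF spike[OF k]] integral_spike_set[OF spike[OF k]]])
  have U: "?U = chart_dom c \<inter> (chart_dom c' \<inter> (topspace X - D))" using dom_subset[OF c(1)] by auto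
  have S: "coord c ` ?U \<in> sets lebesgue"
    unfolding U
    by (rule hopen_lebesgue[OF hopen_chart[OF c(1) openin_Int[OF dom_open[OF c(2)] finite_complement_openin'[OF finD]]]])
  have gS: "?g ` (coord c ` ?U) = coord c' ` ?U"
  proof -
    have "(\<lambda>x. ?g (coord c x)) ` ?U = coord c' ` ?U"
      by (rule image_cong[OF refl]) (simp add: inv_coord[OF c(1)])
    then show ?thesis by (simp only: image_image)
  qed
  have inj: "inj_on ?g (coord c ` ?U)"
  proof (rule inj_onI)
    fix u w assume "u \<in> coord c ` ?U" "w \<in> coord c ` ?U" and eq: "?g u = ?g w"
    then obtain x y where xy: "x \<in> ?U" "u = coord c x" "y \<in> ?U" "w = coord c y" by blast
    then have "coord c' x = coord c' y" using eq inv_coord[OF c(1)] by simp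
    then have "x = y" using xy by (intro inj_onD[OF coord_inj[OF c(2)]]) auto
    then show "u = w" using xy by simp
  qed
  have der: "(?g has_field_derivative ?g' z) (at z within coord c ` ?U)" if z: "z \<in> coord c ` ?U" for z
  proof -
    obtain x where x: "x \<in> ?U" "z = coord c x" using z by blast
    have "(?g has_field_derivative transition_deriv c c' x) (at (coord c x) within coord c ` (chart_dom c \<inter> chart_dom c'))"
      by (rule transition_field_derivative[OF c]) (use x in auto)
    then have "(?g has_field_derivative transition_deriv c c' x) (at (coord c x) within coord c ` ?U)"
      by (rule has_field_derivative_subset) auto
    then show ?thesis using x inv_coord[OF c(1)] by simp
  qed
  have F: "of_real ((cmod (?g' z))\<^sup>2) * ?F c' (?g z) = ?F c z" if z: "z \<in> coord c ` ?U" for z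
  proof -
    obtain x where x: "x \<in> ?U" "z = coord c x" using z by blast
    have "\<omega> c x = \<omega> c' x * transition_deriv c c' x * cnj (transition_deriv c c' x)"
      using form_lawD[OF law c x(1)] by simp
    also have "\<dots> = \<omega> c' x * of_real ((cmod (transition_deriv c c' x))\<^sup>2)"
      by (simp add: complex_norm_square mult.assoc del: of_real_power)
    finally show ?thesis using x inv_coord[OF c(1)] inv_coord[OF c(2)] by (simp add: mult_ac)
  qed
  have "?F c absolutely_integrable_on coord c ` ?U \<and> integral (coord c ` ?U) (?F c) = surface_integral c \<omega>"
    using sub[of c] ig by (simp add: surface_integrable_def surface_integral_def)
  then have "(\<lambda>z. of_real ((cmod (?g' z))\<^sup>2) * ?F c' (?g z)) absolutely_integrable_on coord c ` ?U \<and>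
      integral (coord c ` ?U) (\<lambda>z. of_real ((cmod (?g' z))\<^sup>2) * ?F c' (?g z)) = surface_integral c \<omega>"
    using absolutely_integrable_spike_eq[OF negligible_empty, of "coord c ` ?U" "\<lambda>z. of_real ((cmod (?g' z))\<^sup>2) * ?F c' (?g z)" "?F c"]
      integral_cong[of "coord c ` ?U" "\<lambda>z. of_real ((cmod (?g' z))\<^sup>2) * ?F c' (?g z)" "?F c"] F by auto
  from iffD1[OF change_of_variables_complex[where f="?F c'", OF S der inj] this]
  have "?F c' absolutely_integrable_on coord c' ` ?U \<and> integral (coord c' ` ?U) (?F c') = surface_integral c \<omega>"
    unfolding gS .
  then show "surface_integrable c' \<omega> \<and> surface_integral c' \<omega> = surface_integral c \<omega>"
    using sub[of c'] by (simp add: surface_integrable_def surface_integral_def)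
qed

end

context marked_surface
begin

subsection \<open>The boundary integral in charts\<close>

definition boundary_integrable :: "'a chart \<Rightarrow> 'a form \<Rightarrow> bool" where
  "boundary_integrable c \<omega> \<longleftrightarrow> (\<lambda>t. \<omega> c (chart_inv c (complex_of_real t))) absolutely_integrable_on boundary_img A c"

definition boundary_integral :: "'a chart \<Rightarrow> 'a form \<Rightarrow> complex" where
  "boundary_integral c \<omega> = integral (boundary_img A c) (\<lambda>t. \<omega> c (chart_inv c (complex_of_real t)))"

lemma boundary_imgE:
  assumes c: "c \<in> A" and t: "t \<in> boundary_img A c"
  obtains x where "x \<in> chart_dom c" "x \<in> surface_boundary A" "x \<notin> D" "coord c x = complex_of_real t"
    "chart_inv c (complex_of_real t) = x"
proof -
  obtain x where x: "complex_of_real t = coord c x" "x \<in> chart_dom c" "x \<in> surface_boundary A"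
    using t unfolding boundary_img_def by blast
  moreover have "x \<notin> D" using x(3) Dbd by blast
  ultimately show ?thesis using that[of x] inv_coord[OF c x(2)] by simp
qed

text \<open>A chart around a boundary point cannot have an open image, so it takes values in the half plane and
  the point lies on the real line.\<close>

lemma boundary_point:
  assumes c: "c \<in> A" and x: "x \<in> chart_dom c" "x \<in> surface_boundary A"
  shows "openin (top_of_set {z. 0 \<le> Im z}) (chart_img c)" "Im (coord c x) = 0"
proof -
  have ni: "coord c x \<notin> interior (chart_img c)" using boundary_iff[OF c x(1)] x(2) by blast
  have xi: "coord c x \<in> chart_img c" using x(1) by blast
  have no: "\<not> open (chart_img c)" using ni xi by (metis interior_open)
  then show o: "openin (top_of_set {z. 0 \<le> Im z}) (chart_img c)"
    using hopen_img[OF c] unfolding hopen_def by blast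
  then obtain V where V: "open V" "chart_img c = {z. 0 \<le> Im z} \<inter> V" unfolding openin_open by blast
  have "open ({z. 0 < Im z} \<inter> V)" by (intro open_Int open_Collect_less continuous_intros V(1))
  moreover have "{z. 0 < Im z} \<inter> V \<subseteq> chart_img c" unfolding V(2) by auto
  ultimately have "{z. 0 < Im z} \<inter> V \<subseteq> interior (chart_img c)" by (intro interior_maximal)
  moreover have "0 \<le> Im (coord c x)" "coord c x \<in> V" using xi unfolding V(2) by auto
  ultimately show "Im (coord c x) = 0"
    using ni by (cases "0 < Im (coord c x)") (blast, linarith)
qed

lemma boundary_img_lebesgue: assumes c: "c \<in> A" shows "boundary_img A c \<in> sets lebesgue"
proof (cases "open (chart_img c)")
  case True
  then show ?thesis using boundary_img_open[OF c] by simp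
next
  case False
  then have o: "openin (top_of_set {z. 0 \<le> Im z}) (chart_img c)"
    using hopen_img[OF c] unfolding hopen_def by blast
  then obtain V where V: "open V" "chart_img c = {z. 0 \<le> Im z} \<inter> V" unfolding openin_open by blast
  have "boundary_img A c = complex_of_real -` V"
    unfolding boundary_img_halfplane[OF c o] V(2) by auto
  moreover have "open (complex_of_real -` V)" by (rule open_vimage[OF V(1)]) (intro continuous_intros)
  ultimately show ?thesis by simp
qed

text \<open>A transition map between two boundary charts maps the real line to itself and the upper half
  plane to itself, so that its derivative on the real line is positive.\<close>

lemma transition_deriv_boundary:
  assumes c: "c \<in> A" "c' \<in> A" and x: "x \<in> chart_dom c" "x \<in> chart_dom c'" "x \<in> surface_boundary A"
  shows "Im (transition_deriv c c' x) = 0" "0 < Re (transition_deriv c c' x)"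
proof -
  note bp = boundary_point[OF c(1) x(1,3)]
  obtain W F where W: "open W" "coord c x \<in> W" "F holomorphic_on W"
    "\<And>y. y \<in> chart_dom c \<inter> chart_dom c' \<Longrightarrow> coord c y \<in> W \<Longrightarrow>
      F (coord c y) = coord c' y \<and> transition_deriv c c' y = deriv F (coord c y)"
    by (rule transition[OF c, of x]) (use x that in auto)
  obtain V where V: "open V" "coord c ` (chart_dom c \<inter> chart_dom c') = chart_img c \<inter> V"
    by (rule img_openE[OF c(1) dom_open[OF c(2)]]) (rule that)
  obtain V1 where V1: "open V1" "chart_img c = {z. 0 \<le> Im z} \<inter> V1" using bp(1) unfolding openin_open by blast
  have zin: "coord c x \<in> V" "coord c x \<in> V1" using V(2) V1(2) x by blast+
  define t where "t = Re (coord c x)"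
  have z: "coord c x = complex_of_real t" using bp(2) by (simp add: t_def complex_eq_iff)
  have "open (W \<inter> V \<inter> V1)" "complex_of_real t \<in> W \<inter> V \<inter> V1" using W V V1 zin z by auto
  then obtain e where e: "0 < e" "ball (complex_of_real t) e \<subseteq> W \<inter> V \<inter> V1"
    unfolding open_contains_ball by blast
  have pt: "\<exists>y. y \<in> chart_dom c \<and> y \<in> chart_dom c' \<and> w = coord c y \<and> F w = coord c' y"
    if w: "w \<in> ball (complex_of_real t) e" "0 \<le> Im w" for w
  proof -
    have "w \<in> chart_img c \<inter> V" "w \<in> W" using w e(2) V1(2) by auto
    then have "w \<in> coord c ` (chart_dom c \<inter> chart_dom c')" by (simp only: V(2))
    then obtain y where y: "w = coord c y" "y \<in> chart_dom c \<inter> chart_dom c'" ..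
    have "F (coord c y) = coord c' y" using W(4)[OF y(2)] \<open>w \<in> W\<close> y(1) by simp
    then show ?thesis using y by (intro exI[of _ y]) simp
  qed
  have real0: "Im (F (complex_of_real s)) = 0" if s: "\<bar>s - t\<bar> < e" for s
  proof -
    have "complex_of_real s \<in> ball (complex_of_real t) e"
      using s by (simp add: dist_norm norm_minus_commute flip: of_real_diff)
    from pt[OF this] obtain y where y: "y \<in> chart_dom c" "y \<in> chart_dom c'"
      "complex_of_real s = coord c y" "F (complex_of_real s) = coord c' y" by auto
    have "coord c y \<notin> interior (chart_img c)"
      unfolding y(3)[symmetric] by (rule not_interior_real[OF openin_imp_subset[OF bp(1)]])
    then have "y \<in> surface_boundary A" using boundary_iff[OF c(1) y(1)] by blast
    from boundary_point(2)[OF c(2) y(2) this] show ?thesis unfolding y(4) .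
  qed
  have upper: "0 \<le> Im (F w)" if w: "w \<in> ball (complex_of_real t) e" "0 \<le> Im w" for w
  proof -
    obtain y where y: "y \<in> chart_dom c'" "F w = coord c' y" using pt[OF w] by blast
    have "chart_img c' \<subseteq> {z. 0 \<le> Im z}"
      by (rule openin_imp_subset[OF boundary_point(1)[OF c(2) x(2,3)]])
    then show ?thesis using y by auto
  qed
  let ?d = "deriv F (complex_of_real t)"
  have dF: "(F has_field_derivative ?d) (at (complex_of_real t))"
    by (rule holomorphic_derivI[OF W(3,1)]) (use W(2) z in simp)
  \<comment> \<open>Directional derivatives of \<open>Im F\<close>: along the real line \<open>Im F\<close> vanishes, and in the direction \<open>\<i>\<close> it
    cannot decrease.\<close>
  have line: "((\<lambda>s. Im (F (complex_of_real t + of_real s * v))) has_real_derivative Im (?d * v)) (at 0)" for v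
  proof -
    have "((\<lambda>s::real. complex_of_real t + of_real s * v) has_vector_derivative v) (at 0)"
      by (auto intro!: derivative_eq_intros)
    from field_vector_diff_chain_at[OF this, of F ?d] dF
    have "((\<lambda>s. F (complex_of_real t + of_real s * v)) has_vector_derivative v * ?d) (at 0)"
      by (simp add: o_def)
    from bounded_linear.has_vector_derivative[OF bounded_linear_Im this] show ?thesis
      unfolding has_real_derivative_iff_has_vector_derivative by (simp only: mult.commute[of ?d v])
  qed
  have "Im ?d = 0"
  proof -
    have "Im (F (complex_of_real t + of_real s * 1)) = 0" if s: "s \<in> {-e<..<e}" for s
    proof -
      have "\<bar>t + s - t\<bar> < e" using s by auto
      from real0[OF this] show ?thesis by simp
    qed
    from has_field_derivative_transform_within_open[where g="\<lambda>s. 0" and S="{-e<..<e}", OF line[of 1] _ _ this]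
    have "((\<lambda>s. 0) has_real_derivative Im (?d * 1)) (at 0)" using e(1) by simp
    from DERIV_unique[OF this DERIV_const] show ?thesis by simp
  qed
  moreover have "0 \<le> Re ?d"
  proof (rule ccontr)
    assume "\<not> 0 \<le> Re ?d"
    then have "Im (?d * \<i>) < 0" by simp
    have "\<exists>d>0. \<forall>h>0. h < d \<longrightarrow> Im (F (complex_of_real t + of_real (0 + h) * \<i>)) < Im (F (complex_of_real t + of_real 0 * \<i>))"
      by (rule DERIV_neg_dec_right[OF line \<open>Im (?d * \<i>) < 0\<close>])
    then obtain d where d: "0 < d"
      "\<And>h. 0 < h \<Longrightarrow> h < d \<Longrightarrow> Im (F (complex_of_real t + of_real (0 + h) * \<i>)) < Im (F (complex_of_real t + of_real 0 * \<i>))"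
      by (elim exE conjE) (rule that, assumption, elim allE impE, assumption)
    define h where "h = min d e / 2"
    have h: "0 < h" "h < d" "h < e" using d(1) e(1) by (auto simp: h_def)
    have "Im (F (complex_of_real t + of_real h * \<i>)) < 0" using d(2)[OF h(1,2)] real0[of t] e(1) by simp
    moreover have "0 \<le> Im (F (complex_of_real t + of_real h * \<i>))"
      by (rule upper) (use h in \<open>auto simp: dist_norm norm_mult\<close>)
    ultimately show False by simp
  qed
  moreover have td: "transition_deriv c c' x = ?d" using W(4)[of x] W(2) x z by simp
  moreover have "transition_deriv c c' x \<noteq> 0" by (rule transition_deriv_nonzero[OF c x(1,2)])
  ultimately show "Im (transition_deriv c c' x) = 0" "0 < Re (transition_deriv c c' x)"
    by (auto simp: complex_eq_iff)
qed

sublocale boundary: chart_integral X A D 0 1 boundary_integrable boundary_integral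
proof
  fix c :: "'a chart" and n and f :: "nat \<Rightarrow> 'a form" assume c: "c \<in> A" and f: "\<And>i. i < n \<Longrightarrow> boundary_integrable c (f i)"
  show "boundary_integrable c (\<lambda>c x. \<Sum>i<n. f i c x)"
    unfolding boundary_integrable_def
    by (rule absolutely_integrable_sum) (use f in \<open>auto simp: boundary_integrable_def\<close>)
  show "boundary_integral c (\<lambda>c x. \<Sum>i<n. f i c x) = (\<Sum>i<n. boundary_integral c (f i))"
    unfolding boundary_integral_def
    by (rule integral_sum) (use f in \<open>auto simp: boundary_integrable_def intro: set_lebesgue_integral_eq_integral(1)\<close>)
next
  fix c and \<omega> \<omega>' :: "'a form" assume c: "c \<in> A" and eq: "\<And>x. x \<in> chart_dom c - D \<Longrightarrow> \<omega> c x = \<omega>' c x"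
    and ig: "boundary_integrable c \<omega>"
  have *: "\<omega>' c (chart_inv c (complex_of_real t)) = \<omega> c (chart_inv c (complex_of_real t))" if t: "t \<in> boundary_img A c" for t
  proof -
    obtain x where "x \<in> chart_dom c" "x \<notin> D" "chart_inv c (complex_of_real t) = x"
      by (rule boundary_imgE[OF c t])
    then show ?thesis using eq[of x] by simp
  qed
  show "boundary_integrable c \<omega>' \<and> boundary_integral c \<omega>' = boundary_integral c \<omega>"
    unfolding boundary_integrable_def boundary_integral_def
  proof
    show "(\<lambda>t. \<omega>' c (chart_inv c (complex_of_real t))) absolutely_integrable_on boundary_img A c"
      by (rule absolutely_integrable_spike[OF ig[unfolded boundary_integrable_def] negligible_empty]) (use * in simp)
    show "integral (boundary_img A c) (\<lambda>t. \<omega>' c (chart_inv c (complex_of_real t))) =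
        integral (boundary_img A c) (\<lambda>t. \<omega> c (chart_inv c (complex_of_real t)))"
      by (rule integral_cong) (rule *)
  qed
next
  fix c r and \<omega> :: "'a form" assume c: "c \<in> A" and ig: "boundary_integrable c \<omega>" and r: "weight r"
  note m = boundary_img_lebesgue[OF c]
  have im: "complex_of_real t \<in> chart_img c" if "t \<in> boundary_img A c" for t
    using that unfolding boundary_img_def by blast
  have "(\<lambda>t. r (chart_inv c (complex_of_real t)) *\<^sub>R \<omega> c (chart_inv c (complex_of_real t))) absolutely_integrable_on boundary_img A c"
  proof (rule absolutely_integrable_bounded_measurable_product[OF
        bilinear_conv_bounded_bilinear[THEN iffD2, OF bounded_bilinear_scaleR] _ m _ ig[unfolded boundary_integrable_def]])
    have "continuous_on (boundary_img A c) (\<lambda>t. r (chart_inv c (complex_of_real t)))"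
      by (rule continuous_on_compose2[OF smooth_fun_bounded_measurable(1)[OF r c]])
        (use im in \<open>auto intro!: continuous_intros\<close>)
    then show "(\<lambda>t. r (chart_inv c (complex_of_real t))) \<in> borel_measurable (lebesgue_on (boundary_img A c))"
      by (rule continuous_imp_measurable_on_sets_lebesgue[OF _ m])
    show "bounded ((\<lambda>t. r (chart_inv c (complex_of_real t))) ` boundary_img A c)"
      unfolding bounded_iff
      by (rule exI[of _ 1]) (use smooth_fun_bounded_measurable(2)[OF r c im] in auto)
  qed
  then show "boundary_integrable c (weighted r \<omega>)"
    unfolding boundary_integrable_def weighted_def by (simp add: scaleR_conv_of_real)
next
  fix c c' and \<omega> :: "'a form" assume c: "c \<in> A" "c' \<in> A" and law: "form_law 0 1 \<omega>"
    and v: "vanishes_off (chart_dom c \<inter> chart_dom c') \<omega>" and ig: "boundary_integrable c \<omega>"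
  let ?U = "chart_dom c \<inter> chart_dom c'"
  let ?B = "\<lambda>k. {t. complex_of_real t \<in> coord k ` (?U \<inter> surface_boundary A)}"
  let ?F = "\<lambda>k t. \<omega> k (chart_inv k (complex_of_real t))"
  let ?g = "\<lambda>t. Re (coord c' (chart_inv c (complex_of_real t)))"
    and ?g' = "\<lambda>t. Re (transition_deriv c c' (chart_inv c (complex_of_real t)))"
  have spike: "{t \<in> boundary_img A k - ?B k. ?F k t \<noteq> 0} = {}" "{t \<in> ?B k - boundary_img A k. ?F k t \<noteq> 0} = {}"
    if k: "k \<in> {c, c'}" for k
  proof -
    have kA: "k \<in> A" using k c by blast
    have "?F k t = 0" if t: "t \<in> boundary_img A k" "t \<notin> ?B k" for t
    proof -
      obtain x where x: "x \<in> chart_dom k" "x \<in> surface_boundary A" "x \<notin> D" "coord k x = complex_of_real t"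
        "chart_inv k (complex_of_real t) = x" by (rule boundary_imgE[OF kA t(1)]) (rule that)
      have "complex_of_real t \<notin> coord k ` (?U \<inter> surface_boundary A)" using t(2) by simp
      then have "x \<notin> ?U" using x(2) unfolding x(4)[symmetric] by blast
      then show ?thesis using v kA x(1,3) unfolding vanishes_off_def x(5) by blast
    qed
    then show "{t \<in> boundary_img A k - ?B k. ?F k t \<noteq> 0} = {}" by blast
    show "{t \<in> ?B k - boundary_img A k. ?F k t \<noteq> 0} = {}" using k unfolding boundary_img_def by blast
  qed
  have sub: "(?F k absolutely_integrable_on boundary_img A k \<longleftrightarrow> ?F k absolutely_integrable_on ?B k) \<and>
      integral (boundary_img A k) (?F k) = integral (?B k) (?F k)" if k: "k \<in> {c, c'}" for k
    by (rule conjI[OF absolutely_integrable_spike_set_eq integral_spike_set];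
        simp only: spike[OF k] negligible_empty)
  have pt: "\<exists>x. x \<in> chart_dom c \<and> x \<in> chart_dom c' \<and> x \<in> surface_boundary A \<and> x \<notin> D \<and> coord c x = complex_of_real t \<and>
      chart_inv c (complex_of_real t) = x \<and> coord c' x = complex_of_real (?g t)" if t: "t \<in> ?B c" for t
  proof -
    obtain x where x: "complex_of_real t = coord c x" "x \<in> chart_dom c" "x \<in> chart_dom c'" "x \<in> surface_boundary A"
      using t by blast
    have "Im (coord c' x) = 0" by (rule boundary_point(2)[OF c(2) x(3,4)])
    then have "coord c' x = complex_of_real (?g t)" unfolding x(1) inv_coord[OF c(1) x(2)] by (simp add: complex_eq_iff)
    then show ?thesis using x inv_coord[OF c(1) x(2)] Dbd by (intro exI[of _ x]) auto
  qed
  have S: "?B c \<in> sets lebesgue"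
  proof -
    have "(chart_dom c \<inter> chart_dom c', coord c) \<in> A" by (rule restrict_chart[OF c(1) dom_open[OF c(2)]])
    from boundary_img_lebesgue[OF this] show ?thesis unfolding boundary_img_def by simp
  qed
  have gS: "?g ` ?B c = ?B c'"
  proof (intro set_eqI iffI)
    fix s assume "s \<in> ?g ` ?B c"
    then obtain t where t: "t \<in> ?B c" "s = ?g t" by blast
    from pt[OF t(1)] show "s \<in> ?B c'" unfolding t(2) by (metis (mono_tags, lifting) IntI image_eqI mem_Collect_eq)
  next
    fix s assume "s \<in> ?B c'"
    then obtain x where x: "complex_of_real s = coord c' x" "x \<in> chart_dom c" "x \<in> chart_dom c'" "x \<in> surface_boundary A"
      by blast
    have "Im (coord c x) = 0" by (rule boundary_point(2)[OF c(1) x(2,4)])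
    then have r: "complex_of_real (Re (coord c x)) = coord c x" by (simp add: complex_eq_iff)
    then have "Re (coord c x) \<in> ?B c" using x by auto
    moreover have "s = ?g (Re (coord c x))" unfolding r inv_coord[OF c(1) x(2)] x(1)[symmetric] by simp
    ultimately show "s \<in> ?g ` ?B c" by blast
  qed
  have inj: "inj_on ?g (?B c)"
  proof (rule inj_onI)
    fix s t assume s: "s \<in> ?B c" and t: "t \<in> ?B c" and eq: "?g s = ?g t"
    obtain x where x: "x \<in> chart_dom c'" "coord c x = complex_of_real s" "coord c' x = complex_of_real (?g s)"
      using pt[OF s] by blast
    obtain y where y: "y \<in> chart_dom c'" "coord c y = complex_of_real t" "coord c' y = complex_of_real (?g t)"
      using pt[OF t] by blast
    have "coord c' x = coord c' y" using x(3) y(3) eq by simp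
    then have "x = y" by (rule inj_onD[OF coord_inj[OF c(2)] _ x(1) y(1)])
    then show "s = t" using x(2) y(2) by simp
  qed
  have der: "(?g has_field_derivative ?g' t) (at t within ?B c)" if t: "t \<in> ?B c" for t
  proof -
    obtain x where x: "x \<in> chart_dom c" "x \<in> chart_dom c'" "coord c x = complex_of_real t"
      "chart_inv c (complex_of_real t) = x" using pt[OF t] by blast
    have "((\<lambda>z. coord c' (chart_inv c z)) has_field_derivative transition_deriv c c' x)
        (at (complex_of_real t) within complex_of_real ` ?B c)"
      by (rule has_field_derivative_subset[OF transition_field_derivative[OF c x(1,2), unfolded x(3)]]) auto
    then have 1: "((\<lambda>z. coord c' (chart_inv c z)) has_derivative (*) (transition_deriv c c' x))
        (at (complex_of_real t) within complex_of_real ` ?B c)"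
      unfolding has_field_derivative_def .
    have "(complex_of_real has_derivative complex_of_real) (at t within ?B c)"
      by (rule bounded_linear_imp_has_derivative[OF bounded_linear_of_real])
    from has_derivative_in_compose[OF this 1]
    have "((\<lambda>s. coord c' (chart_inv c (complex_of_real s))) has_vector_derivative transition_deriv c c' x) (at t within ?B c)"
      unfolding has_vector_derivative_def by (simp add: scaleR_conv_of_real mult.commute)
    from bounded_linear.has_vector_derivative[OF bounded_linear_Re this] show ?thesis
      by (simp add: has_real_derivative_iff_has_vector_derivative x(4))
  qed
  have F: "\<bar>?g' t\<bar> *\<^sub>R ?F c' (?g t) = ?F c t" if t: "t \<in> ?B c" for t
  proof -
    obtain x where x: "x \<in> chart_dom c" "x \<in> chart_dom c'" "x \<in> surface_boundary A" "x \<notin> D" "coord c x = complex_of_real t"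
      "chart_inv c (complex_of_real t) = x" "coord c' x = complex_of_real (?g t)" using pt[OF t] by blast
    note p = transition_deriv_boundary[OF c x(1-3)]
    have "cnj (transition_deriv c c' x) = complex_of_real \<bar>Re (transition_deriv c c' x)\<bar>"
      using p by (simp add: complex_eq_iff)
    moreover have "\<omega> c x = \<omega> c' x * cnj (transition_deriv c c' x)"
      using form_lawD[OF law c, of x] x by simp
    moreover have "chart_inv c' (complex_of_real (?g t)) = x" unfolding x(7)[symmetric] by (rule inv_coord[OF c(2) x(2)])
    ultimately show ?thesis using x(6) by (simp add: scaleR_conv_of_real mult.commute)
  qed
  have "?F c absolutely_integrable_on ?B c \<and> integral (?B c) (?F c) = boundary_integral c \<omega>"
    using sub[of c] ig by (simp add: boundary_integrable_def boundary_integral_def)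
  then have "(\<lambda>t. \<bar>?g' t\<bar> *\<^sub>R ?F c' (?g t)) absolutely_integrable_on ?B c \<and>
      integral (?B c) (\<lambda>t. \<bar>?g' t\<bar> *\<^sub>R ?F c' (?g t)) = boundary_integral c \<omega>"
    using absolutely_integrable_spike_eq[OF negligible_empty, of "?B c" "\<lambda>t. \<bar>?g' t\<bar> *\<^sub>R ?F c' (?g t)" "?F c"]
      integral_cong[of "?B c" "\<lambda>t. \<bar>?g' t\<bar> *\<^sub>R ?F c' (?g t)" "?F c"] F by auto
  from iffD1[OF has_absolute_integral_change_of_variables_real[where f="?F c'", OF S der inj] this]
  have "?F c' absolutely_integrable_on ?B c' \<and> integral (?B c') (?F c') = boundary_integral c \<omega>"
    unfolding gS .
  then show "boundary_integrable c' \<omega> \<and> boundary_integral c' \<omega> = boundary_integral c \<omega>"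
    using sub[of c'] by (simp add: boundary_integrable_def boundary_integral_def)
qed

end

section \<open>Stokes' theorem for forms with logarithmic derivative\<close>

context marked_surface
begin

lemma has_pole_cong:
  assumes c: "c \<in> A" and a: "a \<in> D" "a \<in> chart_dom c" "coord c a = 0" and U: "openin X U" "a \<in> U"
    and eq: "\<And>x. x \<in> chart_dom c \<Longrightarrow> x \<in> U \<Longrightarrow> x \<notin> D \<Longrightarrow> \<omega>' c x = \<omega> c x"
    and pole: "has_pole c N \<omega>"
  shows "has_pole c N \<omega>'"
proof -
  obtain r g where g: "0 < r" "ball 0 r \<subseteq> chart_img c" "smooth_on g (ball 0 r)"
    "\<And>z. z \<in> ball 0 r \<Longrightarrow> z \<noteq> 0 \<Longrightarrow> \<omega> c (chart_inv c z) = g z / z ^ N"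
    by (rule has_poleE[OF pole]) (rule that)
  have abd: "a \<notin> surface_boundary A" using a(1) Dbd by blast
  let ?U = "U \<inter> (topspace X - (D - {a}))"
  have oU: "openin X ?U" by (intro openin_Int U(1) openin_minus_D)
  have aU: "a \<in> ?U" using U(2) a(1) DX by blast
  obtain s where s: "0 < s" "ball 0 s \<subseteq> coord c ` (chart_dom c \<inter> ?U)"
    by (rule nbhd_ball[OF c a(2,3) abd oU aU]) (rule that)
  show ?thesis
  proof (rule has_poleI[of "min r s" _ g])
    show "0 < min r s" using g(1) s(1) by simp
    show "ball 0 (min r s) \<subseteq> chart_img c" by (rule order_trans[OF _ g(2)]) auto
    show "smooth_on g (ball 0 (min r s))" by (rule smooth_on_subset[OF g(3)]) auto
    fix z :: complex assume z: "z \<in> ball 0 (min r s)" "z \<noteq> 0"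
    have "z \<in> ball 0 s" using z(1) by simp
    then obtain x where x: "x \<in> chart_dom c" "x \<in> ?U" "z = coord c x" using s(2) by blast
    have "x \<noteq> a" using z(2) x(3) a(3) by blast
    then have "x \<notin> D" using x(2) by blast
    then have "\<omega>' c x = \<omega> c x" using eq[OF x(1)] x(2) by blast
    then show "\<omega>' c (chart_inv c z) = g z / z ^ N"
      using g(4)[of z] z unfolding x(3) inv_coord[OF c x(1)] by simp
  qed
qed

lemma has_pole_1_bound:
  assumes "has_pole c 1 \<omega>"
  obtains s C where "0 < s" "ball 0 s \<subseteq> chart_img c"
    "\<And>z. z \<noteq> 0 \<Longrightarrow> norm z < s \<Longrightarrow> norm (\<omega> c (chart_inv c z)) \<le> C / norm z"
proof -
  obtain r g where g: "0 < r" "ball 0 r \<subseteq> chart_img c" "smooth_on g (ball 0 r)"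
    "\<And>z. z \<in> ball 0 r \<Longrightarrow> z \<noteq> 0 \<Longrightarrow> \<omega> c (chart_inv c z) = g z / z ^ 1"
    by (rule has_poleE[OF assms]) (rule that)
  have sub: "cball 0 (r / 2) \<subseteq> ball (0::complex) r" using g(1) by auto
  have "continuous_on (cball 0 (r / 2)) g"
    by (rule continuous_on_subset[OF smooth_on_imp_continuous_on[OF g(3)] sub])
  from compact_imp_bounded[OF compact_continuous_image[OF this compact_cball]]
  obtain B where B: "\<forall>y\<in>g ` cball 0 (r / 2). norm y \<le> B" unfolding bounded_iff by blast
  show ?thesis
  proof (rule that[of "r / 2" B])
    show "ball 0 (r / 2) \<subseteq> chart_img c" using sub g(2) by (auto simp: subset_eq)
    fix z :: complex assume z: "z \<noteq> 0" "norm z < r / 2"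
    have "norm (g z) \<le> B" using B z(2) by simp
    moreover have "\<omega> c (chart_inv c z) = g z / z" using g(1) g(4)[of z] z by simp
    ultimately show "norm (\<omega> c (chart_inv c z)) \<le> B / norm z"
      by (simp add: norm_divide divide_right_mono)
  qed (use g(1) in simp)
qed

lemma del_cong:
  assumes b: "\<beta> \<in> smooth_forms A 0 1 D" "\<beta>' \<in> smooth_forms A 0 1 D" and c: "c \<in> A" and U: "openin X U"
    and eq: "\<And>y. y \<in> chart_dom c \<Longrightarrow> y \<in> U \<Longrightarrow> y \<notin> D \<Longrightarrow> \<beta> c y = \<beta>' c y"
    and x: "x \<in> chart_dom c" "x \<in> U" "x \<notin> D"
  shows "del D \<beta> c x = del D \<beta>' c x"
proof -
  let ?S = "coord c ` (chart_dom c - D)"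
  obtain V where V: "open V" "coord c ` (chart_dom c \<inter> U) = chart_img c \<inter> V"
    by (rule img_openE[OF c U]) (rule that)
  have xS: "coord c x \<in> ?S" using x by blast
  have xV: "coord c x \<in> V" using V(2) x by blast
  have "del D \<beta> c (chart_inv c (coord c x)) = wirtinger (\<lambda>z. \<beta>' c (chart_inv c z)) (coord c x) ?S"
  proof (rule del_eqI[OF b(1) c xS thick_minus[OF c] xS V(1) xV])
    fix w assume w: "w \<in> ?S" "w \<in> V"
    then obtain y where y: "y \<in> chart_dom c" "y \<notin> D" "w = coord c y" by blast
    have "w \<in> coord c ` (chart_dom c \<inter> U)" unfolding V(2) using y w(2) by blast
    then have "y \<in> U" using y coord_inj[OF c] by (auto simp: inj_on_def)
    then show "\<beta>' c (chart_inv c w) = \<beta> c (chart_inv c w)"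
      using eq[OF y(1) _ y(2)] unfolding y(3) inv_coord[OF c y(1)] by simp
  qed blast
  then show ?thesis unfolding del_inv[OF xS, symmetric] inv_coord[OF c x(1)] .
qed

abbreviation support :: "('a \<Rightarrow> real) \<Rightarrow> 'a set" where
  "support r \<equiv> X closure_of {x \<in> topspace X. r x \<noteq> 0}"

lemma off_support: "x \<in> topspace X \<Longrightarrow> x \<notin> support r \<Longrightarrow> r x = 0"
  using closure_of_subset[of "{x \<in> topspace X. r x \<noteq> 0}" X] by blast

lemma vanishes_off_weighted: "vanishes_off (support r) (weighted r \<omega>)"
  unfolding vanishes_off_def weighted_def
proof (intro ballI impI)
  fix k x assume k: "k \<in> A" and x: "x \<in> chart_dom k - D" "x \<notin> support r"
  have "x \<in> topspace X" using dom_subset[OF k] x(1) by blast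
  from off_support[OF this x(2)] show "of_real (r x) * \<omega> k x = 0" by simp
qed

lemma weighted_smooth: "weight r \<Longrightarrow> \<omega> \<in> smooth_forms A p q D \<Longrightarrow> weighted r \<omega> \<in> smooth_forms A p q D"
  unfolding weighted_def weight_def using smooth_forms_scale by blast

text \<open>Outside the closed support, \<open>r \<beta>\<close> agrees with the zero form on an open set, and \<open>\<partial>\<close> is local.\<close>

lemma vanishes_off_del_weighted:
  assumes r: "weight r" and b: "\<beta> \<in> smooth_forms A 0 1 D"
  shows "vanishes_off (support r) (del D (weighted r \<beta>))"
  unfolding vanishes_off_def
proof (intro ballI impI)
  fix k x assume k: "k \<in> A" and x: "x \<in> chart_dom k - D" "x \<notin> support r"
  have z: "(\<lambda>c x. 0) \<in> smooth_forms A 0 1 D" by (rule smooth_formsI) auto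
  have o: "openin X (topspace X - support r)" by (simp add: openin_diff closedin_closure_of)
  have "del D (weighted r \<beta>) k x = del D (\<lambda>c x. 0) k x"
  proof (rule del_cong[OF weighted_smooth[OF r b] z k o])
    show "weighted r \<beta> k y = 0" if "y \<in> topspace X - support r" for y
      using off_support[of y r] that by (simp add: weighted_def)
  qed (use x dom_subset[OF k] in auto)
  also have "\<dots> = 0" unfolding del_def by (rule wirtinger_const[OF thick_minus[OF k]]) (use x in auto)
  finally show "del D (weighted r \<beta>) k x = 0" .
qed

text \<open>The pairs of chart and weight that occur in \<open>adapted_partition\<close>.\<close>

definition adapted_weight :: "'a chart \<Rightarrow> ('a \<Rightarrow> real) \<Rightarrow> bool" where
  "adapted_weight c r \<longleftrightarrow> c \<in> A \<and> weight r \<and> support r \<subseteq> chart_dom c \<and>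
    (chart_dom c \<inter> D = {} \<or> (\<exists>a\<in>D. chart_dom c \<inter> D = {a} \<and> coord c a = 0 \<and> open (chart_img c) \<and>
        (\<exists>N. openin X N \<and> a \<in> N \<and> (\<forall>y\<in>N. r y = 1))))"

lemma adapted_weightD:
  assumes "adapted_weight c r"
  shows "c \<in> A" "weight r" "support r \<subseteq> chart_dom c"
  using assms unfolding adapted_weight_def by auto

lemma adapted_weight_cases:
  assumes "adapted_weight c r"
  obtains "chart_dom c \<inter> D = {}"
  | a N where "a \<in> D" "a \<in> chart_dom c" "chart_dom c \<inter> D = {a}" "coord c a = 0" "open (chart_img c)"
    "openin X N" "a \<in> N" "\<And>y. y \<in> N \<Longrightarrow> r y = 1"
  using assms unfolding adapted_weight_def by blast

lemma adapted_weight_centre: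
  assumes "adapted_weight c r" "a \<in> D" "a \<in> chart_dom c" shows "coord c a = 0"
proof (rule adapted_weight_cases[OF assms(1)])
  assume "chart_dom c \<inter> D = {}"
  then show ?thesis using assms(2,3) by blast
next
  fix b N assume b: "chart_dom c \<inter> D = {b}" "coord c b = 0"
  have "a = b" using assms(2,3) b(1) by blast
  then show ?thesis using b(2) by simp
qed

lemma marked_img:
  assumes c: "c \<in> A" and a: "a \<in> chart_dom c" "chart_dom c \<inter> D = {a}" "coord c a = 0"
  shows "coord c ` (chart_dom c - D) = chart_img c - {0}"
proof -
  have "chart_dom c - D = chart_dom c - {a}" using a(2) by blast
  then show ?thesis using inj_on_image_set_diff[OF coord_inj[OF c], of "chart_dom c" "{a}"] a by auto
qed

text \<open>The weight is one near \<open>a\<close>, so it leaves the germs of \<open>\<omega>\<close> and \<open>\<partial>\<beta>\<close> at \<open>a\<close> unchanged.\<close>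

lemma weighted_near_pole:
  assumes w: "adapted_weight c r" and a: "a \<in> D" "a \<in> chart_dom c"
  shows "has_pole c N \<omega> \<Longrightarrow> has_pole c N (weighted r \<omega>)"
    and "\<beta> \<in> smooth_forms A 0 1 D \<Longrightarrow> has_pole c N (del D \<beta>) \<Longrightarrow> has_pole c N (del D (weighted r \<beta>))"
proof -
  note c = adapted_weightD[OF w]
  obtain M where M: "coord c a = 0" "openin X M" "a \<in> M" "\<And>y. y \<in> M \<Longrightarrow> r y = 1"
  proof (rule adapted_weight_cases[OF w])
    assume "chart_dom c \<inter> D = {}"
    then show ?thesis using a by blast
  next
    fix b N assume b: "chart_dom c \<inter> D = {b}" "coord c b = 0" "openin X N" "b \<in> N" "\<And>y. y \<in> N \<Longrightarrow> r y = 1"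
    have "a = b" using a b(1) by blast
    then show ?thesis using that[of N] b by simp
  qed
  show "has_pole c N (weighted r \<omega>)" if "has_pole c N \<omega>"
    by (rule has_pole_cong[OF c(1) a M(1-3) _ that]) (simp add: weighted_def M(4))
  show "has_pole c N (del D (weighted r \<beta>))" if b: "\<beta> \<in> smooth_forms A 0 1 D" and p: "has_pole c N (del D \<beta>)"
  proof (rule has_pole_cong[OF c(1) a M(1-3) _ p])
    show "del D (weighted r \<beta>) c x = del D \<beta> c x" if "x \<in> chart_dom c" "x \<in> M" "x \<notin> D" for x
      by (rule del_cong[OF weighted_smooth[OF c(2) b] b c(1) M(2) _ that]) (simp add: weighted_def M(4))
  qed
qed

end

context compact_marked_surface
begin

lemma support_coord:
  assumes w: "adapted_weight c r"
  shows "compact (coord c ` support r)" "coord c ` support r \<subseteq> chart_img c"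
    and "vanishes_off (support r) \<eta> \<Longrightarrow> z \<in> coord c ` (chart_dom c - D) \<Longrightarrow> z \<notin> coord c ` support r \<Longrightarrow>
      \<eta> c (chart_inv c z) = 0"
proof -
  note c = adapted_weightD[OF w]
  show "compact (coord c ` support r)"
    by (rule compact_coord_image[OF c(1) closedin_compact_space[OF compact_X closedin_closure_of] c(3)])
  show "coord c ` support r \<subseteq> chart_img c" using c(3) by blast
  assume v: "vanishes_off (support r) \<eta>" and z: "z \<in> coord c ` (chart_dom c - D)" "z \<notin> coord c ` support r"
  obtain x where x: "x \<in> chart_dom c - D" "z = coord c x" using z(1) by blast
  then have "x \<notin> support r" using z(2) by blast
  then have "\<eta> c x = 0" using v c(1) x(1) unfolding vanishes_off_def by blast
  then show "\<eta> c (chart_inv c z) = 0" using x inv_coord[OF c(1)] by simp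
qed

text \<open>A simple pole is integrable in the plane, so a logarithmic form with support in a chart is integrable.\<close>

lemma surface_integrable_supported:
  assumes w: "adapted_weight c r" and \<eta>: "\<eta> \<in> smooth_forms A 1 1 D" and v: "vanishes_off (support r) \<eta>"
    and pole: "\<And>a. a \<in> D \<Longrightarrow> a \<in> chart_dom c \<Longrightarrow> has_pole c 1 \<eta>"
  shows "surface_integrable c \<eta>"
proof -
  note c = adapted_weightD[OF w]
  note K = support_coord[OF w]
  let ?f = "\<lambda>z. \<eta> c (chart_inv c z) * (- 2 * \<i>)"
  have cont: "continuous_on (coord c ` (chart_dom c - D)) ?f"
    by (intro continuous_intros smooth_on_imp_continuous_on smooth_formsD(1)[OF \<eta> c(1)])
  show ?thesis
    unfolding surface_integrable_def
  proof (rule adapted_weight_cases[OF w])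
    assume "chart_dom c \<inter> D = {}"
    then have e: "chart_dom c - D = chart_dom c" by blast
    show "?f absolutely_integrable_on chart_img c"
    proof (rule absolutely_integrable_compact_support(1)[OF K(1,2)])
      show "continuous_on (coord c ` support r) ?f" by (rule continuous_on_subset[OF cont[unfolded e] K(2)])
      show "?f z = 0" if "z \<in> chart_img c - coord c ` support r" for z using K(3)[OF v, unfolded e, of z] that by simp
    qed
  next
    fix a assume a: "a \<in> D" "a \<in> chart_dom c" "chart_dom c \<inter> D = {a}" "coord c a = 0"
    note m = marked_img[OF c(1) a(2-4)]
    obtain s C where s: "0 < s" "ball 0 s \<subseteq> chart_img c"
      "\<And>z. z \<noteq> 0 \<Longrightarrow> norm z < s \<Longrightarrow> norm (\<eta> c (chart_inv c z)) \<le> C / norm z"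
      by (rule has_pole_1_bound[OF pole[OF a(1,2)]]) (rule that)
    show "?f absolutely_integrable_on chart_img c"
    proof (rule log_singular_integrable[OF K(1) _ _ _ s(1), where C="C * 2"])
      show "coord c ` support r - {0} \<subseteq> chart_img c" using K(2) by blast
      show "continuous_on (coord c ` support r - {0}) ?f"
        by (rule continuous_on_subset[OF cont[unfolded m]]) (use K(2) in blast)
      show "?f z = 0" if "z \<in> chart_img c - coord c ` support r" "z \<noteq> 0" for z
        using K(3)[OF v, unfolded m, of z] that by simp
      show "norm (?f z) \<le> C * 2 / norm z" if "z \<noteq> 0" "norm z < s" for z
        using mult_right_mono[OF s(3)[OF that], of 2] by (simp add: norm_mult)
    qed
  qed
qed

text \<open>Charts that meet \<open>D\<close> have open images and see no boundary; in the others the integrand is continuous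
  with compact support.\<close>

lemma boundary_integrable_weighted:
  assumes w: "adapted_weight c r" and \<beta>: "\<beta> \<in> smooth_forms A 0 1 D"
  shows "boundary_integrable c (weighted r \<beta>)"
proof -
  note c = adapted_weightD[OF w]
  note K = support_coord[OF w]
  show ?thesis
  proof (cases "open (chart_img c)")
    case True
    then show ?thesis unfolding boundary_integrable_def boundary_img_open[OF c(1) True] by simp
  next
    case False
    then have o: "openin (top_of_set {z. 0 \<le> Im z}) (chart_img c)"
      using hopen_img[OF c(1)] unfolding hopen_def by blast
    have e: "chart_dom c - D = chart_dom c"
      by (rule adapted_weight_cases[OF w]) (use False in blast)+
    let ?f = "\<lambda>z. weighted r \<beta> c (chart_inv c z)"
    let ?K = "{t. complex_of_real t \<in> coord c ` support r}"
    have cont: "continuous_on (chart_img c) ?f"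
      using smooth_on_imp_continuous_on[OF smooth_formsD(1)[OF weighted_smooth[OF c(2) \<beta>] c(1)]] unfolding e .
    show ?thesis
      unfolding boundary_integrable_def boundary_img_halfplane[OF c(1) o]
    proof (rule absolutely_integrable_compact_support(1)[of ?K])
      have "closed ?K"
        unfolding vimage_def[symmetric]
        by (rule closed_vimage[OF compact_imp_closed[OF K(1)]]) (intro continuous_intros)
      moreover have "bounded ?K"
      proof -
        obtain R where "\<forall>y\<in>coord c ` support r. norm y \<le> R"
          using compact_imp_bounded[OF K(1)] unfolding bounded_iff by blast
        then have "norm t \<le> R" if "t \<in> ?K" for t
          using bspec[of "coord c ` support r" "\<lambda>y. norm y \<le> R" "complex_of_real t"] that by simp
        then show ?thesis unfolding bounded_iff by blast
      qed
      ultimately show "compact ?K" unfolding compact_eq_bounded_closed by (intro conjI)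
      show sub: "?K \<subseteq> {t. complex_of_real t \<in> chart_img c}" using K(2) by blast
      show "continuous_on ?K (\<lambda>t. ?f (complex_of_real t))"
        by (rule continuous_on_compose2[OF cont]) (use K(2) in \<open>auto intro!: continuous_intros\<close>)
      show "?f (complex_of_real t) = 0" if "t \<in> {t. complex_of_real t \<in> chart_img c} - ?K" for t
        using K(3)[OF vanishes_off_weighted, unfolded e, of "complex_of_real t"] that by blast
    qed
  qed
qed

text \<open>Stokes in one chart. In a chart around a marked point, the pole of \<open>\<gamma>\<close> does not contribute,
  whatever its order, because the pole of \<open>\<partial>\<gamma>\<close> has order one.\<close>

lemma chart_stokes:
  assumes w: "adapted_weight c r" and \<gamma>: "\<gamma> \<in> smooth_forms A 0 1 D"
    and pole: "\<And>a. a \<in> D \<Longrightarrow> a \<in> chart_dom c \<Longrightarrow> \<exists>N. has_pole c N \<gamma>"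
    and log: "\<And>a. a \<in> D \<Longrightarrow> a \<in> chart_dom c \<Longrightarrow> has_pole c 1 (del D \<gamma>)"
  shows "surface_integral c (del D (weighted r \<gamma>)) = boundary_integral c (weighted r \<gamma>)"
proof -
  note c = adapted_weightD[OF w]
  note K = support_coord[OF w]
  note Kc = compact_imp_closed[OF K(1)]
  let ?f = "\<lambda>z. weighted r \<gamma> c (chart_inv c z)" and ?K = "coord c ` support r"
  let ?T = "coord c ` (chart_dom c - D)"
  have sm: "smooth_on ?f ?T" by (rule smooth_formsD(1)[OF weighted_smooth[OF c(2) \<gamma>] c(1)])
  have 0: "?f z = 0" if "z \<in> ?T - ?K" for z using K(3)[OF vanishes_off_weighted] that by blast
  have it: "surface_integral c (del D (weighted r \<gamma>)) = integral ?T (\<lambda>z. wirtinger ?f z ?T * (- 2 * \<i>))"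
  proof -
    have n: "negligible (coord c ` D)" using finD by (simp add: negligible_finite)
    have "negligible {z \<in> chart_img c - ?T. h z \<noteq> 0}" "negligible {z \<in> ?T - chart_img c. h z \<noteq> 0}" for h :: "complex \<Rightarrow> complex"
      by (rule negligible_subset[OF n], blast)+
    from integral_spike_set[OF this]
    have "surface_integral c (del D (weighted r \<gamma>)) = integral ?T (\<lambda>z. del D (weighted r \<gamma>) c (chart_inv c z) * (- 2 * \<i>))"
      unfolding surface_integral_def .
    also have "\<dots> = integral ?T (\<lambda>z. wirtinger ?f z ?T * (- 2 * \<i>))"
      by (rule integral_cong) (simp only: del_inv)
    finally show ?thesis .
  qed
  show ?thesis
  proof (rule adapted_weight_cases[OF w])
    assume "chart_dom c \<inter> D = {}"
    then have "chart_dom c - D = chart_dom c" by blast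
    note e = this
    note * = K(1,2) sm[unfolded e] 0[unfolded e]
    show ?thesis
    proof (cases "open (chart_img c)")
      case True
      have "surface_integral c (del D (weighted r \<gamma>)) = 0"
        unfolding it e by (rule compact_support_stokes_open[OF True *])
      then show ?thesis unfolding boundary_integral_def boundary_img_open[OF c(1) True] by simp
    next
      case False
      then have o: "openin (top_of_set {z. 0 \<le> Im z}) (chart_img c)"
        using hopen_img[OF c(1)] unfolding hopen_def by blast
      show ?thesis
        unfolding it e boundary_integral_def boundary_img_halfplane[OF c(1) o]
        by (rule compact_support_stokes_halfplane[OF o *])
    qed
  next
    fix a assume a: "a \<in> D" "a \<in> chart_dom c" "chart_dom c \<inter> D = {a}" "coord c a = 0" and open_img: "open (chart_img c)"
    note T = marked_img[OF c(1) a(2-4)]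
    let ?F = "\<lambda>z. if z \<in> ?T then ?f z else 0" and ?W = "- {0::complex}"
    have oT: "open ?T" unfolding T by (intro open_delete open_img)
    have oW: "open ?W" by (simp add: open_Compl)
    have TW: "?T \<subseteq> ?W" unfolding T by blast
    have KT: "?K \<inter> ?W \<subseteq> ?T" unfolding T using K(2) by blast
    have "openin (top_of_set ?W) ?T" by (rule open_subset[OF TW oT])
    have F: "smooth_on ?F ?W" by (rule smooth_on_extend_zero[OF \<open>openin (top_of_set ?W) ?T\<close> K(1) sm 0 KT])
    have F0: "?F z = 0" if "z \<notin> ?K" for z using 0[of z] that by simp
    have dF: "wirtinger ?F z ?W = wirtinger ?f z ?T" if z: "z \<in> ?T" for z
      by (rule wirtinger_transfer[OF thick_open[OF oW] thick_open[OF oT] z oT z _ _ F, symmetric]) (use TW in auto)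
    obtain N where N: "has_pole c N \<gamma>" using pole[OF a(1,2)] by blast
    obtain s g where g: "0 < s" "ball 0 s \<subseteq> chart_img c" "smooth_on g (ball 0 s)"
      "\<And>z. z \<in> ball 0 s \<Longrightarrow> z \<noteq> 0 \<Longrightarrow> ?f z = g z / z ^ N"
      by (rule has_poleE[OF weighted_near_pole(1)[OF w a(1,2) N]]) (rule that)
    obtain s' C where s': "0 < s'" "ball 0 s' \<subseteq> chart_img c"
      "\<And>z. z \<noteq> 0 \<Longrightarrow> norm z < s' \<Longrightarrow> norm (del D (weighted r \<gamma>) c (chart_inv c z)) \<le> C / norm z"
      by (rule has_pole_1_bound[OF weighted_near_pole(2)[OF w a(1,2) \<gamma> log[OF a(1,2)]]]) (rule that)
    obtain R where R: "\<And>z. z \<in> ?K \<Longrightarrow> norm z \<le> R"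
      using compact_imp_bounded[OF K(1)] unfolding bounded_iff by blast
    have "integral ?W (\<lambda>z. wirtinger ?F z ?W) = 0"
    proof (rule pole_stokes(2)[OF F _ g(1,3) _ s'(1)])
      show "?F z = 0" if "R < norm z" for z using F0[of z] R[of z] that by linarith
      show "?F z = g z / z ^ N" if z: "z \<in> ball 0 s - {0}" for z
      proof -
        have "z \<in> ?T" unfolding T using z g(2) by blast
        then show ?thesis using g(4)[of z] z by simp
      qed
      show "norm (wirtinger ?F z ?W) \<le> C / norm z" if z: "z \<noteq> 0" "norm z < s'" for z
      proof -
        have "z \<in> ball 0 s'" using z(2) by simp
        then have "z \<in> ?T" unfolding T using z(1) s'(2) by blast
        then show ?thesis using s'(3)[OF z] dF del_inv by simp
      qed
    qed
    moreover have "integral ?W (\<lambda>z. wirtinger ?F z ?W) = integral ?T (\<lambda>z. wirtinger ?F z ?W)"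
    proof (rule integral_spike_set)
      have "wirtinger ?F z ?W = 0" if "z \<in> ?W - ?T" for z
        by (rule wirtinger_eq_0_outside[OF thick_open[OF oW] Kc]) (use that KT F0 in auto)
      then have "{z \<in> ?W - ?T. wirtinger ?F z ?W \<noteq> 0} = {}" by blast
      then show "negligible {z \<in> ?W - ?T. wirtinger ?F z ?W \<noteq> 0}" by (simp only: negligible_empty)
      have "{z \<in> ?T - ?W. wirtinger ?F z ?W \<noteq> 0} = {}" using TW by blast
      then show "negligible {z \<in> ?T - ?W. wirtinger ?F z ?W \<noteq> 0}" by (simp only: negligible_empty)
    qed
    moreover have "integral ?T (\<lambda>z. wirtinger ?F z ?W) = integral ?T (\<lambda>z. wirtinger ?f z ?T)"
      by (rule integral_cong) (rule dF)
    ultimately have "integral ?T (\<lambda>z. wirtinger ?f z ?T) = 0" by simp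
    then have "surface_integral c (del D (weighted r \<gamma>)) = 0" unfolding it integral_mult_left by simp
    then show ?thesis unfolding boundary_integral_def boundary_img_open[OF c(1) open_img] by simp
  qed
qed

lemma surface_integral_diff:
  assumes "surface_integrable c \<omega>" "surface_integrable c \<omega>'"
  shows "surface_integral c (\<lambda>c x. \<omega> c x - \<omega>' c x) = surface_integral c \<omega> - surface_integral c \<omega>'"
  using integral_diff[OF set_lebesgue_integral_eq_integral(1)[OF assms(1)[unfolded surface_integrable_def]]
      set_lebesgue_integral_eq_integral(1)[OF assms(2)[unfolded surface_integrable_def]]]
  unfolding surface_integral_def left_diff_distrib .

lemma boundary_integral_diff:
  assumes "boundary_integrable c \<omega>" "boundary_integrable c \<omega>'"
  shows "boundary_integral c (\<lambda>c x. \<omega> c x - \<omega>' c x) = boundary_integral c \<omega> - boundary_integral c \<omega>'"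
  using integral_diff[OF set_lebesgue_integral_eq_integral(1)[OF assms(1)[unfolded boundary_integrable_def]]
      set_lebesgue_integral_eq_integral(1)[OF assms(2)[unfolded boundary_integrable_def]]]
  unfolding boundary_integral_def .

text \<open>The forms \<open>\<rho>\<^sub>i \<partial>\<gamma> - \<partial>(\<rho>\<^sub>i \<gamma>)\<close> add up to zero, and so do their integrals by \<open>it_partition\<close>. This replaces
  the integral of \<open>\<rho>\<^sub>i \<partial>\<gamma>\<close> by that of \<open>\<partial>(\<rho>\<^sub>i \<gamma>)\<close>, to which \<open>chart_stokes\<close> applies.\<close>

lemma stokes:
  assumes P: "partition_of_unity X A n c \<rho>" and w: "\<And>i. i < n \<Longrightarrow> adapted_weight (c i) (\<rho> i)"
    and \<gamma>: "\<gamma> \<in> smooth_forms A 0 1 D"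
    and pole: "\<And>i a. i < n \<Longrightarrow> a \<in> D \<Longrightarrow> a \<in> chart_dom (c i) \<Longrightarrow> \<exists>N. has_pole (c i) N \<gamma>"
    and log: "\<And>i a. i < n \<Longrightarrow> a \<in> D \<Longrightarrow> a \<in> chart_dom (c i) \<Longrightarrow> has_pole (c i) 1 (del D \<gamma>)"
  shows "(\<Sum>i<n. surface_integral (c i) (weighted (\<rho> i) (del D \<gamma>))) = (\<Sum>i<n. boundary_integral (c i) (weighted (\<rho> i) \<gamma>))"
proof -
  note wD = adapted_weightD[OF w]
  note d\<gamma> = del_smooth_forms[OF \<gamma>]
  let ?\<mu> = "\<lambda>i. weighted (\<rho> i) (del D \<gamma>)" and ?\<nu> = "\<lambda>i. del D (weighted (\<rho> i) \<gamma>)"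
  let ?\<eta> = "\<lambda>i c x. ?\<mu> i c x - ?\<nu> i c x"
  have s\<mu>: "?\<mu> i \<in> smooth_forms A 1 1 D" and s\<gamma>: "weighted (\<rho> i) \<gamma> \<in> smooth_forms A 0 1 D" if "i < n" for i
    by (rule weighted_smooth[OF wD(2)[OF that]], fact)+
  have s\<nu>: "?\<nu> i \<in> smooth_forms A 1 1 D" if "i < n" for i by (rule del_smooth_forms[OF s\<gamma>[OF that]])
  have v\<mu>: "vanishes_off (support (\<rho> i)) (?\<mu> i)" for i by (rule vanishes_off_weighted)
  have v\<nu>: "vanishes_off (support (\<rho> i)) (?\<nu> i)" if "i < n" for i
    by (rule vanishes_off_del_weighted[OF wD(2)[OF that] \<gamma>])
  have ig\<mu>: "surface_integrable (c i) (?\<mu> i)" if i: "i < n" for i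
    by (rule surface_integrable_supported[OF w[OF i] s\<mu>[OF i] v\<mu>])
      (rule weighted_near_pole(1)[OF w[OF i] _ _ log[OF i]])
  have ig\<nu>: "surface_integrable (c i) (?\<nu> i)" if i: "i < n" for i
    by (rule surface_integrable_supported[OF w[OF i] s\<nu>[OF i] v\<nu>[OF i]])
      (rule weighted_near_pole(2)[OF w[OF i] _ _ \<gamma> log[OF i]])
  have s\<eta>: "?\<eta> i \<in> smooth_forms A 1 1 D" if "i < n" for i
    by (rule smooth_forms_diff[OF s\<mu>[OF that] s\<nu>[OF that]])
  have v\<eta>: "vanishes_off (support (\<rho> i)) (?\<eta> i)" if "i < n" for i
    using v\<mu>[of i] v\<nu>[OF that] unfolding vanishes_off_def by simp
  have v\<eta>': "vanishes_off (chart_dom (c i)) (?\<eta> i)" if "i < n" for i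
    using v\<eta>[OF that] wD(3)[OF that] unfolding vanishes_off_def by blast
  have ig\<eta>: "surface_integrable (c i) (?\<eta> i)" if i: "i < n" for i
    by (rule surface_integrable_supported[OF w[OF i] s\<eta>[OF i] v\<eta>[OF i]])
      (rule has_pole_diff[OF weighted_near_pole(1)[OF w[OF i] _ _ log[OF i]]
          weighted_near_pole(2)[OF w[OF i] _ _ \<gamma> log[OF i]]])
  \<comment> \<open>The sum of the \<open>\<rho>\<^sub>i\<close> is constant, so the terms with a derivative of \<open>\<rho>\<^sub>i\<close> cancel.\<close>
  have sum0: "(\<Sum>i<n. ?\<eta> i k x) = 0" if k: "k \<in> A" and x: "x \<in> chart_dom k - D" for k x
  proof -
    have one: "(\<Sum>i<n. weighted (\<rho> i) \<omega> k y) = \<omega> k y" if "y \<in> chart_dom k" for y \<omega>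
    proof -
      have "y \<in> topspace X" using that dom_subset[OF k] by blast
      then have "of_real (\<Sum>i<n. \<rho> i y) = (1::complex)" using partition_sum[OF P] by simp
      then show ?thesis unfolding weighted_def sum_distrib_right[symmetric] of_real_sum[symmetric] by simp
    qed
    have "(\<Sum>i<n. ?\<nu> i k x) = del D (\<lambda>c x. \<Sum>i<n. weighted (\<rho> i) \<gamma> c x) k x"
      by (rule del_sum[OF s\<gamma> k x, symmetric]) simp
    also have "\<dots> = del D \<gamma> k x"
    proof (rule del_cong[OF _ \<gamma> k openin_topspace])
      show "(\<lambda>c x. \<Sum>i<n. weighted (\<rho> i) \<gamma> c x) \<in> smooth_forms A 0 1 D"
        by (rule smooth_forms_sum) (use s\<gamma> in simp)
    qed (use one x dom_subset[OF k] in auto)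
    finally show ?thesis using one[of x "del D \<gamma>"] x unfolding sum_subtractf by simp
  qed
  have "(\<Sum>i<n. surface_integral (c i) (?\<eta> i)) = (\<Sum>k<n. surface_integral (c k) (weighted (\<rho> k) (\<lambda>c x. \<Sum>i<n. ?\<eta> i c x)))"
    by (rule surface.it_partition[OF P wD(1) smooth_forms_law[OF s\<eta>] v\<eta>' ig\<eta>])
  also have "\<dots> = (\<Sum>k<n. 0)"
  proof (rule sum.cong[OF refl])
    fix k assume "k \<in> {..<n}"
    then have k: "c k \<in> A" using wD(1) by simp
    have "surface_integrable (c k) (\<lambda>c x. 0)" unfolding surface_integrable_def by simp
    from surface.it_cong[where \<omega>'="weighted (\<rho> k) (\<lambda>c x. \<Sum>i<n. ?\<eta> i c x)", OF k _ this]
    have "surface_integral (c k) (weighted (\<rho> k) (\<lambda>c x. \<Sum>i<n. ?\<eta> i c x)) = surface_integral (c k) (\<lambda>c x. 0)"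
      using sum0[OF k] by (simp add: weighted_def)
    then show "surface_integral (c k) (weighted (\<rho> k) (\<lambda>c x. \<Sum>i<n. ?\<eta> i c x)) = 0" unfolding surface_integral_def by simp
  qed
  finally have "0 = (\<Sum>i<n. surface_integral (c i) (?\<eta> i))" by simp
  also have "\<dots> = (\<Sum>i<n. surface_integral (c i) (?\<mu> i) - surface_integral (c i) (?\<nu> i))"
    by (intro sum.cong refl surface_integral_diff ig\<mu> ig\<nu>) auto
  also have "\<dots> = (\<Sum>i<n. surface_integral (c i) (?\<mu> i)) - (\<Sum>i<n. surface_integral (c i) (?\<nu> i))"
    by (rule sum_subtractf)
  also have "(\<Sum>i<n. surface_integral (c i) (?\<nu> i)) = (\<Sum>i<n. boundary_integral (c i) (weighted (\<rho> i) \<gamma>))"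
    by (intro sum.cong refl chart_stokes w \<gamma> pole log) auto
  finally show ?thesis by simp
qed

section \<open>Independence of the decomposition\<close>

lemma has_surface_integral_iff:
  "has_surface_integral X A \<alpha> I \<longleftrightarrow> (\<exists>n c \<rho>. partition_of_unity X A n c \<rho> \<and>
    (\<forall>i<n. surface_integrable (c i) (weighted (\<rho> i) \<alpha>)) \<and> I = (\<Sum>i<n. surface_integral (c i) (weighted (\<rho> i) \<alpha>)))"
proof -
  have "surface_integrand c r \<alpha> = (\<lambda>z. weighted r \<alpha> c (chart_inv c z) * (- 2 * \<i>))" for c r
    by (rule ext) (simp add: surface_integrand_def weighted_def)
  then show ?thesis unfolding has_surface_integral_def surface_integrable_def surface_integral_def by (simp only:)
qed

lemma has_boundary_integral_iff:
  "has_boundary_integral X A \<beta> J \<longleftrightarrow> (\<exists>n c \<rho>. partition_of_unity X A n c \<rho> \<and>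
    (\<forall>i<n. boundary_integrable (c i) (weighted (\<rho> i) \<beta>)) \<and> J = (\<Sum>i<n. boundary_integral (c i) (weighted (\<rho> i) \<beta>)))"
proof -
  have "boundary_integrand c r \<beta> = (\<lambda>t. weighted r \<beta> c (chart_inv c (complex_of_real t)))" for c r
    by (rule ext) (simp add: boundary_integrand_def weighted_def)
  then show ?thesis unfolding has_boundary_integral_def boundary_integrable_def boundary_integral_def by (simp only:)
qed

lemma adapted_partition_exists:
  obtains n c \<rho> where "partition_of_unity X A n c \<rho>" "\<And>i. i < n \<Longrightarrow> adapted_weight (c i) (\<rho> i)"
proof -
  obtain n c \<rho> where P: "partition_of_unity X A n c \<rho>"
    and ad: "\<forall>i<n. chart_dom (c i) \<inter> D = {} \<or>
      (\<exists>a\<in>D. chart_dom (c i) \<inter> D = {a} \<and> coord (c i) a = 0 \<and> open (chart_img (c i)) \<and>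
        (\<exists>N. openin X N \<and> a \<in> N \<and> (\<forall>y\<in>N. \<rho> i y = 1)))"
    using adapted_partition by (elim exE conjE) (rule that)
  show ?thesis
  proof (rule that[OF P])
    show "adapted_weight (c i) (\<rho> i)" if "i < n" for i
      unfolding adapted_weight_def using partition_weight(1,2,4)[OF P that] ad that by blast
  qed
qed

lemma decomposition_integrable:
  assumes w: "adapted_weight c r" and dec: "log_decomposition A D \<omega> \<alpha> \<beta>"
  shows "surface_integrable c (weighted r \<alpha>)" "boundary_integrable c (weighted r \<beta>)"
proof -
  note wD = adapted_weightD[OF w]
  have \<alpha>: "\<alpha> \<in> log_forms A D" and \<beta>: "\<beta> \<in> pole_forms A 0 1 D" using dec unfolding log_decomposition_def by auto
  have s: "\<alpha> \<in> smooth_forms A 1 1 D" using \<alpha> by (simp add: log_forms_def pole_forms_def)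
  show "surface_integrable c (weighted r \<alpha>)"
  proof (rule surface_integrable_supported[OF w weighted_smooth[OF wD(2) s] vanishes_off_weighted])
    fix a assume a: "a \<in> D" "a \<in> chart_dom c"
    show "has_pole c 1 (weighted r \<alpha>)"
    proof (rule weighted_near_pole(1)[OF w a log_formsD(2)[OF \<alpha> a(1) wD(1) a(2)]])
      show "coord c a = 0" by (rule adapted_weight_centre[OF w a])
    qed
  qed
  have b: "\<beta> \<in> smooth_forms A 0 1 D" using \<beta> by (simp add: pole_forms_def)
  show "boundary_integrable c (weighted r \<beta>)" by (rule boundary_integrable_weighted[OF w b])
qed

lemma decomposition_integral_sum:
  assumes P: "partition_of_unity X A n c \<rho>" and w: "\<And>i. i < n \<Longrightarrow> adapted_weight (c i) (\<rho> i)"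
    and dec: "log_decomposition A D \<omega> \<alpha> \<beta>"
    and I: "has_surface_integral X A \<alpha> I" and J: "has_boundary_integral X A \<beta> J"
  shows "I = (\<Sum>i<n. surface_integral (c i) (weighted (\<rho> i) \<alpha>))" "J = (\<Sum>i<n. boundary_integral (c i) (weighted (\<rho> i) \<beta>))"
proof -
  note ig = decomposition_integrable[OF w dec]
  have \<alpha>: "\<alpha> \<in> smooth_forms A 1 1 D" and \<beta>: "\<beta> \<in> smooth_forms A 0 1 D"
    using dec by (simp_all add: log_decomposition_def log_forms_def pole_forms_def)
  note l = smooth_forms_law[OF \<alpha>] smooth_forms_law[OF \<beta>]
  obtain m d \<sigma> where Q: "partition_of_unity X A m d \<sigma>" "\<forall>i<m. surface_integrable (d i) (weighted (\<sigma> i) \<alpha>)"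
    "I = (\<Sum>i<m. surface_integral (d i) (weighted (\<sigma> i) \<alpha>))"
    using I unfolding has_surface_integral_iff by (elim exE conjE) (rule that)
  show "I = (\<Sum>i<n. surface_integral (c i) (weighted (\<rho> i) \<alpha>))"
    unfolding Q(3) by (rule surface.it_partition_independent[OF Q(1) P l(1) _ ig(1)]) (simp_all add: Q(2))
  obtain m d \<sigma> where Q: "partition_of_unity X A m d \<sigma>" "\<forall>i<m. boundary_integrable (d i) (weighted (\<sigma> i) \<beta>)"
    "J = (\<Sum>i<m. boundary_integral (d i) (weighted (\<sigma> i) \<beta>))"
    using J unfolding has_boundary_integral_iff by (elim exE conjE) (rule that)
  show "J = (\<Sum>i<n. boundary_integral (c i) (weighted (\<rho> i) \<beta>))"
    unfolding Q(3) by (rule boundary.it_partition_independent[OF Q(1) P l(2) _ ig(2)]) (simp_all add: Q(2))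
qed

text \<open>Stokes' theorem for \<open>\<gamma> = \<beta>' - \<beta>\<close>: its poles may have any order, but \<open>\<partial>\<gamma> = \<alpha> - \<alpha>'\<close> is logarithmic.\<close>

lemma decomposition_integral_unique:
  assumes dec: "log_decomposition A D \<omega> \<alpha> \<beta>" "log_decomposition A D \<omega> \<alpha>' \<beta>'"
    and I: "has_surface_integral X A \<alpha> I" "has_surface_integral X A \<alpha>' I'"
    and J: "has_boundary_integral X A \<beta> J" "has_boundary_integral X A \<beta>' J'"
  shows "I + J = I' + J'"
proof -
  obtain n c \<rho> where P: "partition_of_unity X A n c \<rho>" and w: "\<And>i. i < n \<Longrightarrow> adapted_weight (c i) (\<rho> i)"
    by (rule adapted_partition_exists) (rule that)
  note wD = adapted_weightD[OF w]
  have \<alpha>: "\<alpha> \<in> log_forms A D" "\<alpha>' \<in> log_forms A D" and \<beta>: "\<beta> \<in> pole_forms A 0 1 D" "\<beta>' \<in> pole_forms A 0 1 D"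
    and eq: "\<And>k x. k \<in> A \<Longrightarrow> x \<in> chart_dom k - D \<Longrightarrow> \<alpha> k x + del D \<beta> k x = \<alpha>' k x + del D \<beta>' k x"
    using dec unfolding log_decomposition_def by auto
  have s\<beta>: "\<beta> \<in> smooth_forms A 0 1 D" "\<beta>' \<in> smooth_forms A 0 1 D" using \<beta> unfolding pole_forms_def by auto
  define \<gamma> where "\<gamma> = (\<lambda>k x. \<beta>' k x - \<beta> k x)"
  have \<gamma>: "\<gamma> \<in> smooth_forms A 0 1 D" unfolding \<gamma>_def by (rule smooth_forms_diff[OF s\<beta>(2,1)])
  have del\<gamma>: "del D \<gamma> k x = \<alpha> k x - \<alpha>' k x" if "k \<in> A" "x \<in> chart_dom k - D" for k x
    unfolding \<gamma>_def del_diff[OF s\<beta>(2,1) that] using eq[OF that] by (simp add: algebra_simps)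
  have centre: "coord (c i) a = 0" if "i < n" "a \<in> D" "a \<in> chart_dom (c i)" for i a
    by (rule adapted_weight_centre[OF w[OF that(1)] that(2,3)])
  have p\<gamma>: "\<exists>N. has_pole (c i) N \<gamma>" if a: "i < n" "a \<in> D" "a \<in> chart_dom (c i)" for i a
  proof -
    note ca = wD(1)[OF a(1)] a(3) centre[OF a]
    obtain N where N: "has_pole (c i) N \<beta>"
      using pole_formsD(2)[OF \<beta>(1) a(2) ca] by (elim exE) (rule that)
    obtain N' where N': "has_pole (c i) N' \<beta>'"
      using pole_formsD(2)[OF \<beta>(2) a(2) ca] by (elim exE) (rule that)
    have "has_pole (c i) (N' + N) \<beta>" unfolding add.commute[of N'] by (rule has_pole_raise[OF N])
    then have "has_pole (c i) (N' + N) \<gamma>" unfolding \<gamma>_def by (rule has_pole_diff[OF has_pole_raise[OF N']])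
    then show ?thesis ..
  qed
  have p\<gamma>': "has_pole (c i) 1 (del D \<gamma>)" if a: "i < n" "a \<in> D" "a \<in> chart_dom (c i)" for i a
  proof -
    note ca = wD(1)[OF a(1)] a(3) centre[OF a]
    have "has_pole (c i) 1 (\<lambda>k x. \<alpha> k x - \<alpha>' k x)"
      by (rule has_pole_diff[OF log_formsD(2)[OF \<alpha>(1) a(2) ca] log_formsD(2)[OF \<alpha>(2) a(2) ca]])
    then show ?thesis
      by (rule has_pole_cong[OF ca(1) a(2) ca(2,3) openin_topspace, rotated -1])
        (use a(2) DX del\<gamma>[OF ca(1)] in auto)
  qed
  have "(\<Sum>i<n. surface_integral (c i) (weighted (\<rho> i) (del D \<gamma>))) = (\<Sum>i<n. boundary_integral (c i) (weighted (\<rho> i) \<gamma>))"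
    by (rule stokes[OF P w \<gamma> p\<gamma> p\<gamma>'])
  also have "(\<Sum>i<n. boundary_integral (c i) (weighted (\<rho> i) \<gamma>)) =
      (\<Sum>i<n. boundary_integral (c i) (weighted (\<rho> i) \<beta>') - boundary_integral (c i) (weighted (\<rho> i) \<beta>))"
  proof (rule sum.cong[OF refl])
    fix i assume "i \<in> {..<n}"
    then have i: "i < n" by simp
    have "weighted (\<rho> i) \<gamma> = (\<lambda>k x. weighted (\<rho> i) \<beta>' k x - weighted (\<rho> i) \<beta> k x)"
      by (simp add: weighted_def \<gamma>_def right_diff_distrib)
    then show "boundary_integral (c i) (weighted (\<rho> i) \<gamma>) =
        boundary_integral (c i) (weighted (\<rho> i) \<beta>') - boundary_integral (c i) (weighted (\<rho> i) \<beta>)"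
      by (simp only: boundary_integral_diff[OF decomposition_integrable(2)[OF w[OF i] dec(2)] decomposition_integrable(2)[OF w[OF i] dec(1)]])
  qed
  also have "(\<Sum>i<n. surface_integral (c i) (weighted (\<rho> i) (del D \<gamma>))) =
      (\<Sum>i<n. surface_integral (c i) (weighted (\<rho> i) \<alpha>) - surface_integral (c i) (weighted (\<rho> i) \<alpha>'))"
  proof (rule sum.cong[OF refl])
    fix i assume "i \<in> {..<n}"
    then have i: "i < n" by simp
    note ig = decomposition_integrable(1)[OF w[OF i] dec(1)] decomposition_integrable(1)[OF w[OF i] dec(2)]
    let ?\<delta> = "\<lambda>k x. weighted (\<rho> i) \<alpha> k x - weighted (\<rho> i) \<alpha>' k x"
    have igd: "surface_integrable (c i) ?\<delta>"
      unfolding surface_integrable_def left_diff_distrib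
      by (rule set_integral_diff(1)[OF ig[unfolded surface_integrable_def]])
    have "?\<delta> (c i) x = weighted (\<rho> i) (del D \<gamma>) (c i) x" if x: "x \<in> chart_dom (c i) - D" for x
      using del\<gamma>[OF wD(1)[OF i] x] by (simp add: weighted_def right_diff_distrib)
    from surface.it_cong[where \<omega>="?\<delta>" and \<omega>'="weighted (\<rho> i) (del D \<gamma>)", OF wD(1)[OF i] this igd]
    show "surface_integral (c i) (weighted (\<rho> i) (del D \<gamma>)) = surface_integral (c i) (weighted (\<rho> i) \<alpha>) - surface_integral (c i) (weighted (\<rho> i) \<alpha>')"
      unfolding surface_integral_diff[OF ig, symmetric] by (rule conjunct2)
  qed
  finally show ?thesis
    using decomposition_integral_sum[OF P w dec(1) I(1) J(1)] decomposition_integral_sum[OF P w dec(2) I(2) J(2)]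
    unfolding sum_subtractf by (simp add: algebra_simps)
qed

end

theorem theorem2p4:
  fixes X :: "'a topology" and A :: "'a chart set" and D :: "'a set" and \<omega> :: "'a form"
  assumes "riemann_surface X A"
    and "compact_space X"
    and "finite D" and "D \<subseteq> topspace X" and "D \<inter> surface_boundary A = {}"
    and "\<omega> \<in> pole_forms A 1 1 D"
  shows "(\<exists>\<alpha> \<beta>. log_decomposition A D \<omega> \<alpha> \<beta>) \<and>
         (\<forall>\<alpha> \<beta>. log_decomposition A D \<omega> \<alpha> \<beta> \<longrightarrow>
            (\<exists>I. has_surface_integral X A \<alpha> I) \<and> (\<exists>J. has_boundary_integral X A \<beta> J)) \<and>
         (\<exists>C. \<forall>\<alpha> \<beta> I J. log_decomposition A D \<omega> \<alpha> \<beta> \<and>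
            has_surface_integral X A \<alpha> I \<and> has_boundary_integral X A \<beta> J \<longrightarrow> I + J = C)"
proof -
  interpret compact_marked_surface X A D
  proof
    show "\<exists>c\<in>A. a \<in> chart_dom c \<and> coord c a = 0" if "a \<in> D" for a
      using assms(6) that unfolding pole_forms_def by blast
  qed (use assms in auto)
  have ex: "\<exists>\<alpha> \<beta>. log_decomposition A D \<omega> \<alpha> \<beta>" by (rule log_decomposition_exists[OF assms(6)])
  have int: "(\<exists>I. has_surface_integral X A \<alpha> I) \<and> (\<exists>J. has_boundary_integral X A \<beta> J)"
    if dec: "log_decomposition A D \<omega> \<alpha> \<beta>" for \<alpha> \<beta>
  proof -
    obtain n c \<rho> where P: "partition_of_unity X A n c \<rho>" and w: "\<And>i. i < n \<Longrightarrow> adapted_weight (c i) (\<rho> i)"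
      by (rule adapted_partition_exists) (rule that)
    show ?thesis
      unfolding has_surface_integral_iff has_boundary_integral_iff
      using P decomposition_integrable[OF w dec] by blast
  qed
  obtain \<alpha> \<beta> where dec: "log_decomposition A D \<omega> \<alpha> \<beta>" using ex by blast
  obtain I J where IJ: "has_surface_integral X A \<alpha> I" "has_boundary_integral X A \<beta> J" using int[OF dec] by blast
  have "I' + J' = I + J" if "log_decomposition A D \<omega> \<alpha>' \<beta>' \<and>
      has_surface_integral X A \<alpha>' I' \<and> has_boundary_integral X A \<beta>' J'" for \<alpha>' \<beta>' I' J'
    by (rule decomposition_integral_unique[OF conjunct1[OF that] dec conjunct1[OF conjunct2[OF that]] IJ(1)
          conjunct2[OF conjunct2[OF that]] IJ(2)])
  then show ?thesis using ex int by blast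
qed

end
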